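(* Let $\phi\colon\mathbb D\to\mathbb D$ be analytic and $\Psi$ an Orlicz function. Then $C_\phi\colon H^\Psi\to H^\Psi$ is compact if and only if $$\sup_{\xi\in\mathbb T}\|C_\phi(u_{\xi,1-h})\|_\Psi=o\Big(\frac{1}{\Psi^{-1}(1/h)}\Big)\quad\text{as }h\to0.$$
   Context: An Orlicz function is a continuous, strictly convex, increasing $\Psi\colon[0,\infty)\to[0,\infty)$ with $\Psi(0)=0$ and $\Psi(x)/x\to\infty$. $H^\Psi$ = analytic $f$ on $\mathbb D$ with $\sup_{r<1}\|f(re^{i\cdot})\|_\Psi<\infty$, Luxemburg norm $\|g\|_\Psi=\inf\{C>0:\int_{\mathbb T}\Psi(|g|/C)\,dm\le1\}$, normed by its boundary function. $C_\phi f=f\circ\phi$. $u_{\xi,r}(z)=\big(\frac{1-r}{1-\bar\xi rz}\big)^2$. *)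

theory Defs
  imports "HOL-Analysis.Analysis" "HOL-Library.Landau_Symbols"
begin

definition strictly_convex_on :: "real set \<Rightarrow> (real \<Rightarrow> real) \<Rightarrow> bool" where
  "strictly_convex_on S f \<longleftrightarrow>
     (\<forall>x\<in>S. \<forall>y\<in>S. \<forall>t::real. x \<noteq> y \<and> 0 < t \<and> t < 1 \<longrightarrow>
        f ((1 - t) * x + t * y) < (1 - t) * f x + t * f y)"

text \<open>Orlicz function (values on negative reals are irrelevant).\<close>
definition orlicz_function :: "(real \<Rightarrow> real) \<Rightarrow> bool" where
  "orlicz_function \<Psi> \<longleftrightarrow>
     continuous_on {0..} \<Psi> \<and> strictly_convex_on {0..} \<Psi> \<and>
     strict_mono_on {0..} \<Psi> \<and> \<Psi> 0 = 0 \<and> (\<forall>x\<ge>0. \<Psi> x \<ge> 0) \<and>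
     filterlim (\<lambda>x. \<Psi> x / x) at_top at_top"

definition orlicz_inv :: "(real \<Rightarrow> real) \<Rightarrow> real \<Rightarrow> real" where
  "orlicz_inv \<Psi> = inv_into {0..} \<Psi>"

text \<open>Luxemburg norm on the unit circle with normalized arc-length measure m
  (parametrised by t in [0, 2 pi], m = dt/(2 pi)).\<close>
definition luxemburg_norm :: "(real \<Rightarrow> real) \<Rightarrow> (complex \<Rightarrow> complex) \<Rightarrow> real" where
  "luxemburg_norm \<Psi> g = Inf {C::real. 0 < C \<and>
      (\<integral>\<^sup>+ t\<in>{0..2*pi}. ennreal (\<Psi> (cmod (g (cis t)) / C)) \<partial>lborel) \<le> ennreal (2 * pi)}"

text \<open>Hardy--Orlicz norm: sup over r<1 of the Luxemburg norms of f_r (equal to the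
  Luxemburg norm of the boundary function).\<close>
definition hardy_orlicz_norm :: "(real \<Rightarrow> real) \<Rightarrow> (complex \<Rightarrow> complex) \<Rightarrow> real" where
  "hardy_orlicz_norm \<Psi> f = (SUP r\<in>{0..<1}. luxemburg_norm \<Psi> (\<lambda>z. f (of_real r * z)))"

definition hardy_orlicz :: "(real \<Rightarrow> real) \<Rightarrow> (complex \<Rightarrow> complex) set" where
  "hardy_orlicz \<Psi> = {f. f holomorphic_on ball 0 1 \<and>
      bdd_above ((\<lambda>r. luxemburg_norm \<Psi> (\<lambda>z. f (of_real r * z))) ` {0..<1})}"

definition compact_composition :: "(real \<Rightarrow> real) \<Rightarrow> (complex \<Rightarrow> complex) \<Rightarrow> bool" where
  "compact_composition \<Psi> \<phi> \<longleftrightarrow>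
     (\<forall>f\<in>hardy_orlicz \<Psi>. f \<circ> \<phi> \<in> hardy_orlicz \<Psi>) \<and>
     (\<forall>F::nat \<Rightarrow> complex \<Rightarrow> complex. (\<forall>n. F n \<in> hardy_orlicz \<Psi>) \<and>
        bdd_above (range (\<lambda>n. hardy_orlicz_norm \<Psi> (F n))) \<longrightarrow>
        (\<exists>s g. strict_mono s \<and> g \<in> hardy_orlicz \<Psi> \<and>
           (\<lambda>n. hardy_orlicz_norm \<Psi> (\<lambda>z. (F (s n) \<circ> \<phi>) z - g z)) \<longlonglongrightarrow> 0))"

definition u_kernel :: "complex \<Rightarrow> real \<Rightarrow> complex \<Rightarrow> complex" where
  "u_kernel \<xi> r z = ((1 - of_real r) / (1 - cnj \<xi> * of_real r * z)) ^ 2"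

end

(* A pull-back measure under phi satisfies more than a Carleson condition. For a boundary point xi put
   zeta = 1 - cnj xi * phi. A superharmonic function glued from Re (1/zeta) and Re (sqrt zeta) gives
     int_{|zeta| < a/8} Re (1/zeta) dm <= (32/a) m(|zeta| < a),
   so the part of the measure lying within distance h of the circle integrates Poisson kernels, hence
   sweeps subharmonic functions, with a constant comparable to
   sup_eta m(|phi - eta| < 8h) / h.
   If the Luxemburg norm of f is at most 1, then |f(z)| > c forces 1 - |z| <= 2 / Psi(c). Applying
   the sweeping estimate to (sqrt(|f|/c) - 1)^+ at depth 4 / Psi(c), for c = c_0 4^n, and summing over n
   bounds int Psi(A |f o phi|) by a small multiple of int Psi(|f|), because testing C_phi on the
   u_{xi,1-h} makes the constant at depth h at most a fixed multiple of
   (1/h) / Psi(B Psi^{-1}(1/h)), for every B and all small h. Everything is done on circles of radius r < 1, uniformly in r,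
   so that boundary values never occur.
   Conversely Psi^{-1}(1/h) u_{xi,1-h} is bounded in norm by 1 and tends to 0 locally uniformly. *)

theory Submission
  imports Defs "HOL-Complex_Analysis.Complex_Analysis"
begin

section \<open>The normalized arc-length measure\<close>

text \<open>No doubling condition on \<Psi> is available, and this shapes the sufficiency proof
  twice. First, \<open>\<Psi> (A * x)\<close> is not bounded by a multiple of
  \<open>\<Psi> x\<close>, so constants are absorbed inside \<open>\<Psi>\<close>, where convexity
  turns a scaling into a factor. This is why the window bound is used with an arbitrary B inside
  \<open>\<Psi>\<close>, and why smallness means \<open>\<Psi> (A * |f o \<phi>|)\<close> having
  integral at most 1 for each A. Secondly, a Carleson embedding for a general measure asks for a
  bound on mass over size for all windows smaller than h as well, and the quotient of
  \<open>1/h\<close> by \<open>\<Psi> (B * inv\<Psi> (1/h))\<close> need not be monotone in h, so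
  smaller windows might be relatively heavier. For a pull-back measure they are not: a subharmonic
  function of \<phi> has a mean at least its value at the origin. The glued function vanishes there,
  is at most 32/a on the window of radius a, and is very negative where \<phi> comes close to xi, so
  that mass close to xi must be paid for by mass in the larger window. Hence a single scale controls
  everything deeper, and each level c is tested at its own depth alone.\<close>

definition circ :: "real measure" where
  "circ = density lborel (\<lambda>t. ennreal (indicator {0..2*pi} t / (2*pi)))"

lemma space_circ [simp]: "space circ = UNIV"
  by (simp add: circ_def)

lemma sets_circ [simp, measurable_cong]: "sets circ = sets borel"
  by (simp add: circ_def)

lemma nn_integral_circ:
  assumes [measurable]: "f \<in> borel_measurable borel"
  shows "(\<integral>\<^sup>+ t. f t \<partial>circ) = ennreal (1 / (2*pi)) * (\<integral>\<^sup>+ t\<in>{0..2*pi}. f t \<partial>lborel)"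
proof -
  have "(\<integral>\<^sup>+ t. f t \<partial>circ) = (\<integral>\<^sup>+ t. ennreal (indicator {0..2*pi} t / (2*pi)) * f t \<partial>lborel)"
    unfolding circ_def by (rule nn_integral_density) auto
  also have "\<dots> = (\<integral>\<^sup>+ t. ennreal (1 / (2*pi)) * (f t * indicator {0..2*pi} t) \<partial>lborel)"
    by (intro nn_integral_cong) (auto simp: indicator_def)
  also have "\<dots> = ennreal (1 / (2*pi)) * (\<integral>\<^sup>+ t\<in>{0..2*pi}. f t \<partial>lborel)"
    by (rule nn_integral_cmult) auto
  finally show ?thesis .
qed

lemma emeasure_circ [simp]: "emeasure circ UNIV = 1"
proof -
  have "emeasure circ UNIV = (\<integral>\<^sup>+ t. 1 \<partial>circ)" by simp
  also have "\<dots> = ennreal (1 / (2*pi)) * ennreal (2*pi)"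
    by (subst nn_integral_circ) auto
  also have "\<dots> = 1" by (simp flip: ennreal_mult)
  finally show ?thesis .
qed

lemma measure_circ [simp]: "measure circ UNIV = 1"
  by (simp add: measure_def)

interpretation circ: finite_measure circ
  by standard simp

lemma integrable_circ_bounded:
  fixes f :: "real \<Rightarrow> real"
  assumes "f \<in> borel_measurable borel" "\<And>t. \<bar>f t\<bar> \<le> B"
  shows "integrable circ f"
  using assms by (intro circ.integrable_const_bound[where B=B]) auto

lemma integral_circ_continuous:
  fixes f :: "real \<Rightarrow> 'b::euclidean_space"
  assumes "continuous_on UNIV f"
  shows "integrable circ f" and "(\<integral>t. f t \<partial>circ) = integral {0..2*pi} f /\<^sub>R (2*pi)"
proof -
  have m [measurable]: "f \<in> borel_measurable borel"
    using assms by (rule borel_measurable_continuous_onI)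
  have si: "set_integrable lborel {0..2*pi} f"
    by (rule borel_integrable_atLeastAtMost') (rule continuous_on_subset[OF assms], auto)
  have eq: "(\<lambda>t. (indicator {0..2*pi} t / (2*pi)) *\<^sub>R f t) =
      (\<lambda>t. (1/(2*pi)) *\<^sub>R (indicator {0..2*pi} t *\<^sub>R f t))"
    by auto
  show "integrable circ f"
    unfolding circ_def
    by (subst integrable_density)
       (use si in \<open>auto simp: eq set_integrable_def simp del: scaleR_scaleR\<close>)
  have "(\<integral>t. f t \<partial>circ) = (\<integral>t. (indicator {0..2*pi} t / (2*pi)) *\<^sub>R f t \<partial>lborel)"
    unfolding circ_def by (rule integral_density) auto
  also have "\<dots> = (1/(2*pi)) *\<^sub>R (LINT t:{0..2*pi}|lborel. f t)"
    unfolding eq set_lebesgue_integral_def by (rule integral_scaleR_right)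
  also have "\<dots> = integral {0..2*pi} f /\<^sub>R (2*pi)"
    using set_borel_integral_eq_integral(2)[OF si] by (simp add: inverse_eq_divide)
  finally show "(\<integral>t. f t \<partial>circ) = integral {0..2*pi} f /\<^sub>R (2*pi)" .
qed

text \<open>Bridge from the \<open>ennreal\<close> integral in the definition of the Luxemburg norm
  to a Bochner integral over a probability measure. Continuity makes the latter meaningful, so no
  integral below is infinite.\<close>

lemma modular_circ_iff:
  assumes "continuous_on UNIV f" "\<And>t. 0 \<le> f t"
  shows "(\<integral>\<^sup>+ t\<in>{0..2*pi}. ennreal (f t) \<partial>lborel) \<le> ennreal (2*pi) \<longleftrightarrow> (\<integral>t. f t \<partial>circ) \<le> 1"
proof -
  have m [measurable]: "f \<in> borel_measurable borel"
    using assms(1) by (rule borel_measurable_continuous_onI)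
  let ?I = "\<integral>\<^sup>+ t\<in>{0..2*pi}. ennreal (f t) \<partial>lborel"
  have "ennreal (\<integral>t. f t \<partial>circ) = (\<integral>\<^sup>+ t. ennreal (f t) \<partial>circ)"
    by (rule nn_integral_eq_integral[symmetric])
       (use assms integral_circ_continuous(1) in auto)
  also have "\<dots> = ennreal (1/(2*pi)) * ?I"
    by (rule nn_integral_circ) auto
  finally have e: "ennreal (\<integral>t. f t \<partial>circ) = ennreal (1/(2*pi)) * ?I" .
  have "?I = ennreal (2*pi) * (ennreal (1/(2*pi)) * ?I)"
    by (simp add: mult.assoc[symmetric] flip: ennreal_mult)
  hence I: "?I = ennreal (2*pi * (\<integral>t. f t \<partial>circ))"
    unfolding e[symmetric] by (subst ennreal_mult) (use assms in \<open>auto intro: integral_nonneg_AE\<close>)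
  show ?thesis unfolding I
    by (subst ennreal_le_iff) auto
qed

section \<open>The Poisson kernel and subharmonic functions\<close>

definition poisson :: "complex \<Rightarrow> complex \<Rightarrow> real" where
  "poisson z \<xi> = (1 - (cmod z)\<^sup>2) / (cmod (\<xi> - z))\<^sup>2"

lemma poisson_nonneg: "cmod z \<le> 1 \<Longrightarrow> 0 \<le> poisson z \<xi>"
  unfolding poisson_def by (simp add: power_le_one)

lemma continuous_on_poisson [continuous_intros]:
  assumes "continuous_on S f" "continuous_on S g" "\<And>x. x \<in> S \<Longrightarrow> g x \<noteq> f x"
  shows "continuous_on S (\<lambda>x. poisson (f x) (g x))"
  unfolding poisson_def using assms by (intro continuous_intros) auto

lemma cis_neq_disc: "cmod z < 1 \<Longrightarrow> cis t \<noteq> z"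
  by (metis less_irrefl norm_cis)

lemma poisson_le:
  assumes "cmod z < 1" "cmod \<xi> = 1"
  shows "poisson z \<xi> \<le> 2 / (1 - cmod z)"
proof -
  have "1 - cmod z \<le> cmod (\<xi> - z)" using assms norm_triangle_ineq2[of \<xi> z] by simp
  hence "(1 - cmod z)\<^sup>2 \<le> (cmod (\<xi> - z))\<^sup>2" using assms by (intro power_mono) auto
  hence "poisson z \<xi> \<le> (1 - (cmod z)\<^sup>2) / (1 - cmod z)\<^sup>2"
    unfolding poisson_def using assms
    by (intro divide_left_mono mult_pos_pos) (auto simp: power_le_one cis_neq_disc)
  also have "\<dots> = (1 + cmod z) / (1 - cmod z)"
    using assms by (simp add: power2_eq_square divide_simps) (simp add: algebra_simps)
  also have "\<dots> \<le> 2 / (1 - cmod z)" using assms by (intro divide_right_mono) auto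
  finally show ?thesis .
qed

lemma mult_cnj_unit: "cmod \<xi> = 1 \<Longrightarrow> \<xi> * cnj \<xi> = 1"
  by (metis complex_norm_square of_real_1 power_one)

lemma cmod_one_minus_cnj_mult:
  assumes "cmod \<xi> = 1"
  shows "cmod (1 - cnj \<xi> * z) = cmod (\<xi> - z)"
proof -
  have "\<xi> * (1 - cnj \<xi> * z) = \<xi> - (\<xi> * cnj \<xi>) * z" by (simp only: right_diff_distrib mult_1_right mult.assoc)
  hence "\<xi> * (1 - cnj \<xi> * z) = \<xi> - z" using mult_cnj_unit[OF assms] by simp
  from arg_cong[OF this, of cmod] show ?thesis using assms by (simp add: norm_mult)
qed

text \<open>With \<open>w = cnj \<xi> * z\<close> this is the real part of the Herglotz kernel
  \<open>(1 + w) / (1 - w)\<close>. It makes the Poisson kernel harmonic in z and links it to the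
  quantity estimated in \<open>near_kernel_bound\<close>.\<close>

lemma poisson_eq_Re:
  assumes "cmod z < 1" "cmod \<xi> = 1"
  shows "poisson z \<xi> = 2 * Re (1 / (1 - cnj \<xi> * z)) - 1"
proof -
  define w where "w = cnj \<xi> * z"
  have nw: "cmod w = cmod z" using assms by (simp add: w_def norm_mult)
  have d: "cmod (\<xi> - z) = cmod (1 - w)"
    using cmod_one_minus_cnj_mult[OF assms(2)] by (simp add: w_def)
  have w1: "w \<noteq> 1" using nw assms by auto
  hence pos: "(1 - Re w)\<^sup>2 + (Im w)\<^sup>2 > 0"
    by (metis complex_eqI one_complex.sel right_minus_eq sum_power2_gt_zero_iff)
  have "poisson z \<xi> = (1 - (cmod w)\<^sup>2) / (cmod (1 - w))\<^sup>2"
    by (simp add: poisson_def d nw)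
  also have "\<dots> = 2 * Re (1 / (1 - w)) - 1"
  proof -
    have aux: "2 * (p / D) - 1 = (2 * p - D) / D" if "D \<noteq> 0" for p D :: real
      using that by (simp add: field_simps)
    have "2 * Re (1 / (1 - w)) - 1 = 2 * ((1 - Re w) / ((1 - Re w)\<^sup>2 + (Im w)\<^sup>2)) - 1"
      by (simp add: Re_divide)
    also have "\<dots> = (2 * (1 - Re w) - ((1 - Re w)\<^sup>2 + (Im w)\<^sup>2)) / ((1 - Re w)\<^sup>2 + (Im w)\<^sup>2)"
      by (rule aux[OF less_imp_neq[OF pos, symmetric]])
    also have "2 * (1 - Re w) - ((1 - Re w)\<^sup>2 + (Im w)\<^sup>2) = 1 - ((Re w)\<^sup>2 + (Im w)\<^sup>2)"
      by (simp add: power2_eq_square algebra_simps)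
    finally show ?thesis by (simp add: cmod_power2)
  qed
  finally show ?thesis by (simp add: w_def)
qed

lemma poisson_formula:
  assumes f: "f holomorphic_on ball 0 \<rho>" and "\<rho> > 1" "cmod z < 1"
  shows "Re (f z) = (\<integral>t. poisson z (cis t) * Re (f (cis t)) \<partial>circ)"
proof -
  \<comment> \<open>Cauchy's formula for \<open>f\<close> times a factor that equals 1 at \<open>z\<close> and turns the Cauchy kernel
      into the Poisson kernel.\<close>
  define k where "k = (\<lambda>u. f u * ((1 - (cmod z)\<^sup>2) / (1 - cnj z * u)))"
  have nz: "1 - cnj z * u \<noteq> 0" if "cmod u \<le> 1" for u
  proof
    assume "1 - cnj z * u = 0"
    hence "cmod (cnj z * u) = 1" by (metis eq_iff_diff_eq_0 norm_one)
    moreover have "cmod (cnj z * u) \<le> cmod z * 1"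
      unfolding norm_mult using that by (intro mult_mono) auto
    ultimately show False using assms by simp
  qed
  have hf: "f holomorphic_on ball 0 1" and cf: "continuous_on (cball 0 1) f"
    using f \<open>\<rho> > 1\<close> by (auto elim!: holomorphic_on_subset
        intro: holomorphic_on_imp_continuous_on)
  have "continuous_on (cball 0 1) k" "k holomorphic_on ball 0 1"
    unfolding k_def using nz by (auto intro!: continuous_intros holomorphic_intros cf hf)
  from Cauchy_integral_circlepath[OF this, of z]
  have "((\<lambda>u. k u / (u - z)) has_contour_integral (2 * of_real pi * \<i> * k z)) (circlepath 0 1)"
    using assms by simp
  hence "((\<lambda>t. (k (cis t) / (cis t - z)) * \<i> * cis t) has_integral (2 * of_real pi * \<i> * k z)) {0..2*pi}"
    unfolding circlepath_def by (subst (asm) has_contour_integral_part_circlepath_iff) auto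
  moreover have "k z = f z"
  proof -
    have "complex_of_real (1 - (cmod z)\<^sup>2) = 1 - cnj z * z"
      by (simp only: of_real_diff of_real_1 complex_norm_square mult.commute)
    thus ?thesis using nz[of z] assms unfolding k_def by simp
  qed
  moreover have "(k (cis t) / (cis t - z)) * \<i> * cis t = \<i> * (of_real (poisson z (cis t)) * f (cis t))" for t
  proof -
    define x y N where "x = cis t - z" and "y = cnj x" and "N = complex_of_real (1 - (cmod z)\<^sup>2)"
    have x: "x \<noteq> 0" "y \<noteq> 0" using cis_neq_disc[OF assms(3)] by (auto simp: x_def y_def)
    have d: "1 - cnj z * cis t = cis t * y"
      using mult_cnj_unit[of "cis t"] by (simp add: x_def y_def algebra_simps)
    have P: "complex_of_real (poisson z (cis t)) = N / (x * y)"
      unfolding poisson_def of_real_divide N_def complex_norm_square x_def y_def ..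
    have "k (cis t) = f (cis t) * (N / (cis t * y))"
      unfolding k_def d N_def ..
    thus ?thesis
      unfolding P x_def[symmetric] using x cis_neq_zero[of t] by (simp add: field_simps)
  qed
  ultimately have "((\<lambda>t. \<i> * (of_real (poisson z (cis t)) * f (cis t))) has_integral
      (\<i> * (2 * of_real pi * f z))) {0..2*pi}"
    by (simp add: mult_ac)
  from has_integral_mult_right[OF this, of "-\<i>"]
  have "((\<lambda>t. of_real (poisson z (cis t)) * f (cis t)) has_integral (2 * of_real pi * f z)) {0..2*pi}"
    by (simp add: algebra_simps)
  from has_integral_Re[OF this]
  have I: "integral {0..2*pi} (\<lambda>t. poisson z (cis t) * Re (f (cis t))) = 2 * pi * Re (f z)"
    by (simp add: integral_unique)
  have c: "continuous_on UNIV (\<lambda>t. f (cis t))"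
    by (rule continuous_on_compose2[OF cf]) (auto intro!: continuous_intros)
  have "continuous_on UNIV (\<lambda>t. poisson z (cis t) * Re (f (cis t)))"
    using cis_neq_disc[OF assms(3)] by (intro continuous_intros c) auto
  from integral_circ_continuous(2)[OF this] show ?thesis
    by (simp add: I)
qed

lemma poisson_integral_1:
  assumes "cmod z < 1"
  shows "(\<integral>t. poisson z (cis t) \<partial>circ) = 1"
  using poisson_formula[of "\<lambda>_. 1" 2 z] assms by auto

lemma Re_mean_value:
  assumes "f holomorphic_on ball 0 \<rho>" "\<rho> > 1"
  shows "(\<integral>t. Re (f (cis t)) \<partial>circ) = Re (f 0)"
  using poisson_formula[of f \<rho> 0] assms by (auto simp: poisson_def)

text \<open>A form of subharmonicity that is visibly stable under maxima, composition with increasing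
  convex functions and composition with holomorphic maps.\<close>

definition subharm_on :: "complex set \<Rightarrow> (complex \<Rightarrow> real) \<Rightarrow> bool" where
  "subharm_on S v \<longleftrightarrow> (\<forall>z\<in>S. \<exists>g e. e > 0 \<and> g holomorphic_on ball z e \<and> Re (g z) = v z \<and>
      (\<forall>w\<in>ball z e \<inter> S. Re (g w) \<le> v w))"

section \<open>The maximum principle for functions with local harmonic minorants\<close>

text \<open>At a point where \<open>v - Re p\<close> is maximal, the local minorant of v minus p has
  a real part with a local maximum, hence is constant nearby, and the maximum propagates. Choosing
  the maximum point farthest from the origin turns this into a contradiction.\<close>

lemma subharm_on_max_principle:
  assumes v: "continuous_on (cball 0 1) v" "subharm_on (ball 0 1) v"
    and p: "p holomorphic_on UNIV" and le: "\<And>z. cmod z = 1 \<Longrightarrow> v z \<le> Re (p z)"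
    and z: "cmod z < 1"
  shows "v z \<le> Re (p z)"
proof (rule ccontr)
  assume neg: "\<not> v z \<le> Re (p z)"
  define u where "u = (\<lambda>z. v z - Re (p z))"
  have cu: "continuous_on (cball 0 1) u"
    unfolding u_def using v p
    by (intro continuous_intros holomorphic_on_imp_continuous_on holomorphic_on_subset[OF p]) auto
  obtain a where a: "a \<in> cball 0 1" "\<And>w. w \<in> cball 0 1 \<Longrightarrow> u w \<le> u a"
    using continuous_attains_sup[OF _ _ cu] by (metis centre_in_cball compact_cball empty_iff zero_le_one)
  have upos: "u a > 0" using a(2)[of z] neg z by (simp add: u_def)
  \<comment> \<open>The set of maximum points is compact, so one of largest modulus exists; it is
    interior because u is at most 0 on the circle.\<close>
  define E where "E = {w \<in> cball 0 1. u w = u a}"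
  have "closed E"
    unfolding E_def by (rule continuous_closed_preimage_constant[OF cu]) auto
  hence "compact E"
    by (metis (no_types, lifting) E_def bounded_cball bounded_subset compact_eq_bounded_closed mem_Collect_eq subsetI)
  moreover have "E \<noteq> {}" using a by (auto simp: E_def)
  ultimately obtain b where b: "b \<in> E" "\<And>w. w \<in> E \<Longrightarrow> cmod w \<le> cmod b"
    using continuous_attains_sup[of E cmod] by (metis continuous_on_norm_id)
  have ub: "u b = u a" "cmod b \<le> 1" using b(1) by (auto simp: E_def)
  have "cmod b \<noteq> 1"
  proof
    assume "cmod b = 1"
    hence "u b \<le> 0" using le unfolding u_def by simp
    thus False using upos ub by simp
  qed
  hence b1: "b \<in> ball 0 1" using ub by simp
  then obtain g e where g: "e > 0" "g holomorphic_on ball b e" "Re (g b) = v b"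
      "\<And>w. w \<in> ball b e \<inter> ball 0 1 \<Longrightarrow> Re (g w) \<le> v w"
    using v(2) unfolding subharm_on_def by blast
  define d where "d = min e (1 - cmod b)"
  have d: "d > 0" using g b1 by (auto simp: d_def)
  have sub: "ball b d \<subseteq> ball b e \<inter> ball 0 1"
  proof
    fix w assume "w \<in> ball b d"
    hence "dist b w < e" "dist b w < 1 - cmod b" by (auto simp: d_def)
    moreover have "cmod w \<le> cmod b + dist b w"
      using norm_triangle_sub[of w b] by (simp add: dist_norm norm_minus_commute)
    ultimately show "w \<in> ball b e \<inter> ball 0 1" by auto
  qed
  \<comment> \<open>The exponential converts a maximum of a real part into a maximum of a
    modulus.\<close>
  define q where "q = (\<lambda>w. exp (g w - p w))"
  have qh: "q holomorphic_on ball b d"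
    unfolding q_def by (intro holomorphic_intros holomorphic_on_subset[OF p] holomorphic_on_subset[OF g(2)])
       (use sub in auto)
  have nq: "cmod (q w) \<le> cmod (q b)" if "w \<in> ball b d" for w
  proof -
    have w: "w \<in> ball b e \<inter> ball 0 1" using that sub by auto
    have "Re (g w) - Re (p w) \<le> u w" using g(4)[OF w] by (simp add: u_def)
    also have "\<dots> \<le> u b" using a(2)[of w] w ub by auto
    also have "\<dots> = Re (g b) - Re (p b)" by (simp add: u_def g(3))
    finally show ?thesis by (simp add: q_def)
  qed
  have "q constant_on ball b d"
    by (rule maximum_modulus_principle[OF qh, where U="ball b d" and \<xi>=b]) (use d nq in auto)
  hence qc: "q w = q b" if "w \<in> ball b d" for w
    using that d unfolding constant_on_def by (metis centre_in_ball)
  \<comment> \<open>A point of the same ball farther out than b; when b is 0 any direction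
    serves.\<close>
  define w where "w = b + of_real (d/2) * (if b = 0 then 1 else sgn b)"
  have wb: "w \<in> ball b d"
    using d by (simp add: w_def dist_norm norm_mult norm_sgn)
  have cw: "cmod w = cmod b + d/2"
  proof (cases "b = 0")
    case True thus ?thesis using d by (simp add: w_def)
  next
    case False
    hence "w = of_real (cmod b + d/2) * sgn b"
      by (simp add: w_def sgn_div_norm scaleR_conv_of_real field_simps)
    hence "cmod w = \<bar>cmod b + d/2\<bar>" using False by (simp only: norm_mult norm_sgn norm_of_real) simp
    thus ?thesis using d by simp
  qed
  have w: "w \<in> ball b e \<inter> ball 0 1" using wb sub by auto
  have "cmod (q w) = cmod (q b)" using qc[OF wb] by simp
  hence "Re (g w) - Re (p w) = Re (g b) - Re (p b)" by (simp add: q_def)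
  hence "u b \<le> u w" using g(3) g(4)[OF w] by (simp add: u_def)
  moreover have "u w \<le> u a" using w by (intro a(2)) auto
  ultimately have "w \<in> E" using w ub by (auto simp: E_def)
  hence "cmod w \<le> cmod b" by (rule b(2))
  thus False using cw d by simp
qed

section \<open>Trigonometric polynomials and the Poisson majorant\<close>

text \<open>Real parts of polynomials. On the circle they form an algebra, as Stone-Weierstrass
  requires, and each is the real part of an entire function, as the maximum principle
  requires.\<close>

inductive trig_poly :: "(complex \<Rightarrow> real) \<Rightarrow> bool" where
  monom: "trig_poly (\<lambda>z. Re (a * z ^ n))"
| add: "trig_poly f \<Longrightarrow> trig_poly g \<Longrightarrow> trig_poly (\<lambda>z. f z + g z)"

lemma trig_poly_holomorphic:
  "trig_poly f \<Longrightarrow> \<exists>p. p holomorphic_on UNIV \<and> (\<forall>z. f z = Re (p z))"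
proof (induction rule: trig_poly.induct)
  case (monom a n)
  have "(\<lambda>z. a * z ^ n) holomorphic_on UNIV" by (intro holomorphic_intros)
  thus ?case by blast
next
  case (add f g)
  then obtain p q where "p holomorphic_on UNIV" "q holomorphic_on UNIV"
      "\<And>z. f z = Re (p z)" "\<And>z. g z = Re (q z)" by blast
  hence "(\<lambda>z. p z + q z) holomorphic_on UNIV" "\<forall>z. f z + g z = Re (p z + q z)"
    by (auto intro: holomorphic_intros)
  thus ?case by blast
qed

lemma Re_mult_Re: "Re x * Re y = Re (x * y) / 2 + Re (x * cnj y) / 2"
  by (simp add: field_simps)

text \<open>In \<open>Re_mult_Re\<close> only the term with a conjugate leaves the class. On the
  circle \<open>cnj z\<close> is the inverse of z, so this term is a monomial of degree m - n, or
  the conjugate of one of degree n - m; the real part ignores that conjugation.\<close>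

lemma trig_poly_mult_monom:
  "\<exists>h. trig_poly h \<and> (\<forall>z\<in>sphere 0 1. Re (a * z ^ m) * Re (b * z ^ n) = h z)"
proof -
  have *: "Re (a * z ^ m * cnj (b * z ^ n)) =
      Re ((if n \<le> m then a * cnj b else cnj a * b) * z ^ (if n \<le> m then m - n else n - m))"
    if "z \<in> sphere 0 1" for z
  proof -
    have zz: "z * cnj z = 1" using that by (intro mult_cnj_unit) simp
    have pw: "z ^ k * cnj z ^ k = 1" for k
      using zz by (simp flip: power_mult_distrib)
    show ?thesis
    proof (cases "n \<le> m")
      case True
      hence "z ^ m = z ^ (m - n) * z ^ n" by (simp flip: power_add)
      hence "a * z ^ m * cnj (b * z ^ n) = a * cnj b * z ^ (m - n) * (z ^ n * cnj z ^ n)" by simp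
      hence "a * z ^ m * cnj (b * z ^ n) = a * cnj b * z ^ (m - n)" by (simp only: pw mult_1_right)
      thus ?thesis using True by (simp only: if_True)
    next
      case False
      hence "z ^ n = z ^ (n - m) * z ^ m" by (simp flip: power_add)
      hence "a * z ^ m * cnj (b * z ^ n) = cnj (cnj a * b * z ^ (n - m)) * (z ^ m * cnj z ^ m)" by simp
      also have "Re \<dots> = Re (cnj a * b * z ^ (n - m))" unfolding pw by (simp only: mult_1_right cnj.sel)
      finally have "Re (a * z ^ m * cnj (b * z ^ n)) = Re (cnj a * b * z ^ (n - m))" .
      thus ?thesis using False by (simp only: if_False)
    qed
  qed
  let ?c = "if n \<le> m then a * cnj b else cnj a * b" and ?k = "if n \<le> m then m - n else n - m"
  have "trig_poly (\<lambda>z. Re ((a*b/2) * z ^ (m+n)) + Re ((?c/2) * z ^ ?k))"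
    by (intro trig_poly.intros)
  moreover have "Re (a * z ^ m) * Re (b * z ^ n) = Re ((a*b/2) * z ^ (m+n)) + Re ((?c/2) * z ^ ?k)"
    if "z \<in> sphere 0 1" for z
  proof -
    have "a * z ^ m * (b * z ^ n) = 2 * ((a*b/2) * z ^ (m+n))" by (simp add: power_add)
    hence 1: "Re (a * z ^ m * (b * z ^ n)) / 2 = Re ((a*b/2) * z ^ (m+n))" by (simp only:) simp
    have "?c * z ^ ?k = 2 * ((?c/2) * z ^ ?k)" by simp
    hence 2: "Re (?c * z ^ ?k) / 2 = Re ((?c/2) * z ^ ?k)" by (simp only:) simp
    show ?thesis unfolding Re_mult_Re[of "a * z ^ m" "b * z ^ n"] *[OF that] 1 2 ..
  qed
  ultimately show ?thesis by blast
qed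

lemma trig_poly_mult:
  assumes "trig_poly f" "trig_poly g"
  shows "\<exists>h. trig_poly h \<and> (\<forall>z\<in>sphere 0 1. f z * g z = h z)"
  using assms(1)
proof (induction rule: trig_poly.induct)
  case (monom a m)
  show ?case using assms(2)
  proof (induction rule: trig_poly.induct)
    case (monom b n) thus ?case by (rule trig_poly_mult_monom)
  next
    case (add f g)
    then obtain h k where "trig_poly h" "trig_poly k"
      "\<And>z. z \<in> sphere 0 1 \<Longrightarrow> Re (a * z ^ m) * f z = h z"
      "\<And>z. z \<in> sphere 0 1 \<Longrightarrow> Re (a * z ^ m) * g z = k z" by blast
    thus ?case by (intro exI[of _ "\<lambda>z. h z + k z"]) (auto simp: distrib_left intro: trig_poly.add)
  qed
next
  case (add f1 f2)
  then obtain h k where "trig_poly h" "trig_poly k"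
    "\<And>z. z \<in> sphere 0 1 \<Longrightarrow> f1 z * g z = h z" "\<And>z. z \<in> sphere 0 1 \<Longrightarrow> f2 z * g z = k z" by blast
  thus ?case by (intro exI[of _ "\<lambda>z. h z + k z"]) (auto simp: distrib_right intro: trig_poly.add)
qed

lemma trig_poly_approx:
  fixes v :: "complex \<Rightarrow> real"
  assumes "continuous_on (sphere 0 1) v" "e > 0"
  obtains p where "p holomorphic_on UNIV" "\<And>z. cmod z = 1 \<Longrightarrow> \<bar>v z - Re (p z)\<bar> < e"
proof -
  define R where "R = {f :: complex \<Rightarrow> real. \<exists>h. trig_poly h \<and> (\<forall>z\<in>sphere 0 1. f z = h z)}"
  have RI: "f \<in> R" if "trig_poly h" "\<And>z. z \<in> sphere 0 1 \<Longrightarrow> f z = h z" for f h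
    using that unfolding R_def by blast
  interpret function_ring_on R "sphere 0 1 :: complex set"
  proof
    fix f assume "f \<in> R"
    then obtain h where h: "trig_poly h" "\<forall>z\<in>sphere 0 1. f z = h z" by (auto simp: R_def)
    obtain p where p: "p holomorphic_on UNIV" "\<forall>z. h z = Re (p z)"
      using trig_poly_holomorphic[OF h(1)] by blast
    have "continuous_on (sphere 0 1) (\<lambda>z. Re (p z))"
      by (intro continuous_intros holomorphic_on_imp_continuous_on holomorphic_on_subset[OF p(1)]) auto
    thus "continuous_on (sphere 0 1) f"
      by (rule continuous_on_eq) (use h p in auto)
  next
    fix f g assume "f \<in> R" "g \<in> R"
    then obtain h k where hk: "trig_poly h" "\<forall>z\<in>sphere 0 1. f z = h z"
      "trig_poly k" "\<forall>z\<in>sphere 0 1. g z = k z" by (auto simp: R_def)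
    show "(\<lambda>x. f x + g x) \<in> R"
      by (rule RI[OF trig_poly.add[OF hk(1,3)]]) (use hk in auto)
    obtain l where "trig_poly l" "\<forall>z\<in>sphere 0 1. h z * k z = l z"
      using trig_poly_mult[OF hk(1,3)] by blast
    thus "(\<lambda>x. f x * g x) \<in> R"
      using hk by (intro RI[of l]) auto
  next
    fix c :: real
    show "(\<lambda>_. c) \<in> R"
      by (rule RI[OF trig_poly.monom[of "of_real c" 0]]) auto
  next
    fix x y :: complex assume "x \<noteq> y"
    hence "Re x \<noteq> Re y \<or> Re (-\<i> * x) \<noteq> Re (-\<i> * y)" by (auto simp: complex_eq_iff)
    moreover have "(\<lambda>z. Re z) \<in> R" "(\<lambda>z. Re (-\<i> * z)) \<in> R"
      by (rule RI[OF trig_poly.monom[of 1 1]], simp, rule RI[OF trig_poly.monom[of "-\<i>" 1]], simp)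
    ultimately show "\<exists>f\<in>R. f x \<noteq> f y"
      by (elim disjE) (rule bexI[of _ "\<lambda>z. Re z"], assumption+, rule bexI[of _ "\<lambda>z. Re (-\<i> * z)"], assumption+)
  qed auto
  obtain g where g: "g \<in> R" "\<And>z. z \<in> sphere 0 1 \<Longrightarrow> \<bar>v z - g z\<bar> < e"
    using Stone_Weierstrass_basic[OF assms] by blast
  then obtain h where h: "trig_poly h" "\<forall>z\<in>sphere 0 1. g z = h z" by (auto simp: R_def)
  obtain p where "p holomorphic_on UNIV" "\<forall>z. h z = Re (p z)"
    using trig_poly_holomorphic[OF h(1)] by blast
  thus thesis using g(2) h by (intro that[of p]) auto
qed

lemma continuous_on_cis_cball:
  "continuous_on (cball 0 1) v \<Longrightarrow> continuous_on UNIV (\<lambda>t. v (cis t))"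
  by (rule continuous_on_compose2[of "cball 0 1" v]) (auto intro!: continuous_intros)

text \<open>On the circle v is sandwiched between \<open>Re q - e\<close> and \<open>Re q\<close>
  with q entire. The maximum principle passes the upper bound to z, and the Poisson formula for q
  returns to the circle at the cost of e.\<close>

theorem subharm_on_poisson_le:
  assumes v: "continuous_on (cball 0 1) v" "subharm_on (ball 0 1) v" and z: "cmod z < 1"
  shows "v z \<le> (\<integral>t. poisson z (cis t) * v (cis t) \<partial>circ)"
proof (rule field_le_epsilon)
  fix e :: real assume "e > 0"
  have "continuous_on (sphere 0 1) v" by (rule continuous_on_subset[OF v(1)]) auto
  from trig_poly_approx[OF this, of "e/2"] \<open>e > 0\<close>
  obtain p where p: "p holomorphic_on UNIV" "\<And>z. cmod z = 1 \<Longrightarrow> \<bar>v z - Re (p z)\<bar> < e/2" by auto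
  \<comment> \<open>The shift by e/2 makes the two-sided approximation a majorant.\<close>
  define q where "q = (\<lambda>z. p z + of_real (e/2))"
  have q: "q holomorphic_on UNIV" unfolding q_def by (intro holomorphic_intros p)
  have q1: "v z \<le> Re (q z)" "Re (q z) \<le> v z + e" if "cmod z = 1" for z
    using p(2)[OF that] unfolding q_def plus_complex.sel Re_complex_of_real by linarith+
  have cz: "cis t \<noteq> z" for t using z by (rule cis_neq_disc)
  have c0: "continuous_on UNIV (\<lambda>t. poisson z (cis t))"
    using cz by (intro continuous_intros) auto
  have cv: "continuous_on UNIV (\<lambda>t. v (cis t))" by (rule continuous_on_cis_cball[OF v(1)])
  have cq: "continuous_on UNIV (\<lambda>t. Re (q (cis t)))"
    by (intro continuous_intros continuous_on_compose2[OF holomorphic_on_imp_continuous_on[OF q]]) auto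
  have "v z \<le> Re (q z)" by (rule subharm_on_max_principle[OF v q q1(1) z])
  also have "\<dots> = (\<integral>t. poisson z (cis t) * Re (q (cis t)) \<partial>circ)"
    by (rule poisson_formula[of q 2]) (use q z in \<open>auto elim: holomorphic_on_subset\<close>)
  also have "\<dots> \<le> (\<integral>t. poisson z (cis t) * v (cis t) + e * poisson z (cis t) \<partial>circ)"
  proof (rule integral_mono)
    fix t
    have "poisson z (cis t) * Re (q (cis t)) \<le> poisson z (cis t) * (v (cis t) + e)"
      using z by (intro mult_left_mono q1 poisson_nonneg) auto
    thus "poisson z (cis t) * Re (q (cis t)) \<le> poisson z (cis t) * v (cis t) + e * poisson z (cis t)"
      by (simp add: algebra_simps)
  qed (intro integral_circ_continuous continuous_intros c0 cv cq)+
  also have "\<dots> = (\<integral>t. poisson z (cis t) * v (cis t) \<partial>circ) + (\<integral>t. e * poisson z (cis t) \<partial>circ)"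
    by (rule Bochner_Integration.integral_add)
       (intro integral_circ_continuous continuous_intros c0 cv)+
  also have "(\<integral>t. e * poisson z (cis t) \<partial>circ) = e * (\<integral>t. poisson z (cis t) \<partial>circ)"
    by (rule integral_mult_right_zero)
  finally show "v z \<le> (\<integral>t. poisson z (cis t) * v (cis t) \<partial>circ) + e"
    using poisson_integral_1[OF z] by simp
qed

lemma subharm_on_mean_le:
  assumes "continuous_on (cball 0 1) v" "subharm_on (ball 0 1) v"
  shows "v 0 \<le> (\<integral>t. v (cis t) \<partial>circ)"
  using subharm_on_poisson_le[OF assms, of 0] by (simp add: poisson_def)

section \<open>Image measures of circles under self-maps of the disc\<close>

lemma Re_le_subharm_on:
  assumes "open S" "z \<in> S" "U \<subseteq> S" "open U" "z \<in> U" "g holomorphic_on U" "Re (g z) = v z"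
    "\<And>w. w \<in> U \<Longrightarrow> Re (g w) \<le> v w"
  shows "\<exists>g e. e > 0 \<and> g holomorphic_on ball z e \<and> Re (g z) = v z \<and>
      (\<forall>w\<in>ball z e \<inter> S. Re (g w) \<le> v w)"
proof -
  obtain e where "e > 0" "ball z e \<subseteq> U" using assms(4,5) open_contains_ball by blast
  thus ?thesis using assms by (intro exI[of _ g] exI[of _ e]) (auto elim: holomorphic_on_subset)
qed

lemma pair_sigma_finite_circ: "pair_sigma_finite circ circ"
  by (intro pair_sigma_finite.intro circ.sigma_finite_measure_axioms)

lemma emeasure_circ_Icc:
  assumes "0 \<le> a" "a \<le> b" "b \<le> 2*pi"
  shows "emeasure circ {a..b} = ennreal ((b - a) / (2*pi))"
proof -
  have "emeasure circ {a..b} = (\<integral>\<^sup>+ t. indicator {a..b} t \<partial>circ)" by simp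
  also have "\<dots> = ennreal (1/(2*pi)) * (\<integral>\<^sup>+ t\<in>{0..2*pi}. indicator {a..b} t \<partial>lborel)"
    by (rule nn_integral_circ) auto
  also have "(\<integral>\<^sup>+ t\<in>{0..2*pi}. indicator {a..b} t \<partial>lborel) = (\<integral>\<^sup>+ t. indicator {a..b} t \<partial>lborel)"
    using assms by (intro nn_integral_cong) (auto simp: indicator_def)
  also have "\<dots> = ennreal (b - a)" using assms by simp
  finally show ?thesis using assms by (simp flip: ennreal_mult)
qed

lemma cmod_cis_diff_le: "cmod (cis s - cis t) \<le> \<bar>s - t\<bar>"
proof -
  have "cis s - cis t = cis t * (cis (s - t) - 1)"
    by (simp add: right_diff_distrib cis_mult)
  hence "cmod (cis s - cis t) = cmod (exp (\<i> * of_real (s - t)) - 1)"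
    by (simp only: norm_mult norm_cis mult_1) (simp only: cis_conv_exp)
  also have "\<dots> = 2 * \<bar>sin ((s - t)/2)\<bar>" by (rule dist_exp_i_1)
  also have "\<dots> \<le> 2 * \<bar>(s - t)/2\<bar>" by (intro mult_left_mono abs_sin_x_le_abs_x) auto
  finally show ?thesis by simp
qed

text \<open>The square root maps the right half-plane into the sector of half-angle pi/4. This is
  the origin of the factor \<open>sqrt 2\<close> in \<open>near_kernel_bound\<close>.\<close>

lemma Re_csqrt_ge:
  assumes "Re w \<ge> 0" "cmod w \<ge> 1"
  shows "sqrt 2 * Re (csqrt w) \<ge> 1"
proof -
  have "1 \<le> sqrt (cmod w + Re w)" using assms by simp
  also have "\<dots> = sqrt 2 * Re (csqrt w)" by (simp add: real_sqrt_divide)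
  finally show ?thesis .
qed

text \<open>The situation of every dilate of \<phi>: holomorphic past the closed disc, with values
  strictly inside, so all integrands on the circle are continuous.\<close>

locale disc_self_map =
  fixes \<psi> :: "complex \<Rightarrow> complex" and \<rho> :: real
  assumes rho: "\<rho> > 1" and holo: "\<psi> holomorphic_on ball 0 \<rho>"
    and maps: "\<And>z. cmod z < \<rho> \<Longrightarrow> cmod (\<psi> z) < 1"
begin

lemma holo1: "\<psi> holomorphic_on cball 0 1"
  using holo rho by (auto elim!: holomorphic_on_subset)

lemma cont: "continuous_on (cball 0 1) \<psi>"
  using holo1 by (rule holomorphic_on_imp_continuous_on)

lemma maps1: "cmod z \<le> 1 \<Longrightarrow> cmod (\<psi> z) < 1"
  using maps rho by auto

lemma maps_cis: "cmod (\<psi> (cis t)) < 1"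
  by (rule maps1) simp

lemma cont_cis: "continuous_on UNIV (\<lambda>t. \<psi> (cis t))"
  by (rule continuous_on_compose2[OF cont]) (auto intro!: continuous_intros)

lemma measurable_cis [measurable]: "(\<lambda>t. \<psi> (cis t)) \<in> borel_measurable borel"
  by (rule borel_measurable_continuous_onI[OF cont_cis])

lemma integrable_near_kernel:
  assumes "cmod \<xi> = 1"
  shows "integrable circ (\<lambda>t. if cmod (\<psi> (cis t) - \<xi>) < b then Re (1 / (1 - cnj \<xi> * \<psi> (cis t))) else 0)"
proof -
  have nz: "1 - cnj \<xi> * \<psi> (cis t) \<noteq> 0" for t
    using cmod_one_minus_cnj_mult[OF assms, of "\<psi> (cis t)"] assms maps_cis[of t]
    by (metis eq_iff_diff_eq_0 less_irrefl norm_eq_zero)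
  have c: "continuous_on UNIV (\<lambda>t. Re (1 / (1 - cnj \<xi> * \<psi> (cis t))))"
    using nz by (intro continuous_intros cont_cis) auto
  have [measurable]: "(\<lambda>t. Re (1 / (1 - cnj \<xi> * \<psi> (cis t)))) \<in> borel_measurable borel"
    by (rule borel_measurable_continuous_onI[OF c])
  show ?thesis
    by (rule Bochner_Integration.integrable_bound[OF integral_circ_continuous(1)[OF c]]) auto
qed

text \<open>The function \<open>v\<close> below is the positive part of a harmonic function except on the window
  of radius \<open>a/8\<close>, where the large term \<open>- Re (1 / \<zeta>)\<close> is kept. It vanishes at the
  origin, so its mean is nonnegative.\<close>

lemma near_kernel_bound:
  assumes \<xi>: "cmod \<xi> = 1" and a: "a > 0" "a \<le> cmod (\<psi> 0 - \<xi>)"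
  shows "(\<integral>t. (if cmod (\<psi> (cis t) - \<xi>) < a/8 then Re (1 / (1 - cnj \<xi> * \<psi> (cis t))) else 0) \<partial>circ)
     \<le> 32 / a * measure circ {t. cmod (\<psi> (cis t) - \<xi>) < a}"
proof -
  define \<zeta> where "\<zeta> = (\<lambda>z. 1 - cnj \<xi> * \<psi> z)"
  \<comment> \<open>The constants make \<open>Re (g x)\<close> nonnegative for |x| between a/16 and
    a/8: there \<open>sqrt 2 * Re (csqrt (x/a))\<close> is at most 1/2, so the first term is at
    least 16/a, while \<open>Re (1/x)\<close> is at most 16/a. For |x| at least a in the right
    half-plane both terms are at most 0.\<close>
  define g where "g = (\<lambda>x. of_real (32/a) * (1 - of_real (sqrt 2) * csqrt (x / of_real a)) - 1 / x)"
  define G where "G = (\<lambda>x. Re (g x))"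
  define V where "V = (\<lambda>x. if cmod x < a/8 then G x else max 0 (G x))"
  let ?H = "{x. Re x > 0} :: complex set"
  have oH: "open ?H" by (rule open_halfspace_Re_gt)
  have gh: "g holomorphic_on ?H"
    unfolding g_def using a
    by (intro holomorphic_intros) (auto simp: complex_nonpos_Reals_iff divide_le_0_iff)
  have G_eq: "G x = 32/a * (1 - sqrt 2 * Re (csqrt (x / of_real a))) - Re (1/x)" for x
    unfolding G_def g_def by (simp del: csqrt.simps of_real_divide)
  have Re_csqrt0: "Re (csqrt x) \<ge> 0" for x
    using csqrt_principal[of x] by (auto simp del: csqrt.simps)
  have G_mid: "G x \<ge> 0" if "a/16 \<le> cmod x" "cmod x \<le> a/8" for x
  proof -
    have "Re (csqrt (x / of_real a)) \<le> cmod (csqrt (x / of_real a))" by (rule complex_Re_le_cmod)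
    also have "\<dots> = sqrt (cmod x / a)" using a by (simp add: norm_divide)
    also have "\<dots> \<le> sqrt (1/8)" using that a by (intro real_sqrt_le_mono) (simp add: field_simps)
    finally have "sqrt 2 * Re (csqrt (x / of_real a)) \<le> sqrt 2 * sqrt (1/8)"
      by (intro mult_left_mono) auto
    also have "\<dots> = sqrt ((1/2)^2)" by (simp only: real_sqrt_mult[symmetric]) (simp add: power2_eq_square)
    also have "\<dots> = 1/2" by (subst real_sqrt_abs) simp
    finally have "32/a * (1 - sqrt 2 * Re (csqrt (x / of_real a))) \<ge> 32/a * (1/2)"
      using a by (intro mult_left_mono) auto
    moreover have "Re (1/x) \<le> cmod (1/x)" by (rule complex_Re_le_cmod)
    moreover have "cmod (1/x) \<le> 16/a"
    proof -
      have "1 / cmod x \<le> 1 / (a/16)" using that a by (intro divide_left_mono mult_pos_pos) auto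
      thus ?thesis by (simp add: norm_divide)
    qed
    ultimately show ?thesis unfolding G_eq by simp
  qed
  have G_far: "G x \<le> 0" if "Re x > 0" "cmod x \<ge> a" for x
  proof -
    have "sqrt 2 * Re (csqrt (x / of_real a)) \<ge> 1"
      using that a by (intro Re_csqrt_ge) (auto simp: norm_divide)
    hence "32/a * (1 - sqrt 2 * Re (csqrt (x / of_real a))) \<le> 0"
      using a by (intro mult_nonneg_nonpos) auto
    moreover have "Re (1/x) \<ge> 0" using that by (simp add: Re_divide)
    ultimately show ?thesis unfolding G_eq by simp
  qed
  have G_upper: "G x \<le> 32/a - Re (1/x)" for x
  proof -
    have "32/a * (1 - sqrt 2 * Re (csqrt (x / of_real a))) \<le> 32/a * 1"
      using a Re_csqrt0[of "x / of_real a"] by (intro mult_left_mono) auto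
    thus ?thesis unfolding G_eq by simp
  qed
  \<comment> \<open>The two formulas for V agree on the annulus between a/16 and a/8. This overlap
    yields continuity, and it makes the constant 0 a local minorant at the points outside the window
    where V is cut off.\<close>
  have V_outer: "V x = max 0 (G x)" if "cmod x > a/16" for x
    using G_mid[of x] that by (auto simp: V_def)
  have GV: "G x \<le> V x" for x by (simp add: V_def)
  have cG: "continuous_on ?H G"
    unfolding G_def using holomorphic_on_imp_continuous_on[OF gh] by (intro continuous_intros)
  have cV: "continuous_on ?H V"
  proof -
    let ?A = "?H \<inter> {x. cmod x < a/8}" and ?B = "?H \<inter> {x. cmod x > a/16}"
    have "open ?A" "open ?B"
      using oH by (auto intro!: open_Int open_Collect_less continuous_intros)
    moreover have "continuous_on ?A V"
      by (rule continuous_on_eq[of _ G]) (auto simp: V_def intro: continuous_on_subset[OF cG])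
    moreover have "continuous_on ?B V"
      by (rule continuous_on_eq[of _ "\<lambda>x. max 0 (G x)"])
         (auto simp: V_outer intro!: continuous_intros intro: continuous_on_subset[OF cG])
    ultimately have "continuous_on (?A \<union> ?B) V" by (rule continuous_on_open_Un)
    moreover have "?A \<union> ?B = ?H" using a by auto
    ultimately show ?thesis by simp
  qed
  have nz: "cmod (\<zeta> z) = cmod (\<psi> z - \<xi>)" for z
    unfolding \<zeta>_def cmod_one_minus_cnj_mult[OF \<xi>] by (rule norm_minus_commute)
  have Re\<zeta>: "Re (\<zeta> z) > 0" if "cmod z \<le> 1" for z
  proof -
    have "Re (cnj \<xi> * \<psi> z) \<le> cmod (cnj \<xi> * \<psi> z)" by (rule complex_Re_le_cmod)
    also have "\<dots> < 1" using maps1[OF that] \<xi> by (simp add: norm_mult)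
    finally show ?thesis by (simp add: \<zeta>_def)
  qed
  have \<zeta>h: "\<zeta> holomorphic_on ball 0 1"
    unfolding \<zeta>_def using holo1 by (intro holomorphic_intros) (auto elim: holomorphic_on_subset)
  have c\<zeta>: "continuous_on (cball 0 1) \<zeta>"
    unfolding \<zeta>_def by (intro continuous_intros cont)
  define v where "v = (\<lambda>z. V (\<zeta> z))"
  have cv: "continuous_on (cball 0 1) v"
    unfolding v_def by (rule continuous_on_compose2[OF cV c\<zeta>]) (auto simp: Re\<zeta>)
  have sv: "subharm_on (ball 0 1) v"
    unfolding subharm_on_def
  proof
    fix z :: complex assume z: "z \<in> ball 0 1"
    show "\<exists>g e. 0 < e \<and> g holomorphic_on ball z e \<and> Re (g z) = v z \<and>
           (\<forall>w\<in>ball z e \<inter> ball 0 1. Re (g w) \<le> v w)"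
    proof (cases "v z = G (\<zeta> z)")
      case True
      have "(\<lambda>z. g (\<zeta> z)) holomorphic_on ball 0 1"
        by (rule holomorphic_on_compose_gen[OF \<zeta>h gh, unfolded o_def]) (auto simp: Re\<zeta>)
      thus ?thesis
        using z True GV by (intro Re_le_subharm_on[where U="ball 0 1"]) (auto simp: v_def G_def)
    next
      case False
      hence 0: "v z = 0" "cmod (\<zeta> z) \<ge> a/8" by (auto simp: v_def V_def split: if_splits)
      let ?U = "ball 0 1 \<inter> \<zeta> -` {x. cmod x > a/16}"
      have "open ?U"
        by (rule continuous_open_preimage[OF holomorphic_on_imp_continuous_on[OF \<zeta>h]])
           (auto intro!: open_Collect_less continuous_intros)
      thus ?thesis
        using z 0 a by (intro Re_le_subharm_on[where U="?U" and g="\<lambda>_. 0"]) (auto simp: v_def V_outer)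
    qed
  qed
  let ?W = "{t. cmod (\<psi> (cis t) - \<xi>) < a}"
  let ?N = "\<lambda>t. (if cmod (\<psi> (cis t) - \<xi>) < a/8 then Re (1 / (1 - cnj \<xi> * \<psi> (cis t))) else 0)"
  have iW: "integrable circ (indicator ?W :: real \<Rightarrow> real)"
    by (rule integrable_circ_bounded[where B=1]) (auto simp: indicator_def)
  have iN: "integrable circ ?N" by (rule integrable_near_kernel[OF \<xi>])
  \<comment> \<open>The hypothesis that \<open>\<psi> 0\<close> has distance at least a from \<xi>
    enters here: the positive part is cut off at that point.\<close>
  have "v 0 = 0"
    using G_far[of "\<zeta> 0"] a Re\<zeta>[of 0] nz[of 0] by (auto simp: v_def V_def)
  hence "0 \<le> (\<integral>t. v (cis t) \<partial>circ)" using subharm_on_mean_le[OF cv sv] by simp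
  also have "\<dots> \<le> (\<integral>t. 32/a * indicator ?W t - ?N t \<partial>circ)"
  proof (rule integral_mono)
    show "integrable circ (\<lambda>t. v (cis t))"
      by (rule integral_circ_continuous(1)[OF continuous_on_cis_cball[OF cv]])
    show "integrable circ (\<lambda>t. 32/a * indicator ?W t - ?N t)"
      using iW iN by (intro Bochner_Integration.integrable_diff integrable_mult_right)
    fix t
    have Z: "Re (\<zeta> (cis t)) > 0" "cmod (\<psi> (cis t) - \<xi>) = cmod (\<zeta> (cis t))"
        "1 - cnj \<xi> * \<psi> (cis t) = \<zeta> (cis t)"
      using Re\<zeta>[of "cis t"] nz[of "cis t"] by (auto simp: \<zeta>_def)
    have "Re (1 / \<zeta> (cis t)) \<ge> 0" using Z(1) by (simp add: Re_divide)
    \<comment> \<open>Three regions: for |\<zeta>| < a/8 the singular term is kept, for a/8 up to a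
      only 32/a remains, and from a on v vanishes.\<close>
    thus "v (cis t) \<le> 32/a * indicator ?W t - ?N t"
      using G_upper[of "\<zeta> (cis t)"] G_far[OF Z(1)] a
      unfolding v_def V_def mem_Collect_eq Z(2,3) indicator_def by (auto split: if_splits)
  qed
  also have "\<dots> = 32/a * measure circ ?W - (\<integral>t. ?N t \<partial>circ)"
    using iW iN by (subst Bochner_Integration.integral_diff) (auto intro!: integrable_mult_right)
  finally show ?thesis by simp
qed

text \<open>Points at depth less than h are split by their distance to \<xi>. Closer than h,
  \<open>near_kernel_bound\<close> applies. Farther away the Poisson kernel varies little at scale h
  and can be averaged over an arc of length h, so only masses of windows enter. The radius 8h serves
  both parts, with total constant \<open>8 + 2*pi*40\<close>.\<close>

lemma kernel_bound:
  assumes h: "0 < h" "h \<le> 1" "8 * h \<le> 1 - cmod (\<psi> 0)" and \<xi>: "cmod \<xi> = 1"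
    and m: "\<And>\<eta>. cmod \<eta> = 1 \<Longrightarrow> measure circ {t. cmod (\<psi> (cis t) - \<eta>) < 8 * h} \<le> m"
  shows "(\<integral>\<^sup>+t. ennreal (if 1 - cmod (\<psi> (cis t)) < h then poisson (\<psi> (cis t)) \<xi> else 0) \<partial>circ)
     \<le> ennreal ((80 * pi + 8) * m / h)"
proof -
  let ?p = "\<lambda>t. \<psi> (cis t)"
  have m0: "0 \<le> m" using m[OF \<xi>] measure_nonneg order_trans by blast
  define N where "N = (\<lambda>t. if cmod (?p t - \<xi>) < h then 2 * Re (1 / (1 - cnj \<xi> * ?p t)) else 0)"
  define F where "F = (\<lambda>t. if 1 - cmod (?p t) < h \<and> h \<le> cmod (?p t - \<xi>) then poisson (?p t) \<xi> else 0)"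
  \<comment> \<open>A majorant, up to a constant a Poisson kernel, that dominates
    \<open>poisson p \<xi>\<close> at every point of the circle within 2h of p. The factor 20 is 2
    from \<open>1 + cmod p\<close> times 10 from \<open>1 + 3^2\<close>.\<close>
  define K where "K = (\<lambda>s. 20 * h / (h\<^sup>2 + (cmod (cis s - \<xi>))\<^sup>2))"
  define W where "W = (\<lambda>s. {t. cmod (?p t - cis s) < 8 * h})"
  have cisb [measurable]: "cis \<in> borel_measurable borel"
    by (intro borel_measurable_continuous_onI continuous_intros)
  have [measurable]: "N \<in> borel_measurable borel" "F \<in> borel_measurable borel" "K \<in> borel_measurable borel"
    unfolding N_def F_def K_def poisson_def by measurable
  have Rpos: "0 < Re (1 / (1 - cnj \<xi> * ?p t))" for t
  proof -
    have "Re (cnj \<xi> * ?p t) \<le> cmod (cnj \<xi> * ?p t)" by (rule complex_Re_le_cmod)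
    also have "\<dots> < 1" using maps_cis[of t] \<xi> by (simp add: norm_mult)
    finally have "Re (1 - cnj \<xi> * ?p t) > 0" by simp
    thus ?thesis by (subst Re_divide) (auto intro!: divide_pos_pos add_pos_nonneg simp del: minus_complex.sel)
  qed
  have K0: "K s \<ge> 0" for s using h by (simp add: K_def)
  have N_int: "(\<integral>\<^sup>+t. ennreal (N t) \<partial>circ) \<le> ennreal (8 * m / h)"
  proof -
    \<comment> \<open>With a = 8h the inner window has radius h, and the constant is 2 * 32 / 8 =
      8.\<close>
    have "cmod (\<psi> 0 - \<xi>) \<ge> 8 * h"
      using norm_triangle_ineq2[of \<xi> "\<psi> 0"] \<xi> h by (simp add: norm_minus_commute)
    with near_kernel_bound[OF \<xi>, of "8*h"] h
    have *: "(\<integral>t. (if cmod (?p t - \<xi>) < h then Re (1 / (1 - cnj \<xi> * ?p t)) else 0) \<partial>circ)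
       \<le> 32 / (8*h) * measure circ {t. cmod (?p t - \<xi>) < 8*h}" by simp
    have "(\<integral>t. N t \<partial>circ) = (\<integral>t. 2 * (if cmod (?p t - \<xi>) < h then Re (1 / (1 - cnj \<xi> * ?p t)) else 0) \<partial>circ)"
      by (rule Bochner_Integration.integral_cong) (auto simp: N_def)
    also have "\<dots> = 2 * (\<integral>t. (if cmod (?p t - \<xi>) < h then Re (1 / (1 - cnj \<xi> * ?p t)) else 0) \<partial>circ)"
      by (rule integral_mult_right_zero)
    also have "\<dots> \<le> 2 * (32 / (8*h) * measure circ {t. cmod (?p t - \<xi>) < 8*h})"
      using * by simp
    also have "\<dots> \<le> 2 * (32 / (8*h) * m)"
      using h by (intro mult_left_mono m \<xi>) auto
    finally have I: "(\<integral>t. N t \<partial>circ) \<le> 8 * m / h" by simp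
    have "integrable circ N" unfolding N_def
      using integrable_mult_right[OF integrable_near_kernel[OF \<xi>, of h], of 2]
      by (simp add: if_distrib[of "\<lambda>x. 2 * x"] cong: if_cong)
    hence "(\<integral>\<^sup>+t. ennreal (N t) \<partial>circ) = ennreal (\<integral>t. N t \<partial>circ)"
      by (rule nn_integral_eq_integral) (use Rpos in \<open>auto simp: N_def less_imp_le\<close>)
    thus ?thesis using I by (simp add: ennreal_leI)
  qed
  have K_int: "(\<integral>\<^sup>+s. ennreal (K s) \<partial>circ) \<le> ennreal 40"
  proof -
    \<comment> \<open>Comparison with the Poisson kernel at depth h, whose integral is 1.\<close>
    define z where "z = of_real (1 - h) * \<xi>"
    have nz: "cmod z = 1 - h" using h \<xi> by (simp add: z_def norm_mult del: of_real_diff)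
    hence z: "cmod z < 1" using h by simp
    have "K s \<le> 40 * poisson z (cis s)" for s
    proof -
      have cs: "cis s \<noteq> z" by (rule cis_neq_disc[OF z])
      have "cmod (cis s - z) \<le> cmod (cis s - \<xi>) + cmod (\<xi> - z)"
        using norm_triangle_ineq[of "cis s - \<xi>" "\<xi> - z"] by simp
      also have "\<xi> - z = of_real h * \<xi>" by (simp add: z_def algebra_simps)
      also have "cmod \<dots> = h" using h \<xi> by (simp add: norm_mult)
      finally have "(cmod (cis s - z))\<^sup>2 \<le> (cmod (cis s - \<xi>) + h)\<^sup>2" by (intro power_mono) auto
      also have "\<dots> \<le> 2 * (h\<^sup>2 + (cmod (cis s - \<xi>))\<^sup>2)"
        using sum_squares_bound[of "cmod (cis s - \<xi>)" h] by (simp add: power2_sum)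
      finally have le: "(cmod (cis s - z))\<^sup>2 \<le> 2 * (h\<^sup>2 + (cmod (cis s - \<xi>))\<^sup>2)" .
      have "20 * h / D = 40 * (h / (2 * D))" for D :: real by simp
      hence "K s = 40 * (h / (2 * (h\<^sup>2 + (cmod (cis s - \<xi>))\<^sup>2)))"
        unfolding K_def .
      also have "\<dots> \<le> 40 * (h / (cmod (cis s - z))\<^sup>2)"
        using le h cs by (intro mult_left_mono divide_left_mono mult_pos_pos)
          (auto intro!: add_pos_nonneg)
      also have "\<dots> \<le> 40 * poisson z (cis s)"
        unfolding poisson_def nz using h
        by (intro mult_left_mono divide_right_mono) (auto simp: power2_eq_square algebra_simps mult_left_le)
      finally show ?thesis .
    qed
    hence "(\<integral>\<^sup>+s. ennreal (K s) \<partial>circ) \<le> (\<integral>\<^sup>+s. ennreal (40 * poisson z (cis s)) \<partial>circ)"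
      by (intro nn_integral_mono ennreal_leI) auto
    also have "\<dots> = ennreal (\<integral>s. 40 * poisson z (cis s) \<partial>circ)"
      using z cis_neq_disc[OF z] poisson_nonneg[of z]
      by (intro nn_integral_eq_integral integral_circ_continuous continuous_intros) auto
    also have "(\<integral>s. 40 * poisson z (cis s) \<partial>circ) = 40 * (\<integral>s. poisson z (cis s) \<partial>circ)"
      by (rule integral_mult_right_zero)
    finally show ?thesis using poisson_integral_1[OF z] by simp
  qed
  \<comment> \<open>The value at t is replaced by an average over an arc of angles s, of measure
    h/(2 pi), for each of which t belongs to \<open>W s\<close>. Fubini then produces the masses of
    these windows.\<close>
  have F_le: "ennreal (F t) \<le> (\<integral>\<^sup>+s. ennreal (2*pi/h * K s) * indicator (W s) t \<partial>circ)" for t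
  proof (cases "1 - cmod (?p t) < h \<and> h \<le> cmod (?p t - \<xi>)")
    case False
    hence "F t = 0" unfolding F_def by (rule if_not_P)
    thus ?thesis by simp
  next
    case True
    define p where "p = ?p t"
    have p: "1 - cmod p < h" "h \<le> cmod (p - \<xi>)" "cmod p < 1"
      using True maps_cis[of t] by (auto simp: p_def)
    have t0: "0 \<le> Arg2pi p" "Arg2pi p < 2*pi" "p = of_real (cmod p) * cis (Arg2pi p)"
      using Arg2pi[of p] by (auto simp: is_Arg_def cis_conv_exp)
    define t0 where "t0 = Arg2pi p"
    note t0 = t0[folded t0_def]
    have pt0: "cmod (cis t0 - p) < h"
    proof -
      have "cis t0 - p = of_real (1 - cmod p) * cis t0" by (subst t0(3)) (simp add: algebra_simps)
      thus ?thesis using p by (simp add: norm_mult del: of_real_diff)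
    qed
    \<comment> \<open>The measure \<open>circ\<close> lives on angles between 0 and 2 pi, so the arc
      is taken to the left of \<open>t0\<close> when it would stick out on the right.\<close>
    define c where "c = (if t0 + h \<le> 2*pi then t0 else t0 - h)"
    have c: "0 \<le> c" "c + h \<le> 2*pi" "\<And>s. s \<in> {c..c+h} \<Longrightarrow> \<bar>s - t0\<bar> \<le> h"
      using t0 h pi_gt3 by (auto simp: c_def split: if_splits)
    have P: "poisson p \<xi> \<le> K s \<and> cmod (p - cis s) < 8 * h" if s: "s \<in> {c..c+h}" for s
    proof -
      have "cmod (cis s - cis t0) \<le> h" using cmod_cis_diff_le[of s t0] c(3)[OF s] by simp
      hence d: "cmod (cis s - p) < 2 * h"
        using norm_triangle_ineq[of "cis s - cis t0" "cis t0 - p"] pt0 by simp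
      have "cmod (cis s - \<xi>) \<le> cmod (cis s - p) + cmod (p - \<xi>)"
        using norm_triangle_ineq[of "cis s - p" "p - \<xi>"] by simp
      also have "\<dots> \<le> 3 * cmod (p - \<xi>)" using d p by simp
      finally have "(cmod (cis s - \<xi>))\<^sup>2 \<le> (3 * cmod (p - \<xi>))\<^sup>2" by (intro power_mono) auto
      moreover have "h\<^sup>2 \<le> (cmod (p - \<xi>))\<^sup>2" using p h by (intro power_mono) auto
      ultimately have "h\<^sup>2 + (cmod (cis s - \<xi>))\<^sup>2 \<le> 10 * (cmod (\<xi> - p))\<^sup>2"
        by (simp add: power_mult_distrib norm_minus_commute)
      moreover have "h\<^sup>2 + (cmod (cis s - \<xi>))\<^sup>2 > 0" using h by (intro add_pos_nonneg) auto
      ultimately have "2 * h / (cmod (\<xi> - p))\<^sup>2 \<le> K s"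
        unfolding K_def using h by (simp add: divide_simps zero_less_mult_iff)
      moreover have "poisson p \<xi> \<le> 2 * h / (cmod (\<xi> - p))\<^sup>2"
      proof -
        have "1 - (cmod p)\<^sup>2 = (1 - cmod p) * (1 + cmod p)" by (simp add: power2_eq_square algebra_simps)
        also have "\<dots> \<le> h * 2" using p h by (intro mult_mono) auto
        finally show ?thesis unfolding poisson_def by (intro divide_right_mono) auto
      qed
      ultimately show ?thesis using d h by (simp add: norm_minus_commute)
    qed
    have "ennreal (F t) = ennreal (poisson p \<xi>)" using True by (simp add: F_def p_def)
    also have "\<dots> = ennreal (2*pi/h * poisson p \<xi>) * ennreal (h / (2*pi))"
      using h poisson_nonneg[of p \<xi>] p by (simp flip: ennreal_mult)
    also have "\<dots> = ennreal (2*pi/h * poisson p \<xi>) * emeasure circ {c..c+h}"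
      using c h by (subst emeasure_circ_Icc) auto
    also have "\<dots> = (\<integral>\<^sup>+s. ennreal (2*pi/h * poisson p \<xi>) * indicator {c..c+h} s \<partial>circ)"
      by (rule nn_integral_cmult_indicator[symmetric]) simp
    also have "\<dots> \<le> (\<integral>\<^sup>+s. ennreal (2*pi/h * K s) * indicator (W s) t \<partial>circ)"
    proof (rule nn_integral_mono)
      fix s
      show "ennreal (2*pi/h * poisson p \<xi>) * indicator {c..c+h} s \<le> ennreal (2*pi/h * K s) * indicator (W s) t"
      proof (cases "s \<in> {c..c+h}")
        case True
        hence "ennreal (2*pi/h * poisson p \<xi>) \<le> ennreal (2*pi/h * K s)"
          using P[OF True] h by (intro ennreal_leI mult_left_mono) auto
        moreover have "t \<in> W s" using P[OF True] by (simp add: W_def p_def)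
        ultimately show ?thesis using True by simp
      qed simp
    qed
    finally show ?thesis .
  qed
  have F_int: "(\<integral>\<^sup>+t. ennreal (F t) \<partial>circ) \<le> ennreal (80 * pi * m / h)"
  proof -
    interpret C: pair_sigma_finite circ circ by (rule pair_sigma_finite_circ)
    have meas: "(\<lambda>(t, s). ennreal (2*pi/h * K s) * indicator {x. cmod x < 8 * h} (?p t - cis s))
       \<in> borel_measurable (circ \<Otimes>\<^sub>M circ)"
      by measurable
    have ind: "indicator (W s) t = (indicator {x. cmod x < 8 * h} (?p t - cis s) :: ennreal)" for s t
      by (simp add: W_def indicator_def)
    have Wm: "W s \<in> sets circ" for s unfolding W_def by simp
    have "(\<integral>\<^sup>+t. ennreal (F t) \<partial>circ) \<le> (\<integral>\<^sup>+t. (\<integral>\<^sup>+s. ennreal (2*pi/h * K s) * indicator (W s) t \<partial>circ) \<partial>circ)"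
      by (intro nn_integral_mono F_le)
    also have "\<dots> = (\<integral>\<^sup>+s. (\<integral>\<^sup>+t. ennreal (2*pi/h * K s) * indicator (W s) t \<partial>circ) \<partial>circ)"
      unfolding ind by (rule C.Fubini'[symmetric, OF meas])
    also have "\<dots> = (\<integral>\<^sup>+s. ennreal (2*pi/h * K s) * emeasure circ (W s) \<partial>circ)"
      by (intro nn_integral_cong nn_integral_cmult_indicator Wm)
    also have "\<dots> \<le> (\<integral>\<^sup>+s. ennreal (2*pi/h*m) * ennreal (K s) \<partial>circ)"
    proof (rule nn_integral_mono)
      fix s
      have "ennreal (2*pi/h * K s) * emeasure circ (W s) = ennreal (2*pi/h * K s * measure circ (W s))"
        unfolding circ.emeasure_eq_measure using h K0[of s] by (intro ennreal_mult[symmetric]) auto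
      also have "\<dots> \<le> ennreal (2*pi/h * K s * m)"
        using h K0[of s] m[of "cis s"] unfolding W_def by (intro ennreal_leI mult_left_mono) auto
      finally show "ennreal (2*pi/h * K s) * emeasure circ (W s) \<le> ennreal (2*pi/h*m) * ennreal (K s)"
        using h m0 K0[of s] by (simp add: mult_ac flip: ennreal_mult)
    qed
    also have "\<dots> = ennreal (2*pi/h*m) * (\<integral>\<^sup>+s. ennreal (K s) \<partial>circ)"
      by (rule nn_integral_cmult) simp
    also have "\<dots> \<le> ennreal (2*pi/h*m) * ennreal 40"
      by (rule mult_left_mono[OF K_int]) simp
    also have "\<dots> = ennreal (80 * pi * m / h)"
      using h m0 by (subst ennreal_mult[symmetric]) auto
    finally show ?thesis .
  qed
  have "(\<integral>\<^sup>+t. ennreal (if 1 - cmod (?p t) < h then poisson (?p t) \<xi> else 0) \<partial>circ)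
     \<le> (\<integral>\<^sup>+t. ennreal (N t) + ennreal (F t) \<partial>circ)"
  proof (rule nn_integral_mono)
    fix t
    have "(if 1 - cmod (?p t) < h then poisson (?p t) \<xi> else 0) \<le> N t + F t"
      using poisson_eq_Re[OF maps_cis \<xi>, of t] Rpos[of t] poisson_nonneg[of "?p t" \<xi>] maps_cis[of t]
      unfolding N_def F_def by (auto simp: not_less)
    moreover have "N t \<ge> 0" "F t \<ge> 0"
      using Rpos[of t] poisson_nonneg[of "?p t" \<xi>] maps_cis[of t] by (auto simp: N_def F_def less_imp_le)
    ultimately show "ennreal (if 1 - cmod (?p t) < h then poisson (?p t) \<xi> else 0) \<le> ennreal (N t) + ennreal (F t)"
      by (simp add: ennreal_leI flip: ennreal_plus)
  qed
  also have "\<dots> = (\<integral>\<^sup>+t. ennreal (N t) \<partial>circ) + (\<integral>\<^sup>+t. ennreal (F t) \<partial>circ)"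
    by (rule nn_integral_add) auto
  also have "\<dots> \<le> ennreal (8 * m / h) + ennreal (80 * pi * m / h)"
    by (intro add_mono N_int F_int)
  also have "\<dots> = ennreal ((80 * pi + 8) * m / h)"
    using h m0 by (simp add: add_divide_distrib distrib_right flip: ennreal_plus)
  finally show ?thesis .
qed

section \<open>Sweeping subharmonic functions to the circle\<close>

text \<open>Replace w at \<open>\<psi> (cis t)\<close> by its Poisson majorant and exchange the
  integrals. The inner integral is the density, at \<open>cis s\<close>, of the image measure swept
  to the circle, and \<kappa> bounds it. The predicate Q selects the part of the measure to be
  swept.\<close>

lemma subharm_on_comp_integral_le:
  assumes w: "continuous_on (cball 0 1) w" "subharm_on (ball 0 1) w" "\<And>z. cmod z \<le> 1 \<Longrightarrow> 0 \<le> w z"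
    and Q [measurable]: "Measurable.pred borel Q" and \<kappa>0: "0 \<le> \<kappa>"
    and \<kappa>: "\<And>\<xi>. cmod \<xi> = 1 \<Longrightarrow>
      (\<integral>\<^sup>+t. ennreal (if Q t then poisson (\<psi> (cis t)) \<xi> else 0) \<partial>circ) \<le> ennreal \<kappa>"
  shows "(\<integral>t. (if Q t then w (\<psi> (cis t)) else 0) \<partial>circ) \<le> \<kappa> * (\<integral>s. w (cis s) \<partial>circ)"
proof -
  interpret C: pair_sigma_finite circ circ by (rule pair_sigma_finite_circ)
  have cisb [measurable]: "cis \<in> borel_measurable borel"
    by (intro borel_measurable_continuous_onI continuous_intros)
  have cw: "continuous_on UNIV (\<lambda>t. w (cis t))" by (rule continuous_on_cis_cball[OF w(1)])
  have [measurable]: "(\<lambda>t. w (cis t)) \<in> borel_measurable borel"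
    by (rule borel_measurable_continuous_onI[OF cw])
  have cwp: "continuous_on UNIV (\<lambda>t. w (\<psi> (cis t)))"
    by (rule continuous_on_compose2[OF w(1) cont_cis]) (use maps_cis in \<open>auto simp: less_imp_le\<close>)
  have [measurable]: "(\<lambda>t. w (\<psi> (cis t))) \<in> borel_measurable borel"
    by (rule borel_measurable_continuous_onI[OF cwp])
  have wp0: "0 \<le> w (\<psi> (cis t))" for t using w(3) maps_cis[of t] by (simp add: less_imp_le)
  have ws0: "0 \<le> w (cis t)" for t using w(3) by simp
  define k where "k = (\<lambda>t \<xi>. if Q t then poisson (\<psi> (cis t)) \<xi> else 0)"
  have k0: "k t \<xi> \<ge> 0" for t \<xi> using poisson_nonneg maps_cis[of t] by (simp add: k_def less_imp_le)
  have meas: "(\<lambda>(t, s). ennreal (k t (cis s)) * ennreal (w (cis s))) \<in> borel_measurable (circ \<Otimes>\<^sub>M circ)"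
    unfolding k_def poisson_def by measurable
  have pt: "ennreal (if Q t then w (\<psi> (cis t)) else 0) \<le> (\<integral>\<^sup>+s. ennreal (k t (cis s)) * ennreal (w (cis s)) \<partial>circ)" for t
  proof (cases "Q t")
    case True
    have c: "continuous_on UNIV (\<lambda>s. poisson (\<psi> (cis t)) (cis s) * w (cis s))"
      using cis_neq_disc[OF maps_cis] by (intro continuous_intros cw) auto
    have "w (\<psi> (cis t)) \<le> (\<integral>s. poisson (\<psi> (cis t)) (cis s) * w (cis s) \<partial>circ)"
      by (rule subharm_on_poisson_le[OF w(1,2) maps_cis])
    hence "ennreal (w (\<psi> (cis t))) \<le> ennreal (\<integral>s. poisson (\<psi> (cis t)) (cis s) * w (cis s) \<partial>circ)"
      by (rule ennreal_leI)
    also have "\<dots> = (\<integral>\<^sup>+s. ennreal (poisson (\<psi> (cis t)) (cis s) * w (cis s)) \<partial>circ)"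
      using poisson_nonneg maps_cis[of t] ws0
      by (intro nn_integral_eq_integral[symmetric] integral_circ_continuous(1)[OF c]) (auto simp: less_imp_le)
    finally show ?thesis using True poisson_nonneg maps_cis[of t] ws0
      by (simp add: k_def ennreal_mult less_imp_le)
  qed simp
  have int: "integrable circ (\<lambda>t. if Q t then w (\<psi> (cis t)) else 0)"
    by (rule Bochner_Integration.integrable_bound[OF integral_circ_continuous(1)[OF cwp]]) (use wp0 in auto)
  have "ennreal (\<integral>t. (if Q t then w (\<psi> (cis t)) else 0) \<partial>circ) = (\<integral>\<^sup>+t. ennreal (if Q t then w (\<psi> (cis t)) else 0) \<partial>circ)"
    using wp0 by (intro nn_integral_eq_integral[symmetric] int) auto
  also have "\<dots> \<le> (\<integral>\<^sup>+t. (\<integral>\<^sup>+s. ennreal (k t (cis s)) * ennreal (w (cis s)) \<partial>circ) \<partial>circ)"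
    by (intro nn_integral_mono pt)
  also have "\<dots> = (\<integral>\<^sup>+s. (\<integral>\<^sup>+t. ennreal (k t (cis s)) * ennreal (w (cis s)) \<partial>circ) \<partial>circ)"
    by (rule C.Fubini'[symmetric, OF meas])
  also have "\<dots> = (\<integral>\<^sup>+s. (\<integral>\<^sup>+t. ennreal (k t (cis s)) \<partial>circ) * ennreal (w (cis s)) \<partial>circ)"
    by (intro nn_integral_cong nn_integral_multc) (unfold k_def poisson_def, measurable)
  also have "\<dots> \<le> (\<integral>\<^sup>+s. ennreal \<kappa> * ennreal (w (cis s)) \<partial>circ)"
    unfolding k_def by (intro nn_integral_mono mult_right_mono \<kappa>) auto
  also have "\<dots> = ennreal \<kappa> * (\<integral>\<^sup>+s. ennreal (w (cis s)) \<partial>circ)"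
    by (rule nn_integral_cmult) simp
  also have "(\<integral>\<^sup>+s. ennreal (w (cis s)) \<partial>circ) = ennreal (\<integral>s. w (cis s) \<partial>circ)"
    using ws0 by (intro nn_integral_eq_integral integral_circ_continuous(1)[OF cw]) auto
  also have "ennreal \<kappa> * \<dots> = ennreal (\<kappa> * (\<integral>s. w (cis s) \<partial>circ))"
    using \<kappa>0 ws0 by (subst ennreal_mult) (auto intro: integral_nonneg_AE)
  finally show ?thesis
    using \<kappa>0 ws0 by (subst (asm) ennreal_le_iff) (auto intro!: integral_nonneg_AE mult_nonneg_nonneg)
qed

text \<open>Littlewood subordination: the whole image measure sweeps to harmonic measure at
  \<open>\<psi> 0\<close>, since the Poisson kernel is harmonic in its first argument and the mean
  value property gives the density \<open>poisson (\<psi> 0) \<xi>\<close>.\<close>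

lemma littlewood_integral_le:
  assumes w: "continuous_on (cball 0 1) w" "subharm_on (ball 0 1) w" "\<And>z. cmod z \<le> 1 \<Longrightarrow> 0 \<le> w z"
  shows "(\<integral>t. w (\<psi> (cis t)) \<partial>circ) \<le> 2 / (1 - cmod (\<psi> 0)) * (\<integral>s. w (cis s) \<partial>circ)"
proof -
  have p0: "cmod (\<psi> 0) < 1" by (rule maps1) simp
  have "(\<integral>\<^sup>+t. ennreal (poisson (\<psi> (cis t)) \<xi>) \<partial>circ) \<le> ennreal (2 / (1 - cmod (\<psi> 0)))" if \<xi>: "cmod \<xi> = 1" for \<xi>
  proof -
    define f where "f = (\<lambda>z. 2 * (1 / (1 - cnj \<xi> * \<psi> z)) - 1)"
    have nz: "1 - cnj \<xi> * \<psi> z \<noteq> 0" if "cmod z < \<rho>" for z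
    proof
      assume "1 - cnj \<xi> * \<psi> z = 0"
      hence "cmod (cnj \<xi> * \<psi> z) = 1" by (metis eq_iff_diff_eq_0 norm_one)
      thus False using maps[OF that] \<xi> by (simp add: norm_mult)
    qed
    have fh: "f holomorphic_on ball 0 \<rho>"
      unfolding f_def using nz by (intro holomorphic_intros holo) auto
    have P: "poisson (\<psi> z) \<xi> = Re (f z)" if "cmod z < \<rho>" for z
      using poisson_eq_Re[OF maps[OF that] \<xi>] by (simp add: f_def Re_divide)
    have c: "continuous_on UNIV (\<lambda>t. poisson (\<psi> (cis t)) \<xi>)"
      using maps_cis \<xi> by (intro continuous_intros cont_cis) (metis less_irrefl)
    have "(\<integral>\<^sup>+t. ennreal (poisson (\<psi> (cis t)) \<xi>) \<partial>circ) = ennreal (\<integral>t. poisson (\<psi> (cis t)) \<xi> \<partial>circ)"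
      using poisson_nonneg maps_cis
      by (intro nn_integral_eq_integral integral_circ_continuous(1)[OF c]) (auto simp: less_imp_le)
    also have "(\<integral>t. poisson (\<psi> (cis t)) \<xi> \<partial>circ) = (\<integral>t. Re (f (cis t)) \<partial>circ)"
      using rho by (intro Bochner_Integration.integral_cong P) auto
    also have "\<dots> = poisson (\<psi> 0) \<xi>"
      using Re_mean_value[OF fh rho] P[of 0] rho by simp
    finally show ?thesis using poisson_le[OF p0 \<xi>] by (simp add: ennreal_leI)
  qed
  thus ?thesis
    using subharm_on_comp_integral_le[OF w(1,2), of "\<lambda>_. True" "2 / (1 - cmod (\<psi> 0))"] w(3) p0
    by simp
qed

end

section \<open>Orlicz functions and Hardy--Orlicz norms\<close>

lemma ex_unimodular: "\<exists>u. cmod u = 1 \<and> u * w = of_real (cmod w)"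
proof (cases "w = 0")
  case True thus ?thesis by (intro exI[of _ 1]) auto
next
  case False
  hence s: "cmod (sgn w) = 1" by (simp add: norm_sgn)
  have "w = of_real (cmod w) * sgn w" using False by (simp add: sgn_eq)
  hence "cnj (sgn w) * w = of_real (cmod w) * (sgn w * cnj (sgn w))"
    by (metis mult.assoc mult.commute)
  thus ?thesis using s mult_cnj_unit[OF s] by (intro exI[of _ "cnj (sgn w)"]) simp
qed

locale orlicz =
  fixes \<Psi> :: "real \<Rightarrow> real"
  assumes orlicz: "orlicz_function \<Psi>"
begin

lemma cont_\<Psi>: "continuous_on {0..} \<Psi>"
  using orlicz by (simp add: orlicz_function_def)

lemma \<Psi>_0 [simp]: "\<Psi> 0 = 0"
  using orlicz by (simp add: orlicz_function_def)

lemma \<Psi>_nonneg: "0 \<le> x \<Longrightarrow> 0 \<le> \<Psi> x"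
  using orlicz by (simp add: orlicz_function_def)

lemma \<Psi>_less: "0 \<le> x \<Longrightarrow> x < y \<Longrightarrow> \<Psi> x < \<Psi> y"
  using orlicz by (auto simp: orlicz_function_def strict_mono_on_def)

lemma \<Psi>_mono: "0 \<le> x \<Longrightarrow> x \<le> y \<Longrightarrow> \<Psi> x \<le> \<Psi> y"
  using \<Psi>_less[of x y] by (cases "x = y") auto

lemma \<Psi>_pos: "0 < x \<Longrightarrow> 0 < \<Psi> x"
  using \<Psi>_less[of 0 x] by simp

lemma \<Psi>_less_iff: "0 \<le> x \<Longrightarrow> 0 \<le> y \<Longrightarrow> \<Psi> x < \<Psi> y \<longleftrightarrow> x < y"
  using \<Psi>_less[of x y] \<Psi>_mono[of y x] by linarith

lemma \<Psi>_le_iff: "0 \<le> x \<Longrightarrow> 0 \<le> y \<Longrightarrow> \<Psi> x \<le> \<Psi> y \<longleftrightarrow> x \<le> y"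
  using \<Psi>_less_iff[of y x] by linarith

lemma convex_\<Psi>: "convex_on {0..} \<Psi>"
proof (rule convex_onI)
  fix t x y :: real assume *: "0 < t" "t < 1" "x \<in> {0..}" "y \<in> {0..}"
  show "\<Psi> ((1 - t) *\<^sub>R x + t *\<^sub>R y) \<le> (1 - t) * \<Psi> x + t * \<Psi> y"
  proof (cases "x = y")
    case True thus ?thesis by (simp flip: scaleR_left.add distrib_right)
  next
    case False
    hence "\<Psi> ((1 - t) * x + t * y) < (1 - t) * \<Psi> x + t * \<Psi> y"
      using orlicz * unfolding orlicz_function_def strictly_convex_on_def by blast
    thus ?thesis by simp
  qed
qed auto

lemma \<Psi>_scale_le:
  assumes "0 \<le> c" "c \<le> 1" "0 \<le> x"
  shows "\<Psi> (c * x) \<le> c * \<Psi> x"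
  using convex_onD[OF convex_\<Psi>, of c 0 x] assms by simp

lemma \<Psi>_scale_ge:
  assumes "1 \<le> c" "0 \<le> x"
  shows "c * \<Psi> x \<le> \<Psi> (c * x)"
  using \<Psi>_scale_le[of "1/c" "c * x"] assms by (simp add: field_simps)

lemma \<Psi>_average_le:
  assumes "0 \<le> x" "0 \<le> y"
  shows "\<Psi> ((x + y) / 2) \<le> (\<Psi> x + \<Psi> y) / 2"
  using convex_onD[OF convex_\<Psi>, of "1/2" x y] assms by (simp add: field_simps)

text \<open>Superlinearity in the form used later: it makes \<Psi> onto, and it bounds
  \<open>inv\<Psi> (1/h)\<close> by \<open>a + 1/h\<close>.\<close>

lemma \<Psi>_growth: "\<exists>a\<ge>0. \<forall>x\<ge>0. x \<le> a + \<Psi> x"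
proof -
  have "eventually (\<lambda>x. 1 \<le> \<Psi> x / x) at_top"
    using orlicz unfolding orlicz_function_def filterlim_at_top by blast
  then obtain a where a: "\<And>x. x \<ge> a \<Longrightarrow> 1 \<le> \<Psi> x / x" by (auto simp: eventually_at_top_linorder)
  have "x \<le> max a 1 + \<Psi> x" if "x \<ge> 0" for x
  proof (cases "x \<ge> max a 1")
    case True
    hence "x \<le> \<Psi> x" using a[of x] by (simp add: field_simps)
    thus ?thesis by simp
  next
    case False thus ?thesis using \<Psi>_nonneg[OF that] by linarith
  qed
  thus ?thesis by (intro exI[of _ "max a 1"]) auto
qed

lemma \<Psi>_surj: "0 \<le> y \<Longrightarrow> \<exists>x\<ge>0. \<Psi> x = y"
proof -
  assume y: "0 \<le> y"
  obtain a where a: "a \<ge> 0" "\<forall>x\<ge>0. x \<le> a + \<Psi> x" using \<Psi>_growth by blast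
  have "a + y \<le> a + \<Psi> (a + y)" using a y by (metis add_nonneg_nonneg)
  hence "\<exists>x. 0 \<le> x \<and> x \<le> a + y \<and> \<Psi> x = y"
    using a y by (intro IVT') (auto intro: continuous_on_subset[OF cont_\<Psi>])
  thus ?thesis by blast
qed

abbreviation inv\<Psi> :: "real \<Rightarrow> real" where "inv\<Psi> \<equiv> orlicz_inv \<Psi>"

lemma inv\<Psi>:
  assumes "0 \<le> y"
  shows "0 \<le> inv\<Psi> y" "\<Psi> (inv\<Psi> y) = y"
proof -
  have "y \<in> \<Psi> ` {0..}" using \<Psi>_surj[OF assms] by auto
  thus "0 \<le> inv\<Psi> y" "\<Psi> (inv\<Psi> y) = y"
    unfolding orlicz_inv_def using inv_into_into[of y \<Psi> "{0..}"] f_inv_into_f[of y \<Psi> "{0..}"] by auto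
qed

lemma inv\<Psi>_pos: "0 < y \<Longrightarrow> 0 < inv\<Psi> y"
  using inv\<Psi>[of y] \<Psi>_0 by (metis less_eq_real_def)

lemma le_inv\<Psi>_iff: "0 \<le> x \<Longrightarrow> 0 \<le> y \<Longrightarrow> x \<le> inv\<Psi> y \<longleftrightarrow> \<Psi> x \<le> y"
  using \<Psi>_le_iff[of x "inv\<Psi> y"] inv\<Psi>[of y] by simp

lemma continuous_on_\<Psi> [continuous_intros]:
  "continuous_on S f \<Longrightarrow> (\<And>x. x \<in> S \<Longrightarrow> 0 \<le> f x) \<Longrightarrow> continuous_on S (\<lambda>x. \<Psi> (f x))"
  by (rule continuous_on_compose2[OF cont_\<Psi>]) auto

text \<open>A supporting line. Its slope must be nonnegative so that it can be composed with the
  inequality \<open>Re (u * f w) \<le> cmod (f w)\<close>. At the end point 0 the horizontal line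
  serves.\<close>

lemma \<Psi>_tangent:
  assumes "0 \<le> x0"
  shows "\<exists>b\<ge>0. \<forall>x\<ge>0. \<Psi> x0 + b * (x - x0) \<le> \<Psi> x"
proof (cases "x0 = 0")
  case True
  thus ?thesis using \<Psi>_nonneg by (intro exI[of _ 0]) auto
next
  case False
  hence x0: "x0 > 0" using assms by simp
  define b where "b = Inf ((\<lambda>t. (\<Psi> x0 - \<Psi> t) / (x0 - t)) ` ({x0<..} \<inter> {0..}))"
  have "b \<ge> 0" unfolding b_def
  proof (rule cInf_greatest)
    show "(\<lambda>t. (\<Psi> x0 - \<Psi> t) / (x0 - t)) ` ({x0<..} \<inter> {0..}) \<noteq> {}"
      using x0 by (simp add: ex_in_conv[symmetric]) (rule exI[of _ "x0 + 1"], simp)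
  next
    fix s assume "s \<in> (\<lambda>t. (\<Psi> x0 - \<Psi> t) / (x0 - t)) ` ({x0<..} \<inter> {0..})"
    then obtain t where "t > x0" "s = (\<Psi> x0 - \<Psi> t) / (x0 - t)" by auto
    thus "0 \<le> s" using \<Psi>_mono[of x0 t] x0 by (auto intro!: divide_nonpos_nonpos)
  qed
  moreover have "\<Psi> x0 + b * (x - x0) \<le> \<Psi> x" if "x \<ge> 0" for x
    unfolding b_def
    by (rule convex_le_Inf_differential[OF convex_\<Psi>]) (use x0 that in \<open>auto simp: interior_real_atLeast\<close>)
  ultimately show ?thesis by blast
qed

text \<open>The minorant at z is the supporting line of \<Psi> composed with
  \<open>Re (u * f)\<close>, where the rotation u makes \<open>u * f z\<close> equal to the
  modulus.\<close>

lemma subharm_on_\<Psi>: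
  assumes f: "f holomorphic_on S" and S: "open S" and C: "C > 0"
  shows "subharm_on S (\<lambda>z. \<Psi> (cmod (f z) / C))"
  unfolding subharm_on_def
proof
  fix z assume z: "z \<in> S"
  define x0 where "x0 = cmod (f z) / C"
  obtain b where b: "b \<ge> 0" "\<And>x. x \<ge> 0 \<Longrightarrow> \<Psi> x0 + b * (x - x0) \<le> \<Psi> x"
    using \<Psi>_tangent[of x0] C by (auto simp: x0_def)
  obtain u where u: "cmod u = 1" "u * f z = of_real (cmod (f z))"
    using ex_unimodular by blast
  define g where "g = (\<lambda>w. of_real (\<Psi> x0 - b * x0) + of_real (b / C) * (u * f w))"
  have Reg: "Re (g w) = \<Psi> x0 - b * x0 + (b / C) * Re (u * f w)" for w
    by (simp only: g_def plus_complex.sel times_complex.sel Re_complex_of_real Im_complex_of_real mult_zero_left diff_zero)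
  show "\<exists>g e. 0 < e \<and> g holomorphic_on ball z e \<and> Re (g z) = \<Psi> (cmod (f z) / C) \<and>
      (\<forall>w\<in>ball z e \<inter> S. Re (g w) \<le> \<Psi> (cmod (f w) / C))"
  proof (rule Re_le_subharm_on[OF S z, where U=S and g=g])
    show "g holomorphic_on S" unfolding g_def by (intro holomorphic_intros f)
    show "Re (g z) = \<Psi> (cmod (f z) / C)"
      unfolding Reg u(2) by (simp add: x0_def)
    fix w assume "w \<in> S"
    have "Re (u * f w) \<le> cmod (f w)"
      using complex_Re_le_cmod[of "u * f w"] u(1) by (simp add: norm_mult)
    hence "(b / C) * Re (u * f w) \<le> (b / C) * cmod (f w)"
      using b C by (intro mult_left_mono) auto
    hence "Re (g w) \<le> \<Psi> x0 + b * (cmod (f w) / C - x0)"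
      unfolding Reg by (simp add: algebra_simps)
    also have "\<dots> \<le> \<Psi> (cmod (f w) / C)" using C by (intro b) auto
    finally show "Re (g w) \<le> \<Psi> (cmod (f w) / C)" .
  qed (use z S in auto)
qed

section \<open>Modulars on circles and the Luxemburg norm\<close>

text \<open>Norms are handled only through the condition \<open>modular f r C \<le> 1\<close>.
  \<open>hardy_orliczI\<close> and \<open>modular_le_1\<close> translate in the two directions; the
  second asks for C strictly above the norm, which avoids the question whether the infimum is
  attained.\<close>

definition modular :: "(complex \<Rightarrow> complex) \<Rightarrow> real \<Rightarrow> real \<Rightarrow> real" where
  "modular f r C = (\<integral>t. \<Psi> (cmod (f (of_real r * cis t)) / C) \<partial>circ)"

lemma luxemburg_set_eq:
  assumes "continuous_on UNIV (\<lambda>t. g (cis t))"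
  shows "{C::real. 0 < C \<and>
      (\<integral>\<^sup>+ t\<in>{0..2*pi}. ennreal (\<Psi> (cmod (g (cis t)) / C)) \<partial>lborel) \<le> ennreal (2 * pi)} =
    {C. 0 < C \<and> (\<integral>t. \<Psi> (cmod (g (cis t)) / C) \<partial>circ) \<le> 1}"
proof (intro Collect_cong conj_cong refl)
  fix C :: real assume "0 < C"
  thus "(\<integral>\<^sup>+ t\<in>{0..2*pi}. ennreal (\<Psi> (cmod (g (cis t)) / C)) \<partial>lborel) \<le> ennreal (2 * pi) \<longleftrightarrow>
     (\<integral>t. \<Psi> (cmod (g (cis t)) / C) \<partial>circ) \<le> 1"
    by (intro modular_circ_iff continuous_intros assms \<Psi>_nonneg) auto
qed

lemma luxemburg_norm_le:
  assumes "continuous_on UNIV (\<lambda>t. g (cis t))" "C > 0" "(\<integral>t. \<Psi> (cmod (g (cis t)) / C) \<partial>circ) \<le> 1"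
  shows "luxemburg_norm \<Psi> g \<le> C"
  unfolding luxemburg_norm_def luxemburg_set_eq[OF assms(1)]
  using assms by (intro cInf_lower) (auto intro: bdd_belowI[of _ 0])

text \<open>The infimum of an empty set of reals would carry no information. A bounded g has its
  modulus scaled below \<open>inv\<Psi> 1\<close>, so that the integrand is at most 1
  pointwise.\<close>

lemma luxemburg_set_nonempty:
  assumes c: "continuous_on UNIV (\<lambda>t. g (cis t))"
  shows "{C. 0 < C \<and> (\<integral>t. \<Psi> (cmod (g (cis t)) / C) \<partial>circ) \<le> 1} \<noteq> {}"
proof -
  have "compact ((\<lambda>t. g (cis t)) ` {0..2*pi})"
    by (intro compact_continuous_image continuous_on_subset[OF c]) auto
  then obtain M where M: "M > 0" "\<And>t. t \<in> {0..2*pi} \<Longrightarrow> cmod (g (cis t)) \<le> M"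
    using compact_imp_bounded bounded_pos by (metis (no_types, lifting) imageI)
  have M': "cmod (g (cis t)) \<le> M" for t
  proof -
    have "cis t = cis (Arg2pi (cis t))"
      using Arg2pi[of "cis t"] by (simp add: is_Arg_def cis_conv_exp)
    thus ?thesis using M(2)[of "Arg2pi (cis t)"] Arg2pi[of "cis t"] by (metis atLeastAtMost_iff less_eq_real_def)
  qed
  define C where "C = M / inv\<Psi> 1"
  have i: "inv\<Psi> 1 > 0" "\<Psi> (inv\<Psi> 1) = 1" using inv\<Psi>_pos[of 1] inv\<Psi>[of 1] by auto
  have C: "C > 0" using M i by (simp add: C_def)
  have "(\<integral>t. \<Psi> (cmod (g (cis t)) / C) \<partial>circ) \<le> (\<integral>t. 1 \<partial>circ)"
  proof (rule integral_mono)
    show "integrable circ (\<lambda>t. \<Psi> (cmod (g (cis t)) / C))"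
      using C by (intro integral_circ_continuous continuous_intros c) auto
    fix t
    have "\<Psi> (cmod (g (cis t)) / C) \<le> \<Psi> (inv\<Psi> 1)"
      using C M' i M by (intro \<Psi>_mono) (auto simp: C_def field_simps)
    thus "\<Psi> (cmod (g (cis t)) / C) \<le> 1" using i by simp
  qed auto
  thus ?thesis using C by auto
qed

lemma luxemburg_norm_less:
  assumes c: "continuous_on UNIV (\<lambda>t. g (cis t))" and less: "luxemburg_norm \<Psi> g < C"
  shows "C > 0" "(\<integral>t. \<Psi> (cmod (g (cis t)) / C) \<partial>circ) \<le> 1"
proof -
  from less obtain C' where C': "0 < C'" "(\<integral>t. \<Psi> (cmod (g (cis t)) / C') \<partial>circ) \<le> 1" "C' < C"
    unfolding luxemburg_norm_def luxemburg_set_eq[OF c]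
    using cInf_lessD[OF luxemburg_set_nonempty[OF c]] by blast
  show "C > 0" using C' by simp
  have "(\<integral>t. \<Psi> (cmod (g (cis t)) / C) \<partial>circ) \<le> (\<integral>t. \<Psi> (cmod (g (cis t)) / C') \<partial>circ)"
    using C' by (intro integral_mono integral_circ_continuous continuous_intros c \<Psi>_mono divide_left_mono) auto
  thus "(\<integral>t. \<Psi> (cmod (g (cis t)) / C) \<partial>circ) \<le> 1" using C' by simp
qed

lemma luxemburg_norm_nonneg:
  assumes c: "continuous_on UNIV (\<lambda>t. g (cis t))"
  shows "0 \<le> luxemburg_norm \<Psi> g"
  unfolding luxemburg_norm_def luxemburg_set_eq[OF c]
  using luxemburg_set_nonempty[OF c] by (intro cInf_greatest) auto

lemma cont_circle:
  assumes "f holomorphic_on ball 0 1" "0 \<le> r" "r < 1"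
  shows "continuous_on UNIV (\<lambda>t. f (of_real r * cis t))"
  by (rule continuous_on_compose2[OF holomorphic_on_imp_continuous_on[OF assms(1)]])
     (use assms in \<open>auto intro!: continuous_intros simp: norm_mult\<close>)

lemma hardy_orliczI:
  assumes f: "f holomorphic_on ball 0 1" and C: "C > 0"
    and m: "\<And>r. 0 \<le> r \<Longrightarrow> r < 1 \<Longrightarrow> modular f r C \<le> 1"
  shows "f \<in> hardy_orlicz \<Psi>" "hardy_orlicz_norm \<Psi> f \<le> C"
proof -
  have le: "luxemburg_norm \<Psi> (\<lambda>z. f (of_real r * z)) \<le> C" if "r \<in> {0..<1}" for r
    using that m C by (intro luxemburg_norm_le cont_circle f) (auto simp: modular_def)
  show "f \<in> hardy_orlicz \<Psi>"
    using f le by (auto simp: hardy_orlicz_def intro!: bdd_aboveI2[where M=C])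
  show "hardy_orlicz_norm \<Psi> f \<le> C"
    unfolding hardy_orlicz_norm_def using le by (intro cSUP_least) auto
qed

lemma hardy_orlicz_holomorphic: "f \<in> hardy_orlicz \<Psi> \<Longrightarrow> f holomorphic_on ball 0 1"
  by (simp add: hardy_orlicz_def)

lemma modular_le_1:
  assumes f: "f \<in> hardy_orlicz \<Psi>" and less: "hardy_orlicz_norm \<Psi> f < C" and r: "0 \<le> r" "r < 1"
  shows "modular f r C \<le> 1"
proof -
  have "luxemburg_norm \<Psi> (\<lambda>z. f (of_real r * z)) \<le> hardy_orlicz_norm \<Psi> f"
    unfolding hardy_orlicz_norm_def using f r by (intro cSUP_upper) (auto simp: hardy_orlicz_def)
  from luxemburg_norm_less(2)[OF _ le_less_trans[OF this less]] show ?thesis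
    using cont_circle[OF hardy_orlicz_holomorphic[OF f] r] by (simp add: modular_def)
qed

lemma hardy_orlicz_norm_nonneg:
  assumes f: "f \<in> hardy_orlicz \<Psi>"
  shows "0 \<le> hardy_orlicz_norm \<Psi> f"
proof -
  have "0 \<le> luxemburg_norm \<Psi> (\<lambda>z. f (of_real 0 * z))"
    by (intro luxemburg_norm_nonneg cont_circle hardy_orlicz_holomorphic f) auto
  also have "\<dots> \<le> hardy_orlicz_norm \<Psi> f"
    unfolding hardy_orlicz_norm_def using f by (intro cSUP_upper) (auto simp: hardy_orlicz_def)
  finally show ?thesis .
qed

text \<open>Convexity at the midpoint: \<open>|f - g| / (2C)\<close> is at most the mean of
  \<open>|f| / C\<close> and \<open>|g| / C\<close>. It takes the place of the triangle inequality
  for the norm.\<close>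

lemma modular_diff:
  assumes f: "f holomorphic_on ball 0 1" "modular f r C \<le> 1"
    and g: "g holomorphic_on ball 0 1" "modular g r C \<le> 1" and C: "0 < C" and r: "0 \<le> r" "r < 1"
  shows "modular (\<lambda>z. f z - g z) r (2 * C) \<le> 1"
proof -
  let ?f = "\<lambda>t. f (of_real r * cis t)" and ?g = "\<lambda>t. g (of_real r * cis t)"
  have cf: "continuous_on UNIV ?f" "continuous_on UNIV ?g"
    using f g r by (auto intro: cont_circle)
  have i: "integrable circ (\<lambda>t. \<Psi> (cmod (?f t) / C))" "integrable circ (\<lambda>t. \<Psi> (cmod (?g t) / C))"
    "integrable circ (\<lambda>t. \<Psi> (cmod (?f t - ?g t) / (2 * C)))"
    using C by (intro integral_circ_continuous continuous_intros cf; simp)+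
  have "modular (\<lambda>z. f z - g z) r (2 * C) \<le> (\<integral>t. (\<Psi> (cmod (?f t) / C) + \<Psi> (cmod (?g t) / C)) / 2 \<partial>circ)"
    unfolding modular_def
  proof (rule integral_mono)
    fix t
    have "cmod (?f t - ?g t) / (2 * C) \<le> (cmod (?f t) + cmod (?g t)) / (2 * C)"
      using C by (intro divide_right_mono norm_triangle_ineq4) auto
    hence "\<Psi> (cmod (?f t - ?g t) / (2 * C)) \<le> \<Psi> ((cmod (?f t) / C + cmod (?g t) / C) / 2)"
      using C by (intro \<Psi>_mono) (auto simp: add_divide_distrib)
    also have "\<dots> \<le> (\<Psi> (cmod (?f t) / C) + \<Psi> (cmod (?g t) / C)) / 2"
      using C by (intro \<Psi>_average_le) auto
    finally show "\<Psi> (cmod (?f t - ?g t) / (2 * C)) \<le> (\<Psi> (cmod (?f t) / C) + \<Psi> (cmod (?g t) / C)) / 2" .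
  qed (use i in auto)
  also have "\<dots> = (modular f r C + modular g r C) / 2"
    using i by (simp add: modular_def)
  also have "\<dots> \<le> 1" using f g by simp
  finally show ?thesis .
qed

lemma hardy_orlicz_diff:
  assumes "f \<in> hardy_orlicz \<Psi>" "g \<in> hardy_orlicz \<Psi>"
  shows "(\<lambda>z. f z - g z) \<in> hardy_orlicz \<Psi>"
proof -
  define C where "C = max (hardy_orlicz_norm \<Psi> f) (hardy_orlicz_norm \<Psi> g) + 1"
  have C: "hardy_orlicz_norm \<Psi> f < C" "hardy_orlicz_norm \<Psi> g < C" "C > 0"
    using hardy_orlicz_norm_nonneg[OF assms(1)] by (auto simp: C_def)
  note h = hardy_orlicz_holomorphic[OF assms(1)] hardy_orlicz_holomorphic[OF assms(2)]
  show ?thesis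
  proof (rule hardy_orliczI(1)[where C="2*C"])
    show "modular (\<lambda>z. f z - g z) r (2 * C) \<le> 1" if r: "0 \<le> r" "r < 1" for r
      by (rule modular_diff[OF h(1) modular_le_1[OF assms(1) C(1) r] h(2) modular_le_1[OF assms(2) C(2) r] C(3) r])
  qed (use C h in \<open>auto intro: holomorphic_on_diff\<close>)
qed

text \<open>The Poisson majorant of a subharmonic function of mean at most 1, with the kernel
  bounded by its maximum. It confines large values of f to a thin ring.\<close>

lemma \<Psi>_pointwise_le_closed:
  assumes f: "f holomorphic_on ball 0 \<rho>" "\<rho> > 1" and C: "C > 0"
    and m: "(\<integral>t. \<Psi> (cmod (f (cis t)) / C) \<partial>circ) \<le> 1" and z: "cmod z < 1"
  shows "\<Psi> (cmod (f z) / C) \<le> 2 / (1 - cmod z)"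
proof -
  define v where "v = (\<lambda>z. \<Psi> (cmod (f z) / C))"
  have cf: "continuous_on (cball 0 1) f"
    by (rule holomorphic_on_imp_continuous_on, rule holomorphic_on_subset[OF f(1)]) (use f in auto)
  have cv: "continuous_on (cball 0 1) v"
    unfolding v_def using C by (intro continuous_intros cf) auto
  have sv: "subharm_on (ball 0 1) v"
    unfolding v_def
    by (rule subharm_on_\<Psi>) (use f C in \<open>auto elim!: holomorphic_on_subset\<close>)
  have c: "continuous_on UNIV (\<lambda>t. v (cis t))" by (rule continuous_on_cis_cball[OF cv])
  have v0: "v w \<ge> 0" for w using C by (auto simp: v_def intro: \<Psi>_nonneg)
  have "v z \<le> (\<integral>t. poisson z (cis t) * v (cis t) \<partial>circ)"
    by (rule subharm_on_poisson_le[OF cv sv z])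
  also have "\<dots> \<le> (\<integral>t. 2 / (1 - cmod z) * v (cis t) \<partial>circ)"
    using z cis_neq_disc[OF z] v0
    by (intro integral_mono integral_circ_continuous continuous_intros c mult_right_mono poisson_le) auto
  also have "\<dots> = 2 / (1 - cmod z) * (\<integral>t. v (cis t) \<partial>circ)" by (rule integral_mult_right_zero)
  also have "\<dots> \<le> 2 / (1 - cmod z) * 1" using m z unfolding v_def by (intro mult_left_mono) auto
  finally show ?thesis by (simp add: v_def)
qed

lemma mult_cmod_less_1: "0 \<le> R \<Longrightarrow> R < 1 \<Longrightarrow> cmod z \<le> 1 \<Longrightarrow> R * cmod z < 1"
  using mult_left_mono[of "cmod z" 1 R] by simp

lemma holomorphic_dilate:
  assumes "f holomorphic_on ball 0 1" "0 < R" "R < 1"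
  shows "(\<lambda>z. f (of_real R * z)) holomorphic_on ball 0 (1 / R)"
  using assms
  by (intro holomorphic_on_compose_gen[of "\<lambda>z. of_real R * z" _ f "ball 0 1", unfolded o_def] holomorphic_intros)
     (auto simp: norm_mult field_simps)

text \<open>The closed-disc estimate for the dilate by R, evaluated at \<open>z / R\<close>, as R
  tends to 1.\<close>

lemma \<Psi>_pointwise_le:
  assumes f: "f holomorphic_on ball 0 1" and C: "C > 0"
    and m: "\<And>r. 0 \<le> r \<Longrightarrow> r < 1 \<Longrightarrow> modular f r C \<le> 1" and z: "cmod z < 1"
  shows "\<Psi> (cmod (f z) / C) \<le> 2 / (1 - cmod z)"
proof -
  have *: "\<Psi> (cmod (f z) / C) \<le> 2 / (1 - cmod z / R)" if R: "0 < R" "cmod z < R" "R < 1" for R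
  proof -
    have "\<Psi> (cmod (f (of_real R * (z / of_real R))) / C) \<le> 2 / (1 - cmod (z / of_real R))"
      by (rule \<Psi>_pointwise_le_closed[OF holomorphic_dilate[OF f] _ C, where z="z / of_real R"])
         (use R m[of R] in \<open>auto simp: modular_def norm_divide\<close>)
    thus ?thesis using R by (simp add: norm_divide)
  qed
  have "((\<lambda>R. 2 / (1 - cmod z / R)) \<longlongrightarrow> 2 / (1 - cmod z / 1)) (at_left 1)"
    using z by (intro tendsto_intros) auto
  moreover have "eventually (\<lambda>R. \<Psi> (cmod (f z) / C) \<le> 2 / (1 - cmod z / R)) (at_left 1)"
    using eventually_at_left_real[OF z] by eventually_elim (auto intro!: * intro: le_less_trans[OF norm_ge_zero])
  ultimately show ?thesis
    using tendsto_lowerbound by fastforce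
qed

end

section \<open>Littlewood subordination for modulars\<close>

locale orlicz_self_map = orlicz \<Psi> + disc_self_map \<psi> \<rho> for \<Psi> \<psi> \<rho>
begin

text \<open>The estimates require f on the closed disc, while a function of the space lives on the
  open one. Since \<psi> maps the closed disc into a smaller closed disc, the dilates of f converge
  boundedly along \<psi>.\<close>

lemma modular_dilate_limit:
  assumes f: "f holomorphic_on ball 0 1" and C: "C > 0"
    and le: "\<And>R. 0 < R \<Longrightarrow> R < 1 \<Longrightarrow> (\<integral>t. \<Psi> (cmod (f (of_real R * \<psi> (cis t))) / C) \<partial>circ) \<le> B"
  shows "(\<integral>t. \<Psi> (cmod (f (\<psi> (cis t))) / C) \<partial>circ) \<le> B"
proof -
  have cf: "continuous_on (ball 0 1) f" using f by (rule holomorphic_on_imp_continuous_on)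
  have c\<Psi>: "continuous_on (ball 0 1) (\<lambda>z. \<Psi> (cmod (f z) / C))"
    using C by (intro continuous_intros cf) auto
  have "continuous_on (cball 0 1) (\<lambda>z. cmod (\<psi> z))" by (intro continuous_intros cont)
  from continuous_attains_sup[OF _ _ this]
  obtain z0 where z0: "cmod z0 \<le> 1" "\<And>z. cmod z \<le> 1 \<Longrightarrow> cmod (\<psi> z) \<le> cmod (\<psi> z0)"
    by fastforce
  define s where "s = cmod (\<psi> z0)"
  have s: "s < 1" "\<And>t. cmod (\<psi> (cis t)) \<le> s" using z0 maps1 by (auto simp: s_def)
  have "compact ((\<lambda>z. \<Psi> (cmod (f z) / C)) ` cball 0 s)"
    using s by (intro compact_continuous_image continuous_on_subset[OF c\<Psi>]) auto
  then obtain M where M: "\<And>z. z \<in> cball 0 s \<Longrightarrow> norm (\<Psi> (cmod (f z) / C)) \<le> M"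
    using compact_imp_bounded bounded_pos by (metis (no_types, lifting) imageI)
  \<comment> \<open>Two successors, so that already \<open>R 0 = 1/2\<close> is positive.\<close>
  define R where "R = (\<lambda>n. 1 - inverse (real (Suc (Suc n))))"
  have R: "0 < R n" "R n < 1" for n by (auto simp: R_def field_simps)
  have Rlim: "R \<longlonglongrightarrow> 1"
    unfolding R_def using tendsto_diff[OF tendsto_const LIMSEQ_Suc[OF LIMSEQ_inverse_real_of_nat], of 1]
    by simp
  have in_cball: "of_real (R n) * \<psi> (cis t) \<in> cball 0 s" for n t
    using R[of n] s(2)[of t] mult_mono[of "R n" 1 "cmod (\<psi> (cis t))" s] by (auto simp: norm_mult)
  have c: "continuous_on UNIV (\<lambda>t. \<Psi> (cmod (f (of_real q * \<psi> (cis t))) / C))" if "0 \<le> q" "q \<le> 1" for q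
  proof (rule continuous_on_compose2[OF c\<Psi>])
    have "q * cmod (\<psi> (cis t)) < 1" for t
      using mult_right_mono[OF that(2), of "cmod (\<psi> (cis t))"] maps_cis[of t] by simp
    thus "(\<lambda>t. of_real q * \<psi> (cis t)) ` UNIV \<subseteq> ball 0 1"
      using that by (auto simp: norm_mult)
  qed (intro continuous_intros cont_cis)
  have "(\<lambda>n. \<integral>t. \<Psi> (cmod (f (of_real (R n) * \<psi> (cis t))) / C) \<partial>circ) \<longlonglongrightarrow> (\<integral>t. \<Psi> (cmod (f (\<psi> (cis t))) / C) \<partial>circ)"
  proof (rule integral_dominated_convergence[where w="\<lambda>_. M"])
    show "(\<lambda>t. \<Psi> (cmod (f (\<psi> (cis t))) / C)) \<in> borel_measurable circ"
      using borel_measurable_continuous_onI[OF c[of 1]] by simp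
    show "(\<lambda>t. \<Psi> (cmod (f (of_real (R n) * \<psi> (cis t))) / C)) \<in> borel_measurable circ" for n
      using borel_measurable_continuous_onI[OF c[of "R n"]] R[of n] by simp
    show "AE t in circ. (\<lambda>n. \<Psi> (cmod (f (of_real (R n) * \<psi> (cis t))) / C)) \<longlonglongrightarrow> \<Psi> (cmod (f (\<psi> (cis t))) / C)"
    proof (rule AE_I2)
      fix t
      have "(\<lambda>n. of_real (R n) * \<psi> (cis t)) \<longlonglongrightarrow> of_real 1 * \<psi> (cis t)"
        by (intro tendsto_intros Rlim)
      thus "(\<lambda>n. \<Psi> (cmod (f (of_real (R n) * \<psi> (cis t))) / C)) \<longlonglongrightarrow> \<Psi> (cmod (f (\<psi> (cis t))) / C)"
        using maps_cis[of t] in_cball s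
        by (intro continuous_on_tendsto_compose[OF c\<Psi>]) (auto intro!: always_eventually le_less_trans[OF _ s(1)])
    qed
    show "AE t in circ. norm (\<Psi> (cmod (f (of_real (R n) * \<psi> (cis t))) / C)) \<le> M" for n
      using M[OF in_cball] by (intro AE_I2) auto
  qed auto
  thus ?thesis by (rule LIMSEQ_le_const2) (use le R in auto)
qed

text \<open>The factor D of Littlewood's inequality stands in front of the integral; convexity,
  \<open>\<Psi> (x / D) \<le> \<Psi> x / D\<close> for D at least 1, moves it into the norm.\<close>

lemma littlewood_modular:
  assumes f: "f holomorphic_on ball 0 1" and C: "C > 0"
    and m: "\<And>r. 0 \<le> r \<Longrightarrow> r < 1 \<Longrightarrow> modular f r C \<le> 1"
  shows "(\<integral>t. \<Psi> (cmod (f (\<psi> (cis t))) / (2 / (1 - cmod (\<psi> 0)) * C)) \<partial>circ) \<le> 1"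
proof -
  define D where "D = 2 / (1 - cmod (\<psi> 0))"
  have p0: "cmod (\<psi> 0) < 1" by (rule maps1) simp
  have D: "D \<ge> 1" using p0 by (simp add: D_def field_simps)
  have "(\<integral>t. \<Psi> (cmod (f (\<psi> (cis t))) / (D * C)) \<partial>circ) \<le> 1"
  proof (rule modular_dilate_limit[OF f])
    show "D * C > 0" using D C by simp
    fix R :: real assume R: "0 < R" "R < 1"
    define g where "g = (\<lambda>z. f (of_real R * z))"
    have gh: "g holomorphic_on ball 0 (1 / R)" unfolding g_def by (rule holomorphic_dilate[OF f R])
    have gc: "continuous_on (cball 0 1) g"
      by (rule holomorphic_on_imp_continuous_on, rule holomorphic_on_subset[OF gh])
         (use R mult_cmod_less_1 in \<open>auto simp: field_simps\<close>)
    define w where "w = (\<lambda>z. \<Psi> (cmod (g z) / C))"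
    have cw: "continuous_on (cball 0 1) w"
      unfolding w_def using C by (intro continuous_intros gc) auto
    have sw: "subharm_on (ball 0 1) w"
      unfolding w_def
      by (rule subharm_on_\<Psi>[OF holomorphic_on_subset[OF gh]]) (use R C mult_cmod_less_1 in \<open>auto simp: field_simps\<close>)
    have w0: "w z \<ge> 0" for z using C by (auto simp: w_def intro: \<Psi>_nonneg)
    have cp: "continuous_on UNIV (\<lambda>t. g (\<psi> (cis t)))"
      by (rule continuous_on_compose2[OF gc cont_cis]) (use maps_cis in \<open>auto simp: less_imp_le\<close>)
    have "(\<integral>t. \<Psi> (cmod (g (\<psi> (cis t))) / (D * C)) \<partial>circ) \<le> (\<integral>t. 1 / D * w (\<psi> (cis t)) \<partial>circ)"
    proof (rule integral_mono)
      fix t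
      have "\<Psi> (cmod (g (\<psi> (cis t))) / (D * C)) = \<Psi> (1 / D * (cmod (g (\<psi> (cis t))) / C))" by simp
      also have "\<dots> \<le> 1 / D * \<Psi> (cmod (g (\<psi> (cis t))) / C)"
        using D C by (intro \<Psi>_scale_le) auto
      finally show "\<Psi> (cmod (g (\<psi> (cis t))) / (D * C)) \<le> 1 / D * w (\<psi> (cis t))" by (simp add: w_def)
    qed (unfold w_def, use C D in \<open>(intro integral_circ_continuous continuous_intros cp; simp)+\<close>)
    also have "\<dots> = 1 / D * (\<integral>t. w (\<psi> (cis t)) \<partial>circ)" by (rule integral_mult_right_zero)
    also have "\<dots> \<le> 1 / D * (D * (\<integral>t. w (cis t) \<partial>circ))"
      using littlewood_integral_le[OF cw sw w0] D unfolding D_def[symmetric] by (intro mult_left_mono) auto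
    also have "\<dots> = modular f R C" using D by (simp add: w_def g_def modular_def)
    also have "\<dots> \<le> 1" using m R by simp
    finally show "(\<integral>t. \<Psi> (cmod (f (of_real R * \<psi> (cis t))) / (D * C)) \<partial>circ) \<le> 1"
      by (simp add: g_def)
  qed
  thus ?thesis by (simp add: D_def)
qed

end

section \<open>The Carleson-type estimate\<close>

text \<open>Square roots are what make the geometric summation over the levels \<open>c = c\<^sub>0 4\<^sup>n\<close> converge;
  subharmonicity of the square root of a modulus uses holomorphy.\<close>

lemma subharm_on_sqrt:
  assumes f: "f holomorphic_on S" and S: "open S" and c: "c > 0"
  shows "subharm_on S (\<lambda>z. max 0 (sqrt (cmod (f z) / c) - 1))"
  unfolding subharm_on_def
proof
  fix z assume z: "z \<in> S"
  show "\<exists>g e. 0 < e \<and> g holomorphic_on ball z e \<and> Re (g z) = max 0 (sqrt (cmod (f z) / c) - 1) \<and>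
      (\<forall>w\<in>ball z e \<inter> S. Re (g w) \<le> max 0 (sqrt (cmod (f w) / c) - 1))"
  proof (cases "sqrt (cmod (f z) / c) \<le> 1")
    case True
    thus ?thesis
      by (intro Re_le_subharm_on[OF S z, where U=S and g="\<lambda>_. 0"]) (use S z in auto)
  next
    case False
    hence fz: "cmod (f z) > 0" using c by (auto simp: not_le)
    obtain u where u: "cmod u = 1" "u * f z = of_real (cmod (f z))"
      using ex_unimodular by blast
    \<comment> \<open>After the rotation u the principal square root is holomorphic near z, and its
      real part is at most its modulus, with equality at z.\<close>
    let ?U = "S \<inter> (\<lambda>w. u * f w) -` {x. Re x > 0}"
    have oU: "open ?U"
      by (rule continuous_open_preimage)
         (intro continuous_intros holomorphic_on_imp_continuous_on f S open_halfspace_Re_gt)+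
    define g where "g = (\<lambda>w. csqrt (u * f w / of_real c) - 1)"
    have Reg: "Re (g w) \<le> sqrt (cmod (f w) / c) - 1" for w
    proof -
      have "Re (csqrt (u * f w / of_real c)) \<le> cmod (csqrt (u * f w / of_real c))"
        by (rule complex_Re_le_cmod)
      also have "\<dots> = sqrt (cmod (f w) / c)" using u c by (simp add: norm_mult norm_divide)
      finally show ?thesis by (simp add: g_def)
    qed
    show ?thesis
    proof (rule Re_le_subharm_on[OF S z _ oU, where g=g])
      have "Re (u * f z) > 0" unfolding u(2) using fz by simp
      thus "z \<in> ?U" using z by blast
      show "g holomorphic_on ?U"
        unfolding g_def using c
        by (intro holomorphic_intros holomorphic_on_subset[OF f]) (auto simp: complex_nonpos_Reals_iff divide_le_0_iff)
      have "csqrt (of_real (cmod (f z) / c)) = of_real (sqrt (cmod (f z) / c))"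
        using c by (intro csqrt_of_real) auto
      hence "csqrt (u * f z / of_real c) = of_real (sqrt (cmod (f z) / c))"
        unfolding u(2) by (simp only: of_real_divide)
      thus "Re (g z) = max 0 (sqrt (cmod (f z) / c) - 1)"
        unfolding g_def using False by simp
      show "Re (g w) \<le> max 0 (sqrt (cmod (f w) / c) - 1)" for w
        using Reg[of w] by simp
    qed auto
  qed
qed

text \<open>The bound \<open>2 * y\<close> alone is not inductive. Together with
  \<open>2 ^ N\<close> it is: a new term with \<open>2 ^ N < y\<close> at most doubles the second
  bound and stays below the first.\<close>

lemma sum_powers_of_2_below:
  fixes y :: real
  assumes "0 \<le> y"
  shows "(\<Sum>n<N. if 2 ^ n < y then 2 ^ n else 0) \<le> 2 * y"
proof -
  have "(\<Sum>n<N. if 2 ^ n < y then 2 ^ n else 0) \<le> min (2 * y) (2 ^ N)"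
    by (induction N) (use assms in auto)
  thus ?thesis by simp
qed

context orlicz
begin

text \<open>With \<open>y = sqrt (x / c0)\<close> only levels with \<open>2 ^ n < y\<close> count.
  Convexity gives \<open>\<Psi> (c0 * 4 ^ n) \<le> 4 ^ n / y^2 * \<Psi> x\<close>, and the root
  contributes at most \<open>y / 2 ^ n\<close>, so the terms grow like \<open>2 ^ n / y\<close> and
  the last ones dominate. With the modulus in place of its root, this bound would give
  \<open>\<Psi> x\<close> at every level.\<close>

lemma sum_levels_le:
  assumes c0: "c0 > 0" and x: "x \<ge> 0"
  shows "(\<Sum>n<N. \<Psi> (c0 * 4 ^ n) * max 0 (sqrt (x / (c0 * 4 ^ n)) - 1)) \<le> 2 * \<Psi> x"
proof (cases "x = 0")
  case True thus ?thesis by simp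
next
  case False
  define y where "y = sqrt (x / c0)"
  have y: "y > 0" "y\<^sup>2 = x / c0" using False x c0 by (auto simp: y_def)
  have sq: "sqrt (x / (c0 * 4 ^ n)) = y / 2 ^ n" for n
  proof -
    have "sqrt ((4::real) ^ n) = 2 ^ n" by (simp add: real_sqrt_power)
    thus ?thesis by (simp add: y_def real_sqrt_divide real_sqrt_mult)
  qed
  have "\<Psi> (c0 * 4 ^ n) * max 0 (y / 2 ^ n - 1) \<le> \<Psi> x / y * (if 2 ^ n < y then 2 ^ n else 0)" for n
  proof (cases "2 ^ n < y")
    case True
    hence "((2::real) ^ n)\<^sup>2 < y\<^sup>2" by (intro power_strict_mono) auto
    hence "(4::real) ^ n < x / c0" unfolding y by (simp add: power2_eq_square flip: power_mult_distrib)
    hence lt: "c0 * 4 ^ n < x" using c0 by (simp add: field_simps)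
    have "\<Psi> (c0 * 4 ^ n) = \<Psi> ((c0 * 4 ^ n / x) * x)" using False by simp
    also have "\<dots> \<le> (c0 * 4 ^ n / x) * \<Psi> x"
      using lt c0 x False by (intro \<Psi>_scale_le) auto
    also have "c0 * 4 ^ n / x = 4 ^ n / y\<^sup>2" using y(2) by simp
    finally have "\<Psi> (c0 * 4 ^ n) * max 0 (y / 2 ^ n - 1) \<le> (4 ^ n / y\<^sup>2 * \<Psi> x) * (y / 2 ^ n)"
      using y(1) \<Psi>_nonneg[OF x] by (intro mult_mono mult_nonneg_nonneg divide_nonneg_nonneg) auto
    also have "\<dots> = \<Psi> x / y * 2 ^ n"
    proof -
      have "(4::real) ^ n = 2 ^ n * 2 ^ n" by (simp flip: power_mult_distrib)
      thus ?thesis using y(1) by (simp add: power2_eq_square field_simps)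
    qed
    finally show ?thesis using True by simp
  next
    case False
    hence "y / 2 ^ n \<le> 1" by simp
    thus ?thesis using False by simp
  qed
  hence "(\<Sum>n<N. \<Psi> (c0 * 4 ^ n) * max 0 (y / 2 ^ n - 1)) \<le> (\<Sum>n<N. \<Psi> x / y * (if 2 ^ n < y then 2 ^ n else 0))"
    by (intro sum_mono)
  also have "\<dots> = \<Psi> x / y * (\<Sum>n<N. if 2 ^ n < y then 2 ^ n else 0)" by (rule sum_distrib_left[symmetric])
  also have "\<dots> \<le> \<Psi> x / y * (2 * y)"
    using y \<Psi>_nonneg[OF x] by (intro mult_left_mono sum_powers_of_2_below) auto
  also have "\<dots> = 2 * \<Psi> x" using y by simp
  finally show ?thesis unfolding sq .
qed

end

context orlicz_self_map
begin

text \<open>Three ranges contribute 1/4 each: points at depth at least \<delta>, where f is at most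
  \<epsilon>; points closer to the circle where |f| is at most \<open>4 * c0\<close>, whose total
  measure is small by \<open>win'\<close>; and the points where |f| exceeds \<open>4 * c0\<close>,
  summed over the levels by \<open>win\<close>. The level \<open>c0\<close> is so high that every
  depth involved lies below \<open>h1\<close>.\<close>

lemma carleson_estimate:
  defines "K \<equiv> 80 * pi + 8"
  assumes f: "f holomorphic_on ball 0 \<rho>'" "\<rho>' > 1" and m: "(\<integral>t. \<Psi> (cmod (f (cis t))) \<partial>circ) \<le> 1"
    and A: "A > 0" and h1: "h1 \<le> 1" "8 * h1 \<le> 1 - cmod (\<psi> 0)" and c0: "c0 > 0" "4 / \<Psi> c0 < h1"
    and win: "\<And>h \<eta>. 0 < h \<Longrightarrow> h < h1 \<Longrightarrow> cmod \<eta> = 1 \<Longrightarrow>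
        measure circ {t. cmod (\<psi> (cis t) - \<eta>) < 8 * h} \<le> 1 / \<Psi> (128 * A * K * inv\<Psi> (1 / h))"
    and \<delta>: "0 < \<delta>" "\<delta> < h1" and B: "B \<ge> 1" "\<Psi> (4 * A * c0) * K \<le> B / 4"
    and win': "\<And>\<eta>. cmod \<eta> = 1 \<Longrightarrow>
        measure circ {t. cmod (\<psi> (cis t) - \<eta>) < 8 * \<delta>} \<le> 1 / \<Psi> (B * inv\<Psi> (1 / \<delta>))"
    and \<epsilon>: "\<And>z. cmod z \<le> 1 - \<delta> \<Longrightarrow> cmod (f z) \<le> \<epsilon>" "\<Psi> (A * \<epsilon>) \<le> 1 / 4"
  shows "(\<integral>t. \<Psi> (A * cmod (f (\<psi> (cis t)))) \<partial>circ) \<le> 1"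
proof -
  let ?p = "\<lambda>t. \<psi> (cis t)"
  have K: "K > 8" using pi_gt_zero by (simp add: K_def)
  define c where "c = (\<lambda>n::nat. c0 * 4 ^ n)"
  define w where "w = (\<lambda>n z. max 0 (sqrt (cmod (f z) / c n) - 1))"
  \<comment> \<open>Twice the depth 2 / \<Psi>(c n) given by the pointwise estimate, so that the
    inequality in \<open>depth\<close> is strict.\<close>
  define h where "h = (\<lambda>n. 4 / \<Psi> (c n))"
  have cpos: "c n > 0" for n using c0 by (simp add: c_def)
  have \<Psi>c: "\<Psi> (c n) > 0" for n by (rule \<Psi>_pos[OF cpos])
  have cc0: "c0 \<le> c n" for n using c0 by (simp add: c_def)
  have h: "0 < h n" "h n < h1" for n
  proof -
    show "0 < h n" using \<Psi>c by (simp add: h_def)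
    have "h n \<le> 4 / \<Psi> c0"
      unfolding h_def using c0 \<Psi>_mono[OF _ cc0] \<Psi>c \<Psi>_pos[of c0] by (intro divide_left_mono mult_pos_pos) auto
    thus "h n < h1" using c0 by simp
  qed
  have fh: "f holomorphic_on cball 0 1" using f by (auto elim!: holomorphic_on_subset)
  have cf: "continuous_on (cball 0 1) f" using fh by (rule holomorphic_on_imp_continuous_on)
  have cfp: "continuous_on UNIV (\<lambda>t. f (?p t))"
    by (rule continuous_on_compose2[OF cf cont_cis]) (use maps_cis in \<open>auto simp: less_imp_le\<close>)
  have cw: "continuous_on (cball 0 1) (w n)" for n
    unfolding w_def using cpos[of n] by (intro continuous_intros cf) auto
  have sw: "subharm_on (ball 0 1) (w n)" for n
    unfolding w_def by (rule subharm_on_sqrt[OF holomorphic_on_subset[OF fh]]) (use cpos in auto)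
  have w0: "w n z \<ge> 0" for n z by (simp add: w_def)
  have cwp: "continuous_on UNIV (\<lambda>t. w n (?p t))" for n
    by (rule continuous_on_compose2[OF cw cont_cis]) (use maps_cis in \<open>auto simp: less_imp_le\<close>)
  have iwp: "integrable circ (\<lambda>t. w n (?p t))" for n
    by (rule integral_circ_continuous(1)[OF cwp])
  have ppred: "Measurable.pred borel (\<lambda>t. 1 - cmod (?p t) < q)" for q by measurable
  have depth: "1 - cmod z < h n" if "w n z \<noteq> 0" "cmod z < 1" for n z
  proof -
    have "sqrt (cmod (f z) / c n) > 1"
    proof (rule ccontr)
      assume "\<not> ?thesis"
      hence "w n z = 0" unfolding w_def by (intro max_absorb1) linarith
      thus False using that by simp
    qed
    hence "cmod (f z) / c n > 1" by simp
    hence "cmod (f z) > c n" using less_divide_eq_1_pos[OF cpos] by blast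
    hence "\<Psi> (c n) \<le> \<Psi> (cmod (f z) / 1)" using cpos[of n] by (intro \<Psi>_mono) auto
    also have "\<dots> \<le> 2 / (1 - cmod z)"
      by (rule \<Psi>_pointwise_le_closed[OF f _ _ that(2)]) (use m in auto)
    finally have "\<Psi> (c n) * (1 - cmod z) \<le> 2" using that by (simp add: field_simps)
    hence "\<Psi> (c n) * (1 - cmod z) < 4" by linarith
    thus ?thesis using \<Psi>c[of n] by (simp add: h_def field_simps)
  qed
  have level: "\<Psi> (16 * A * c n) * (\<integral>t. w n (?p t) \<partial>circ) \<le> \<Psi> (c n) / 8 * (\<integral>t. w n (cis t) \<partial>circ)" for n
  proof -
    \<comment> \<open>The factor 128 is 4 * 2 * 16: by convexity
      \<open>inv\<Psi> (\<Psi> (c n) / 4)\<close> is at least \<open>c n / 4\<close>, the factor 2K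
      is pulled out of \<Psi> by convexity to beat the constant K, and 16A is the scaling required
      on the n-th level. The outcome is the coefficient \<open>\<Psi> (c n) / 8\<close>, which the
      factor 2 of \<open>sum_levels_le\<close> turns into 1/4.\<close>
    define P where "P = \<Psi> (128 * A * K * inv\<Psi> (1 / h n))"
    have "\<Psi> (c n / 4) \<le> \<Psi> (c n) / 4" using \<Psi>_scale_le[of "1/4" "c n"] cpos[of n] by simp
    hence "c n / 4 \<le> inv\<Psi> (1 / h n)"
      using cpos[of n] \<Psi>c[of n] by (subst le_inv\<Psi>_iff) (auto simp: h_def)
    hence "\<Psi> (128 * A * K * (c n / 4)) \<le> P"
      unfolding P_def using A K cpos[of n] by (intro \<Psi>_mono mult_left_mono) auto
    hence "\<Psi> ((2 * K) * (16 * A * c n)) \<le> P" by (simp add: mult_ac)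
    moreover have "(2 * K) * \<Psi> (16 * A * c n) \<le> \<Psi> ((2 * K) * (16 * A * c n))"
      using A K cpos[of n] by (intro \<Psi>_scale_ge) auto
    ultimately have P: "(2 * K) * \<Psi> (16 * A * c n) \<le> P" by simp
    have \<Psi>16: "\<Psi> (16 * A * c n) > 0" using A cpos by (intro \<Psi>_pos) auto
    have "(2 * K) * \<Psi> (16 * A * c n) > 0" using K \<Psi>16 by simp
    hence Ppos: "P > 0" using P by linarith
    have "(\<integral>t. (if 1 - cmod (?p t) < h n then w n (?p t) else 0) \<partial>circ) \<le> K * (1 / P) / h n * (\<integral>t. w n (cis t) \<partial>circ)"
    proof (rule subharm_on_comp_integral_le[OF cw sw w0 ppred])
      show "0 \<le> K * (1 / P) / h n" using K Ppos h(1)[of n] by simp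
      fix \<xi> :: complex assume \<xi>: "cmod \<xi> = 1"
      show "(\<integral>\<^sup>+ t. ennreal (if 1 - cmod (?p t) < h n then poisson (?p t) \<xi> else 0) \<partial>circ) \<le> ennreal (K * (1 / P) / h n)"
        unfolding K_def
        by (rule kernel_bound) (use h[of n] h1 \<xi> win[OF h] in \<open>auto simp: P_def\<close>)
    qed
    moreover have "(if 1 - cmod (?p t) < h n then w n (?p t) else 0) = w n (?p t)" for t
      using depth[of n "?p t"] maps_cis[of t] by auto
    ultimately have "(\<integral>t. w n (?p t) \<partial>circ) \<le> K * (1 / P) / h n * (\<integral>t. w n (cis t) \<partial>circ)" by simp
    hence "\<Psi> (16 * A * c n) * (\<integral>t. w n (?p t) \<partial>circ) \<le> \<Psi> (16 * A * c n) * (K * (1 / P) / h n * (\<integral>t. w n (cis t) \<partial>circ))"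
      using \<Psi>16 by (intro mult_left_mono) auto
    also have "\<dots> = (\<Psi> (16 * A * c n) * (K * (1 / P) / h n)) * (\<integral>t. w n (cis t) \<partial>circ)" by simp
    also have "\<dots> \<le> \<Psi> (c n) / 8 * (\<integral>t. w n (cis t) \<partial>circ)"
    proof (rule mult_right_mono)
      have "\<Psi> (16 * A * c n) * (K * (1 / P) / h n) = ((2 * K) * \<Psi> (16 * A * c n)) / P * (\<Psi> (c n) / 8)"
        using \<Psi>c[of n] Ppos by (simp add: h_def field_simps)
      also have "\<dots> \<le> 1 * (\<Psi> (c n) / 8)"
        using P Ppos \<Psi>c[of n] by (intro mult_right_mono) auto
      finally show "\<Psi> (16 * A * c n) * (K * (1 / P) / h n) \<le> \<Psi> (c n) / 8" by simp
    qed (auto intro!: integral_nonneg_AE simp: w0)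
    finally show ?thesis .
  qed
  \<comment> \<open>Sweeping the constant function 1 bounds the measure of the ring itself, by K /
    B.\<close>
  let ?D = "\<lambda>t. if 1 - cmod (?p t) < \<delta> then 1 else 0 :: real"
  have iD: "integrable circ ?D"
    by (rule integrable_circ_bounded[where B=1]) (use ppred in auto)
  have "(\<integral>t. ?D t \<partial>circ) \<le> K * (1 / \<Psi> (B * inv\<Psi> (1 / \<delta>))) / \<delta> * (\<integral>t. 1 \<partial>circ)"
  proof (rule subharm_on_comp_integral_le[where w="\<lambda>_. 1", OF _ _ _ ppred])
    show "subharm_on (ball 0 1) (\<lambda>_. 1)"
      unfolding subharm_on_def by (intro ballI exI[of _ "\<lambda>_. 1"] exI[of _ 1]) auto
    show "0 \<le> K * (1 / \<Psi> (B * inv\<Psi> (1 / \<delta>))) / \<delta>"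
      using K \<delta> B inv\<Psi>[of "1/\<delta>"] by (auto intro!: divide_nonneg_nonneg mult_nonneg_nonneg \<Psi>_nonneg)
    fix \<xi> :: complex assume \<xi>: "cmod \<xi> = 1"
    show "(\<integral>\<^sup>+ t. ennreal (if 1 - cmod (?p t) < \<delta> then poisson (?p t) \<xi> else 0) \<partial>circ)
        \<le> ennreal (K * (1 / \<Psi> (B * inv\<Psi> (1 / \<delta>))) / \<delta>)"
      unfolding K_def by (rule kernel_bound) (use \<delta> h1 \<xi> win' in auto)
  qed auto
  also have "\<dots> \<le> K / B"
  proof -
    have "B * \<Psi> (inv\<Psi> (1 / \<delta>)) \<le> \<Psi> (B * inv\<Psi> (1 / \<delta>))"
      using B \<delta> by (intro \<Psi>_scale_ge inv\<Psi>) auto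
    hence "B / \<delta> \<le> \<Psi> (B * inv\<Psi> (1 / \<delta>))" using \<delta> inv\<Psi>[of "1/\<delta>"] by simp
    hence "1 / \<Psi> (B * inv\<Psi> (1 / \<delta>)) \<le> 1 / (B / \<delta>)"
      using B \<delta> by (intro divide_left_mono mult_pos_pos) (auto intro: less_le_trans[of 0 "B / \<delta>"])
    hence "K * (1 / \<Psi> (B * inv\<Psi> (1 / \<delta>))) / \<delta> \<le> K * (1 / (B / \<delta>)) / \<delta>"
      using K \<delta> by (intro divide_right_mono mult_left_mono) auto
    also have "\<dots> = K / B" using \<delta> B by simp
    finally show ?thesis by simp
  qed
  finally have D: "(\<integral>t. ?D t \<partial>circ) \<le> K / B" .
  have \<Psi>4: "\<Psi> (4 * A * c0) \<ge> 0" using A c0 by (intro \<Psi>_nonneg) auto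
  have D': "\<Psi> (4 * A * c0) * (\<integral>t. ?D t \<partial>circ) \<le> 1 / 4"
  proof -
    have "\<Psi> (4 * A * c0) * (\<integral>t. ?D t \<partial>circ) \<le> \<Psi> (4 * A * c0) * (K / B)"
      using D \<Psi>4 by (rule mult_left_mono)
    also have "\<dots> = \<Psi> (4 * A * c0) * K / B" by simp
    also have "\<dots> \<le> (B / 4) / B" using B by (intro divide_right_mono) auto
    also have "\<dots> = 1 / 4" using B by simp
    finally show ?thesis .
  qed
  have "compact (f ` cball 0 1)" by (intro compact_continuous_image cf) auto
  from compact_imp_bounded[OF this]
  obtain X where "\<And>y. y \<in> f ` cball 0 1 \<Longrightarrow> cmod y \<le> X"
    unfolding bounded_iff by blast
  hence X: "\<And>z. cmod z \<le> 1 \<Longrightarrow> cmod (f z) \<le> X" by auto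
  \<comment> \<open>The dilated f is bounded, so finitely many levels suffice and no infinite sum is
    integrated.\<close>
  obtain N where N: "X / c0 < 4 ^ N" using real_arch_pow[of 4 "X / c0"] by auto
  have XN: "X \<le> 4 * c N"
  proof -
    have "X < c N" using N c0 by (simp add: c_def field_simps)
    thus ?thesis using cpos[of N] by simp
  qed
  have find: "\<exists>n<N. 4 * c n < x \<and> x \<le> 16 * c n" if "4 * c 0 < x" "x \<le> 4 * c N" for x and N
    using that
  proof (induction N)
    case (Suc N)
    show ?case
    proof (cases "x \<le> 4 * c N")
      case True thus ?thesis using Suc by (auto intro: less_SucI)
    next
      case False
      thus ?thesis using Suc.prems by (intro exI[of _ N]) (auto simp: c_def)
    qed
  qed auto
  have coef0: "\<Psi> (16 * A * c n) \<ge> 0" for n using A cpos[of n] by (intro \<Psi>_nonneg) auto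
  have pt: "\<Psi> (A * cmod (f (?p t))) \<le> 1/4 + (\<Psi> (4 * A * c0) * ?D t + (\<Sum>n<N. \<Psi> (16 * A * c n) * w n (?p t)))" for t
  proof -
    define x where "x = cmod (f (?p t))"
    have x: "x \<ge> 0" "x \<le> 4 * c N"
      using X[of "?p t"] XN maps_cis[of t] by (auto simp: x_def less_imp_le intro: order_trans)
    have S0: "(\<Sum>n<N. \<Psi> (16 * A * c n) * w n (?p t)) \<ge> 0"
      by (intro sum_nonneg mult_nonneg_nonneg coef0 w0)
    have D0: "\<Psi> (4 * A * c0) * ?D t \<ge> 0" using \<Psi>4 by simp
    consider "1 - cmod (?p t) \<ge> \<delta>" | "1 - cmod (?p t) < \<delta>" "x \<le> 4 * c0" | "x > 4 * c0" by linarith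
    thus ?thesis
    proof cases
      case 1
      hence "x \<le> \<epsilon>" unfolding x_def by (intro \<epsilon>) auto
      hence "\<Psi> (A * x) \<le> \<Psi> (A * \<epsilon>)" using A x by (intro \<Psi>_mono mult_left_mono) auto
      thus ?thesis using \<epsilon>(2) S0 D0 unfolding x_def by linarith
    next
      case 2
      have "A * x \<le> A * (4 * c0)" using A 2 by (intro mult_left_mono) auto
      hence "\<Psi> (A * x) \<le> \<Psi> (4 * A * c0)" using A x by (intro \<Psi>_mono) auto
      thus ?thesis using 2 S0 unfolding x_def by simp
    next
      case 3
      then obtain n where n: "n < N" "4 * c n < x" "x \<le> 16 * c n"
        using find[of x N] x by (auto simp: c_def)
      \<comment> \<open>On the level from \<open>4 * c n\<close> to \<open>16 * c n\<close> the root
        is at least 2, hence \<open>w n\<close> is at least 1; this is why levels advance by the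
        factor 4 but start at \<open>4 * c n\<close>.\<close>
      have "sqrt (2\<^sup>2) \<le> sqrt (x / c n)" using n cpos[of n] by (intro real_sqrt_le_mono) (simp add: field_simps)
      hence w1: "1 \<le> w n (?p t)" by (simp add: w_def x_def)
      have "A * x \<le> A * (16 * c n)" using A n by (intro mult_left_mono) auto
      hence "\<Psi> (A * x) \<le> \<Psi> (16 * A * c n) * 1" using A x by (simp, intro \<Psi>_mono) auto
      also have "\<dots> \<le> \<Psi> (16 * A * c n) * w n (?p t)" by (intro mult_left_mono w1 coef0)
      also have "\<dots> \<le> (\<Sum>n<N. \<Psi> (16 * A * c n) * w n (?p t))"
        using n by (intro member_le_sum mult_nonneg_nonneg coef0 w0) auto
      finally show ?thesis using D0 unfolding x_def by linarith
    qed
  qed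
  have iS: "integrable circ (\<lambda>t. \<Sum>n<N. \<Psi> (16 * A * c n) * w n (?p t))"
    by (intro Bochner_Integration.integrable_sum integrable_mult_right iwp)
  have iD': "integrable circ (\<lambda>t. \<Psi> (4 * A * c0) * ?D t)" by (intro integrable_mult_right iD)
  have cfc: "continuous_on UNIV (\<lambda>t. f (cis t))" by (rule continuous_on_cis_cball[OF cf])
  have iw: "integrable circ (\<lambda>t. w n (cis t))" for n
    by (rule integral_circ_continuous(1)[OF continuous_on_cis_cball[OF cw]])
  have "(\<integral>t. \<Psi> (A * cmod (f (?p t))) \<partial>circ) \<le>
      (\<integral>t. 1/4 + (\<Psi> (4 * A * c0) * ?D t + (\<Sum>n<N. \<Psi> (16 * A * c n) * w n (?p t))) \<partial>circ)"
  proof (rule integral_mono[OF _ _ pt])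
    show "integrable circ (\<lambda>t. \<Psi> (A * cmod (f (?p t))))"
      using A by (intro integral_circ_continuous continuous_intros cfp) auto
  qed (intro Bochner_Integration.integrable_add iS iD' circ.integrable_const)
  also have "\<dots> = 1/4 + (\<Psi> (4 * A * c0) * (\<integral>t. ?D t \<partial>circ) + (\<Sum>n<N. \<Psi> (16 * A * c n) * (\<integral>t. w n (?p t) \<partial>circ)))"
  proof -
    have "(\<integral>t. (\<Sum>n<N. \<Psi> (16 * A * c n) * w n (?p t)) \<partial>circ) = (\<Sum>n<N. \<integral>t. \<Psi> (16 * A * c n) * w n (?p t) \<partial>circ)"
      by (intro Bochner_Integration.integral_sum integrable_mult_right iwp)
    thus ?thesis
      by (subst Bochner_Integration.integral_add, simp, intro Bochner_Integration.integrable_add iS iD',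
          subst Bochner_Integration.integral_add[OF iD' iS]) simp
  qed
  also have "\<dots> \<le> 1/4 + (1/4 + (\<Sum>n<N. \<Psi> (c n) / 8 * (\<integral>t. w n (cis t) \<partial>circ)))"
    by (intro add_mono D' sum_mono level order_refl)
  also have "(\<Sum>n<N. \<Psi> (c n) / 8 * (\<integral>t. w n (cis t) \<partial>circ)) = (\<integral>t. (\<Sum>n<N. \<Psi> (c n) / 8 * w n (cis t)) \<partial>circ)"
    by (subst Bochner_Integration.integral_sum) (auto intro!: integrable_mult_right iw)
  also have "\<dots> \<le> (\<integral>t. 1/4 * \<Psi> (cmod (f (cis t))) \<partial>circ)"
  proof (rule integral_mono)
    show "integrable circ (\<lambda>t. \<Sum>n<N. \<Psi> (c n) / 8 * w n (cis t))"
      by (intro Bochner_Integration.integrable_sum integrable_mult_right iw)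
    show "integrable circ (\<lambda>t. 1/4 * \<Psi> (cmod (f (cis t))))"
      by (intro integral_circ_continuous continuous_intros cfc) auto
    fix t
    have "(\<Sum>n<N. \<Psi> (c n) / 8 * w n (cis t)) = (\<Sum>n<N. \<Psi> (c n) * w n (cis t)) / 8"
      by (simp add: sum_divide_distrib)
    also have "\<dots> \<le> (2 * \<Psi> (cmod (f (cis t)))) / 8"
      unfolding w_def c_def by (intro divide_right_mono sum_levels_le c0) auto
    finally show "(\<Sum>n<N. \<Psi> (c n) / 8 * w n (cis t)) \<le> 1/4 * \<Psi> (cmod (f (cis t)))" by simp
  qed
  also have "\<dots> = 1/4 * (\<integral>t. \<Psi> (cmod (f (cis t))) \<partial>circ)" by (rule integral_mult_right_zero)
  finally show ?thesis using m by simp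
qed

end

section \<open>Compact composition operators\<close>

lemma compact_subset_ball_cball:
  assumes "compact X" "X \<subseteq> ball (0 :: complex) 1"
  obtains s where "0 \<le> s" "s < 1" "X \<subseteq> cball 0 s"
proof (cases "X = {}")
  case True thus ?thesis by (intro that[of 0]) auto
next
  case False
  obtain z where "z \<in> X" "\<And>w. w \<in> X \<Longrightarrow> cmod w \<le> cmod z"
    using continuous_attains_sup[OF assms(1) False continuous_on_norm_id] by blast
  thus ?thesis using assms by (intro that[of "cmod z"]) auto
qed

locale orlicz_composition = orlicz \<Psi> for \<Psi> +
  fixes \<phi> :: "complex \<Rightarrow> complex"
  assumes hol: "\<phi> holomorphic_on ball 0 1" and self: "\<phi> ` ball 0 1 \<subseteq> ball 0 1"
begin

lemma self_lt: "cmod z < 1 \<Longrightarrow> cmod (\<phi> z) < 1"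
  using self by (auto simp: image_subset_iff)

lemma hol_comp: "f holomorphic_on ball 0 1 \<Longrightarrow> (f \<circ> \<phi>) holomorphic_on ball 0 1"
  by (rule holomorphic_on_compose_gen[OF hol _ self])

text \<open>The radius 2 / (1 + r) exceeds 1 and is less than 1 / r, and it also makes sense for r =
  0.\<close>

lemma dilate_self_map:
  assumes r: "0 \<le> r" "r < 1"
  shows "orlicz_self_map \<Psi> (\<lambda>z. \<phi> (of_real r * z)) (2 / (1 + r))"
proof
  show "2 / (1 + r) > 1" using r by (simp add: field_simps)
  have in1: "cmod (of_real r * z) < 1" if "cmod z < 2 / (1 + r)" for z
  proof -
    have "r * cmod z \<le> r * (2 / (1 + r))" using that r by (intro mult_left_mono) auto
    also have "\<dots> < 1" using r by (simp add: field_simps)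
    finally show ?thesis using r by (simp add: norm_mult)
  qed
  show "(\<lambda>z. \<phi> (of_real r * z)) holomorphic_on ball 0 (2 / (1 + r))"
    by (rule holomorphic_on_compose_gen[OF _ hol, unfolded o_def]) (use in1 in \<open>auto intro!: holomorphic_intros\<close>)
  show "cmod (\<phi> (of_real r * z)) < 1" if "cmod z < 2 / (1 + r)" for z
    by (rule self_lt[OF in1[OF that]])
qed

lemma modular_comp: "modular (f \<circ> \<phi>) r C = (\<integral>t. \<Psi> (cmod (f (\<phi> (of_real r * cis t))) / C) \<partial>circ)"
  by (simp add: modular_def)

text \<open>Subordination makes every composition operator act on the space, so compactness is a
  matter of convergent subsequences only.\<close>

lemma comp_hardy_orlicz:
  assumes f: "f \<in> hardy_orlicz \<Psi>"
  shows "f \<circ> \<phi> \<in> hardy_orlicz \<Psi>"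
proof -
  define C where "C = hardy_orlicz_norm \<Psi> f + 1"
  have C: "C > 0" "hardy_orlicz_norm \<Psi> f < C" using hardy_orlicz_norm_nonneg[OF f] by (auto simp: C_def)
  have p0: "cmod (\<phi> 0) < 1" by (rule self_lt) simp
  show ?thesis
  proof (rule hardy_orliczI(1)[where C="2 / (1 - cmod (\<phi> 0)) * C"])
    show "f \<circ> \<phi> holomorphic_on ball 0 1" by (rule hol_comp[OF hardy_orlicz_holomorphic[OF f]])
    show "2 / (1 - cmod (\<phi> 0)) * C > 0" using p0 C by simp
    fix r :: real assume r: "0 \<le> r" "r < 1"
    interpret orlicz_self_map \<Psi> "\<lambda>z. \<phi> (of_real r * z)" "2 / (1 + r)" by (rule dilate_self_map[OF r])
    show "modular (f \<circ> \<phi>) r (2 / (1 - cmod (\<phi> 0)) * C) \<le> 1"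
      using littlewood_modular[OF hardy_orlicz_holomorphic[OF f] C(1) modular_le_1[OF f C(2)]]
      by (simp add: modular_comp)
  qed
qed

subsection \<open>The test functions\<close>

lemma u_kernel_norm:
  assumes "cmod \<xi> = 1" "0 < h" "h \<le> 1"
  shows "cmod (u_kernel \<xi> (1 - h) z) = h\<^sup>2 / (cmod (1 - cnj \<xi> * of_real (1 - h) * z))\<^sup>2"
  using assms by (simp add: u_kernel_def norm_power norm_divide power_divide)

lemma u_kernel_denominator_ge:
  assumes "cmod \<xi> = 1" "0 < h" "h \<le> 1" "cmod z < 1"
  shows "1 - (1 - h) * cmod z \<le> cmod (1 - cnj \<xi> * of_real (1 - h) * z)"
  using norm_triangle_ineq2[of 1 "cnj \<xi> * of_real (1 - h) * z"] assms
  by (simp add: norm_mult del: of_real_diff)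

lemma u_kernel_holomorphic:
  assumes "cmod \<xi> = 1" "0 < h" "h \<le> 1"
  shows "u_kernel \<xi> (1 - h) holomorphic_on ball 0 1"
proof -
  have "1 - cnj \<xi> * of_real (1 - h) * z \<noteq> 0" if "z \<in> ball 0 1" for z
  proof -
    have "(1 - h) * cmod z < 1"
      using assms that mult_right_le_one_le[of "1 - h" "cmod z"] mult_cmod_less_1[of "1 - h" z] by auto
    thus ?thesis using u_kernel_denominator_ge[OF assms, of z] that by auto
  qed
  thus ?thesis unfolding u_kernel_def by (intro holomorphic_intros) auto
qed

lemma u_kernel_le_1:
  assumes "cmod \<xi> = 1" "0 < h" "h \<le> 1" "cmod z < 1"
  shows "cmod (u_kernel \<xi> (1 - h) z) \<le> 1"
proof -
  have "(1 - h) * cmod z \<le> (1 - h) * 1" using assms by (intro mult_left_mono) auto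
  hence h: "h \<le> cmod (1 - cnj \<xi> * of_real (1 - h) * z)"
    using u_kernel_denominator_ge[OF assms] by simp
  hence "h\<^sup>2 \<le> (cmod (1 - cnj \<xi> * of_real (1 - h) * z))\<^sup>2" using assms by (intro power_mono) auto
  thus ?thesis
    unfolding u_kernel_norm[OF assms(1-3)] using h assms by (subst divide_le_eq_1) auto
qed

text \<open>On the circle of radius r the modulus of the test function equals
  \<open>h^2 / |cis t - z|^2\<close> with \<open>z = (1 - h) * r * \<xi>\<close>. As
  \<open>1 - |z|^2\<close> is at least h, this is at most h times a Poisson kernel.\<close>

lemma u_kernel_integral_le:
  assumes \<xi>: "cmod \<xi> = 1" and h: "0 < h" "h \<le> 1" and r: "0 \<le> r" "r < 1"
  shows "(\<integral>t. cmod (u_kernel \<xi> (1 - h) (of_real r * cis t)) \<partial>circ) \<le> h"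
proof -
  define z where "z = of_real ((1 - h) * r) * \<xi>"
  have s: "0 \<le> (1 - h) * r" "(1 - h) * r < 1"
    using h r mult_left_le[of r "1 - h"] by auto
  have nz: "cmod z = (1 - h) * r" using s \<xi> unfolding z_def by (simp only: norm_mult norm_of_real abs_of_nonneg mult_1_right)
  hence z1: "cmod z < 1" using s by simp
  have sq: "(cmod z)\<^sup>2 \<le> (1 - h)\<^sup>2"
    unfolding nz using h r by (intro power_mono) (auto simp: mult_left_le)
  have den: "h \<le> 1 - (cmod z)\<^sup>2"
  proof -
    have "(1 - h)\<^sup>2 \<le> 1 - h" using h by (simp add: power2_eq_square mult_left_le)
    thus ?thesis using sq by simp
  qed
  have *: "cmod (u_kernel \<xi> (1 - h) (of_real r * cis t)) \<le> h * poisson z (cis t)" for t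
  proof -
    have "cmod (1 - cnj \<xi> * of_real (1 - h) * (of_real r * cis t)) = cmod (cnj (1 - cnj (cis t) * z))"
      unfolding z_def by (simp add: mult_ac)
    also have "\<dots> = cmod (cis t - z)" by (simp only: complex_mod_cnj cmod_one_minus_cnj_mult[OF norm_cis])
    finally have "cmod (u_kernel \<xi> (1 - h) (of_real r * cis t)) = h * (h / (cmod (cis t - z))\<^sup>2)"
      unfolding u_kernel_norm[OF \<xi> h] by (simp add: power2_eq_square)
    also have "\<dots> \<le> h * poisson z (cis t)"
      unfolding poisson_def using h den by (intro mult_left_mono divide_right_mono) auto
    finally show ?thesis .
  qed
  have "(\<integral>t. cmod (u_kernel \<xi> (1 - h) (of_real r * cis t)) \<partial>circ) \<le> (\<integral>t. h * poisson z (cis t) \<partial>circ)"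
    using cis_neq_disc[OF z1]
    by (intro integral_mono * integral_circ_continuous continuous_intros cont_circle u_kernel_holomorphic assms) auto
  also have "\<dots> = h * (\<integral>t. poisson z (cis t) \<partial>circ)" by (rule integral_mult_right_zero)
  finally show ?thesis using poisson_integral_1[OF z1] by simp
qed

text \<open>A real \<open>SUP\<close> is meaningful only over a bounded family. Here the test
  functions are bounded by 1, uniformly in \<xi>.\<close>

lemma u_kernel_comp_bdd:
  assumes h: "0 < h" "h \<le> 1"
  shows "bdd_above ((\<lambda>\<xi>. hardy_orlicz_norm \<Psi> (u_kernel \<xi> (1 - h) \<circ> \<phi>)) ` sphere 0 1)"
    and "cmod \<xi> = 1 \<Longrightarrow> u_kernel \<xi> (1 - h) \<circ> \<phi> \<in> hardy_orlicz \<Psi>"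
proof -
  have i: "inv\<Psi> 1 > 0" "\<Psi> (inv\<Psi> 1) = 1" using inv\<Psi>_pos[of 1] inv\<Psi>[of 1] by auto
  have m: "modular (u_kernel \<xi> (1 - h) \<circ> \<phi>) r (1 / inv\<Psi> 1) \<le> 1"
    if \<xi>: "cmod \<xi> = 1" and r: "0 \<le> r" "r < 1" for \<xi> r
  proof -
    have "modular (u_kernel \<xi> (1 - h) \<circ> \<phi>) r (1 / inv\<Psi> 1) \<le> (\<integral>t. 1 \<partial>circ)"
      unfolding modular_def
    proof (rule integral_mono)
      show "integrable circ (\<lambda>t. \<Psi> (cmod ((u_kernel \<xi> (1 - h) \<circ> \<phi>) (of_real r * cis t)) / (1 / inv\<Psi> 1)))"
        using i by (intro integral_circ_continuous continuous_intros cont_circle hol_comp u_kernel_holomorphic \<xi> h r) auto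
      fix t
      have "cmod (\<phi> (of_real r * cis t)) < 1" using r by (intro self_lt) (simp add: norm_mult)
      hence "cmod (u_kernel \<xi> (1 - h) (\<phi> (of_real r * cis t))) * inv\<Psi> 1 \<le> 1 * inv\<Psi> 1"
        using i by (intro mult_right_mono u_kernel_le_1 \<xi> h) auto
      hence "\<Psi> (cmod (u_kernel \<xi> (1 - h) (\<phi> (of_real r * cis t))) * inv\<Psi> 1) \<le> \<Psi> (inv\<Psi> 1)"
        using i by (intro \<Psi>_mono) auto
      thus "\<Psi> (cmod ((u_kernel \<xi> (1 - h) \<circ> \<phi>) (of_real r * cis t)) / (1 / inv\<Psi> 1)) \<le> 1"
        using i by simp
    qed auto
    thus ?thesis by simp
  qed
  have *: "u_kernel \<xi> (1 - h) \<circ> \<phi> \<in> hardy_orlicz \<Psi>"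
    "hardy_orlicz_norm \<Psi> (u_kernel \<xi> (1 - h) \<circ> \<phi>) \<le> 1 / inv\<Psi> 1" if \<xi>: "cmod \<xi> = 1" for \<xi>
    by (rule hardy_orliczI[OF hol_comp[OF u_kernel_holomorphic[OF \<xi> h]] _ m[OF \<xi>]]; use i in simp)+
  show "bdd_above ((\<lambda>\<xi>. hardy_orlicz_norm \<Psi> (u_kernel \<xi> (1 - h) \<circ> \<phi>)) ` sphere 0 1)"
    using *(2) by (intro bdd_aboveI2) auto
  show "cmod \<xi> = 1 \<Longrightarrow> u_kernel \<xi> (1 - h) \<circ> \<phi> \<in> hardy_orlicz \<Psi>" by (rule *(1))
qed

abbreviation test_sup :: "real \<Rightarrow> real" where
  "test_sup h \<equiv> SUP \<xi>\<in>sphere 0 1. hardy_orlicz_norm \<Psi> (u_kernel \<xi> (1 - h) \<circ> \<phi>)"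

lemma test_sup_ge:
  assumes "0 < h" "h \<le> 1" "cmod \<xi> = 1"
  shows "hardy_orlicz_norm \<Psi> (u_kernel \<xi> (1 - h) \<circ> \<phi>) \<le> test_sup h"
  using assms by (intro cSUP_upper u_kernel_comp_bdd) auto

lemma test_sup_nonneg:
  assumes "0 < h" "h \<le> 1"
  shows "0 \<le> test_sup h"
  using test_sup_ge[OF assms, of 1] hardy_orlicz_norm_nonneg[OF u_kernel_comp_bdd(2)[OF assms, of 1]] by simp

text \<open>As |u| is at most 1, convexity gives
  \<open>\<Psi> (|u| * b) \<le> |u| * \<Psi> b = |u| / h\<close>, and |u| has mean at most
  h.\<close>

lemma scaled_u_kernel_modular:
  assumes \<xi>: "cmod \<xi> = 1" and h: "0 < h" "h \<le> 1" and r: "0 \<le> r" "r < 1"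
  shows "modular (\<lambda>z. of_real (inv\<Psi> (1 / h)) * u_kernel \<xi> (1 - h) z) r 1 \<le> 1"
proof -
  define b where "b = inv\<Psi> (1 / h)"
  have b: "b > 0" "\<Psi> b = 1 / h" using inv\<Psi>[of "1/h"] inv\<Psi>_pos[of "1/h"] h by (auto simp: b_def)
  let ?u = "\<lambda>t. cmod (u_kernel \<xi> (1 - h) (of_real r * cis t))"
  have c: "continuous_on UNIV (\<lambda>t. u_kernel \<xi> (1 - h) (of_real r * cis t))"
    by (intro cont_circle u_kernel_holomorphic assms)
  have "modular (\<lambda>z. of_real b * u_kernel \<xi> (1 - h) z) r 1 = (\<integral>t. \<Psi> (?u t * b) \<partial>circ)"
    using b by (simp add: modular_def norm_mult mult.commute)
  also have "\<dots> \<le> (\<integral>t. 1 / h * ?u t \<partial>circ)"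
  proof (rule integral_mono)
    fix t
    have "?u t \<le> 1" using r by (intro u_kernel_le_1 \<xi> h) (simp add: norm_mult)
    hence "\<Psi> (?u t * b) \<le> ?u t * \<Psi> b" using b by (intro \<Psi>_scale_le) auto
    thus "\<Psi> (?u t * b) \<le> 1 / h * ?u t" using b by (simp add: mult.commute)
  qed (use b in \<open>(intro integral_circ_continuous continuous_intros c; simp)+\<close>)
  also have "\<dots> = 1 / h * (\<integral>t. ?u t \<partial>circ)" by (rule integral_mult_right_zero)
  also have "\<dots> \<le> 1 / h * h" using h by (intro mult_left_mono u_kernel_integral_le assms) auto
  finally show ?thesis using h by (simp add: b_def)
qed

subsection \<open>Necessity\<close>

text \<open>At a fixed z the test function is of order \<open>h^2\<close>, while
  \<open>inv\<Psi> (1/h)\<close> is at most \<open>a + 1/h\<close>. The points \<xi> may vary with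
  n.\<close>

lemma scaled_u_kernel_tendsto_0:
  assumes h: "\<And>n. 0 < h n" "\<And>n. h n \<le> 1" "h \<longlonglongrightarrow> 0" and \<xi>: "\<And>n. cmod (\<xi> n) = 1" and z: "cmod z < 1"
  shows "(\<lambda>n. of_real (inv\<Psi> (1 / h n)) * u_kernel (\<xi> n) (1 - h n) z) \<longlonglongrightarrow> 0"
proof -
  obtain a where a: "a \<ge> 0" "\<And>x. x \<ge> 0 \<Longrightarrow> x \<le> a + \<Psi> x" using \<Psi>_growth by blast
  have bound: "norm (of_real (inv\<Psi> (1 / h n)) * u_kernel (\<xi> n) (1 - h n) z) \<le> (a * (h n)\<^sup>2 + h n) / (1 - cmod z)\<^sup>2" for n
  proof -
    define b where "b = inv\<Psi> (1 / h n)"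
    have b: "0 \<le> b" "b \<le> a + 1 / h n"
      using a(2)[of b] inv\<Psi>[of "1 / h n"] h(1)[of n] by (auto simp: b_def)
    have "1 - cmod z \<le> 1 - (1 - h n) * cmod z"
      using h(1,2)[of n] mult_left_le_one_le[of "cmod z" "1 - h n"] by simp
    hence d: "1 - cmod z \<le> cmod (1 - cnj (\<xi> n) * of_real (1 - h n) * z)"
      using u_kernel_denominator_ge[OF \<xi>[of n] h(1,2)[of n] z] by linarith
    hence "(1 - cmod z)\<^sup>2 \<le> (cmod (1 - cnj (\<xi> n) * of_real (1 - h n) * z))\<^sup>2"
      using z by (intro power_mono) auto
    moreover have "(1 - cmod z)\<^sup>2 > 0" using z by simp
    ultimately have "cmod (u_kernel (\<xi> n) (1 - h n) z) \<le> (h n)\<^sup>2 / (1 - cmod z)\<^sup>2"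
      unfolding u_kernel_norm[OF \<xi>[of n] h(1,2)[of n]] by (intro divide_left_mono mult_pos_pos) auto
    hence "b * cmod (u_kernel (\<xi> n) (1 - h n) z) \<le> (a + 1 / h n) * ((h n)\<^sup>2 / (1 - cmod z)\<^sup>2)"
      using b by (intro mult_mono) auto
    also have "\<dots> = (a * (h n)\<^sup>2 + h n) / (1 - cmod z)\<^sup>2"
    proof -
      have "(a + 1 / h n) * (h n)\<^sup>2 = a * (h n)\<^sup>2 + h n"
        using h(1)[of n] by (simp add: distrib_right power2_eq_square)
      thus ?thesis by simp
    qed
    finally show ?thesis using b by (simp add: norm_mult b_def)
  qed
  have "(\<lambda>n. (a * (h n)\<^sup>2 + h n) / (1 - cmod z)\<^sup>2) \<longlonglongrightarrow> (a * 0\<^sup>2 + 0) / (1 - cmod z)\<^sup>2"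
    using z by (intro tendsto_intros h) auto
  hence lim: "(\<lambda>n. (a * (h n)\<^sup>2 + h n) / (1 - cmod z)\<^sup>2) \<longlonglongrightarrow> 0" by simp
  show ?thesis
    by (rule Lim_null_comparison[OF always_eventually lim]) (use bound in blast)
qed

text \<open>Point evaluations are continuous by \<open>\<Psi>_pointwise_le\<close>; it is used to
  identify the limit in \<open>compact_imp_littleo\<close>.\<close>

lemma norm_tendsto_0_imp_pointwise:
  assumes d: "\<And>n. d n \<in> hardy_orlicz \<Psi>" and lim: "(\<lambda>n. hardy_orlicz_norm \<Psi> (d n)) \<longlonglongrightarrow> 0" and z: "cmod z < 1"
  shows "(\<lambda>n. d n z) \<longlonglongrightarrow> 0"
proof -
  define b where "b = inv\<Psi> (2 / (1 - cmod z))"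
  have b: "b > 0" unfolding b_def using z by (intro inv\<Psi>_pos) auto
  show ?thesis
  proof (rule tendstoI)
    fix e :: real assume e: "e > 0"
    have "eventually (\<lambda>n. hardy_orlicz_norm \<Psi> (d n) < e / (2 * b)) sequentially"
      using lim e b by (intro order_tendstoD(2)) auto
    thus "eventually (\<lambda>n. dist (d n z) 0 < e) sequentially"
    proof eventually_elim
      case (elim n)
      have "\<Psi> (cmod (d n z) / (e / (2 * b))) \<le> 2 / (1 - cmod z)"
        using e b z elim by (intro \<Psi>_pointwise_le modular_le_1 d hardy_orlicz_holomorphic) auto
      hence "cmod (d n z) / (e / (2 * b)) \<le> b"
        unfolding b_def using e b z by (subst le_inv\<Psi>_iff) (auto simp: b_def)
      hence "cmod (d n z) \<le> e / 2" using e b by (simp add: field_simps)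
      thus ?case using e by simp
    qed
  qed
qed

text \<open>A failure of the little-o yields normalized test functions whose images keep norm above
  c. A norm limit of a subsequence of the images would have to be their pointwise limit 0.\<close>

lemma compact_imp_littleo:
  assumes comp: "compact_composition \<Psi> \<phi>"
  shows "test_sup \<in> o[at_right 0](\<lambda>h. 1 / inv\<Psi> (1 / h))"
proof (rule ccontr)
  assume "\<not> ?thesis"
  then obtain c where c: "c > 0" "\<not> eventually (\<lambda>h. norm (test_sup h) \<le> c * norm (1 / inv\<Psi> (1 / h))) (at_right 0)"
    by (auto simp: smallo_def)
  have "\<exists>h \<xi>. 0 < h \<and> h < 1 / real (Suc n) \<and> cmod \<xi> = 1 \<and>
      c / inv\<Psi> (1 / h) < hardy_orlicz_norm \<Psi> (u_kernel \<xi> (1 - h) \<circ> \<phi>)" for n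
  proof -
    have "\<not> (\<forall>h>0. h < 1 / real (Suc n) \<longrightarrow> norm (test_sup h) \<le> c * norm (1 / inv\<Psi> (1 / h)))"
      using c(2) unfolding eventually_at_right_field by (metis of_nat_0_less_iff zero_less_Suc zero_less_divide_1_iff)
    then obtain h where h: "0 < h" "h < 1 / real (Suc n)" "norm (test_sup h) > c * norm (1 / inv\<Psi> (1 / h))"
      by (auto simp: not_le)
    have "1 / real (Suc n) \<le> 1" by simp
    hence h1: "h \<le> 1" using h by linarith
    have "c / inv\<Psi> (1 / h) < test_sup h"
      using h(3) test_sup_nonneg[OF h(1) h1] inv\<Psi>_pos[of "1/h"] h(1) by simp
    then obtain \<xi> where "\<xi> \<in> sphere 0 1" "c / inv\<Psi> (1 / h) < hardy_orlicz_norm \<Psi> (u_kernel \<xi> (1 - h) \<circ> \<phi>)"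
      using less_cSUP_iff[OF _ u_kernel_comp_bdd(1)[OF h(1) h1]] by auto
    thus ?thesis using h by (intro exI[of _ h] exI[of _ \<xi>]) auto
  qed
  then obtain h \<xi> where h: "\<And>n. 0 < h n" "\<And>n. h n < 1 / real (Suc n)" and \<xi>: "\<And>n. cmod (\<xi> n) = 1"
    and big: "\<And>n. c / inv\<Psi> (1 / h n) < hardy_orlicz_norm \<Psi> (u_kernel (\<xi> n) (1 - h n) \<circ> \<phi>)"
    by metis
  have h1: "h n \<le> 1" for n
  proof -
    have "1 / real (Suc n) \<le> 1" by simp
    thus ?thesis using h(2)[of n] by linarith
  qed
  have hlim: "h \<longlonglongrightarrow> 0"
    by (rule real_tendsto_sandwich[OF _ _ tendsto_const LIMSEQ_inverse_real_of_nat])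
       (use h in \<open>auto simp: less_imp_le inverse_eq_divide simp del: of_nat_Suc\<close>)
  define F where "F = (\<lambda>n z. of_real (inv\<Psi> (1 / h n)) * u_kernel (\<xi> n) (1 - h n) z)"
  have Fh: "F n holomorphic_on ball 0 1" for n
    unfolding F_def by (intro holomorphic_intros u_kernel_holomorphic \<xi> h h1)
  have F: "F n \<in> hardy_orlicz \<Psi>" "hardy_orlicz_norm \<Psi> (F n) \<le> 1" for n
    using Fh[of n] scaled_u_kernel_modular[OF \<xi> h(1) h1] unfolding F_def by (auto intro!: hardy_orliczI)
  from F have "bdd_above (range (\<lambda>n. hardy_orlicz_norm \<Psi> (F n)))" by (intro bdd_aboveI2) auto
  with comp F obtain s g where s: "strict_mono s" and g: "g \<in> hardy_orlicz \<Psi>"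
    and lim: "(\<lambda>n. hardy_orlicz_norm \<Psi> (\<lambda>z. (F (s n) \<circ> \<phi>) z - g z)) \<longlonglongrightarrow> 0"
    unfolding compact_composition_def by blast
  have d: "(\<lambda>z. (F (s n) \<circ> \<phi>) z - g z) \<in> hardy_orlicz \<Psi>" for n
    by (intro hardy_orlicz_diff comp_hardy_orlicz F g)
  have g0: "g z = 0" if z: "cmod z < 1" for z
  proof -
    have "(\<lambda>n. F n (\<phi> z)) \<longlonglongrightarrow> 0"
      unfolding F_def by (rule scaled_u_kernel_tendsto_0[OF h(1) h1 hlim \<xi> self_lt[OF z]])
    hence "(\<lambda>n. F (s n) (\<phi> z)) \<longlonglongrightarrow> 0" using LIMSEQ_subseq_LIMSEQ[OF _ s] by (auto simp: o_def)
    moreover have "(\<lambda>n. F (s n) (\<phi> z) - g z) \<longlonglongrightarrow> 0"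
      using norm_tendsto_0_imp_pointwise[OF d lim z] by simp
    ultimately have "(\<lambda>n. F (s n) (\<phi> z) - (F (s n) (\<phi> z) - g z)) \<longlonglongrightarrow> 0 - 0" by (rule tendsto_diff)
    thus ?thesis by (simp add: LIMSEQ_const_iff)
  qed
  have "eventually (\<lambda>n. hardy_orlicz_norm \<Psi> (\<lambda>z. (F (s n) \<circ> \<phi>) z - g z) < c) sequentially"
    using lim c by (intro order_tendstoD(2)) auto
  then obtain n where n: "hardy_orlicz_norm \<Psi> (\<lambda>z. (F (s n) \<circ> \<phi>) z - g z) < c"
    by (auto simp: eventually_sequentially)
  let ?n = "s n"
  define b where "b = inv\<Psi> (1 / h ?n)"
  have b: "b > 0" unfolding b_def using h by (intro inv\<Psi>_pos) auto
  have "hardy_orlicz_norm \<Psi> (u_kernel (\<xi> ?n) (1 - h ?n) \<circ> \<phi>) \<le> c / b"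
  proof (rule hardy_orliczI(2))
    show "u_kernel (\<xi> ?n) (1 - h ?n) \<circ> \<phi> holomorphic_on ball 0 1"
      by (intro hol_comp u_kernel_holomorphic \<xi> h h1)
    show "c / b > 0" using c b by simp
    fix r :: real assume r: "0 \<le> r" "r < 1"
    \<comment> \<open>The normalizing factor b is moved into the scale: scale c for the normalized
      function is scale c / b for the test function.\<close>
    have "modular (u_kernel (\<xi> ?n) (1 - h ?n) \<circ> \<phi>) r (c / b) = modular (\<lambda>z. (F ?n \<circ> \<phi>) z - g z) r c"
      unfolding modular_def
    proof (rule Bochner_Integration.integral_cong[OF refl])
      fix t
      have "g (of_real r * cis t) = 0" using r by (intro g0) (simp add: norm_mult)
      thus "\<Psi> (cmod ((u_kernel (\<xi> ?n) (1 - h ?n) \<circ> \<phi>) (of_real r * cis t)) / (c / b)) =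
          \<Psi> (cmod ((F ?n \<circ> \<phi>) (of_real r * cis t) - g (of_real r * cis t)) / c)"
        using b by (simp add: F_def b_def[symmetric] norm_mult mult.commute)
    qed
    also have "\<dots> \<le> 1" by (rule modular_le_1[OF d n r])
    finally show "modular (u_kernel (\<xi> ?n) (1 - h ?n) \<circ> \<phi>) r (c / b) \<le> 1" .
  qed
  thus False using big[of ?n] by (simp add: b_def)
qed

subsection \<open>Sufficiency\<close>

text \<open>Chebyshev's inequality: where \<phi> is within 8h of \<eta>, the denominator of the test
  function is at most 9h, so its modulus is at least 1/81.\<close>

lemma littleo_imp_window_bound:
  assumes lo: "test_sup \<in> o[at_right 0](\<lambda>h. 1 / inv\<Psi> (1 / h))" and B: "B > 0"
  shows "\<exists>h0>0. \<forall>h r \<eta>. 0 < h \<longrightarrow> h < h0 \<longrightarrow> 0 \<le> r \<longrightarrow> r < 1 \<longrightarrow> cmod \<eta> = 1 \<longrightarrow>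
     measure circ {t. cmod (\<phi> (of_real r * cis t) - \<eta>) < 8 * h} \<le> 1 / \<Psi> (B * inv\<Psi> (1 / h))"
proof -
  have "eventually (\<lambda>h. norm (test_sup h) \<le> 1 / (162 * B) * norm (1 / inv\<Psi> (1 / h))) (at_right 0)"
    using landau_o.smallD[OF lo, of "1 / (162 * B)"] B by simp
  then obtain h0 where h0: "h0 > 0"
    "\<And>h. 0 < h \<Longrightarrow> h < h0 \<Longrightarrow> norm (test_sup h) \<le> 1 / (162 * B) * norm (1 / inv\<Psi> (1 / h))"
    unfolding eventually_at_right_field by auto
  show ?thesis
  proof (intro exI[of _ "min h0 1"] conjI allI impI)
    show "min h0 1 > 0" using h0 by simp
    fix h r :: real and \<eta> :: complex
    assume hh: "0 < h" "h < min h0 1" and r: "0 \<le> r" "r < 1" and \<eta>: "cmod \<eta> = 1"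
    define b where "b = inv\<Psi> (1 / h)"
    have b: "b > 0" unfolding b_def using hh by (intro inv\<Psi>_pos) auto
    have h: "0 < h" "h \<le> 1" using hh by auto
    \<comment> \<open>At this scale the value 1/81 becomes exactly \<open>B * b\<close>. The
      constant 162 is twice 81, which gives the strict inequality required by
      \<open>modular_le_1\<close>.\<close>
    define C where "C = 1 / (81 * B * b)"
    have C: "C > 0" using B b by (simp add: C_def)
    have "hardy_orlicz_norm \<Psi> (u_kernel \<eta> (1 - h) \<circ> \<phi>) \<le> test_sup h"
      by (rule test_sup_ge[OF h \<eta>])
    also have "\<dots> \<le> 1 / (162 * B) * (1 / b)"
      using h0(2)[of h] hh b by (simp add: b_def)
    also have "\<dots> < C" using B b by (simp add: C_def field_simps)
    finally have less: "hardy_orlicz_norm \<Psi> (u_kernel \<eta> (1 - h) \<circ> \<phi>) < C" .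
    have m: "modular (u_kernel \<eta> (1 - h) \<circ> \<phi>) r C \<le> 1"
      by (rule modular_le_1[OF u_kernel_comp_bdd(2)[OF h \<eta>] less r])
    let ?p = "\<lambda>t. \<phi> (of_real r * cis t)"
    let ?W = "{t. cmod (?p t - \<eta>) < 8 * h}"
    have cp: "continuous_on UNIV ?p" by (rule cont_circle[OF hol r])
    have [measurable]: "?p \<in> borel_measurable borel" by (rule borel_measurable_continuous_onI[OF cp])
    have cu: "continuous_on UNIV (\<lambda>t. u_kernel \<eta> (1 - h) (?p t))"
      using cont_circle[OF hol_comp[OF u_kernel_holomorphic[OF \<eta> h]] r] by simp
    have \<Psi>pos: "\<Psi> (B * b) > 0" using B b by (intro \<Psi>_pos) auto
    have "\<Psi> (B * b) * measure circ ?W = (\<integral>t. \<Psi> (B * b) * indicator ?W t \<partial>circ)"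
      by simp
    also have "\<dots> \<le> (\<integral>t. \<Psi> (cmod (u_kernel \<eta> (1 - h) (?p t)) / C) \<partial>circ)"
    proof (rule integral_mono)
      show "integrable circ (\<lambda>t. \<Psi> (B * b) * indicator ?W t)"
        by (intro integrable_mult_right integrable_circ_bounded[where B=1]) (auto simp: indicator_def)
      show "integrable circ (\<lambda>t. \<Psi> (cmod (u_kernel \<eta> (1 - h) (?p t)) / C))"
        using C by (intro integral_circ_continuous continuous_intros cu) auto
      fix t
      show "\<Psi> (B * b) * indicator ?W t \<le> \<Psi> (cmod (u_kernel \<eta> (1 - h) (?p t)) / C)"
      proof (cases "t \<in> ?W")
        case False
        thus ?thesis using C by (auto intro: \<Psi>_nonneg)
      next
        case True
        define z where "z = ?p t"
        have z: "cmod z < 1" "cmod (\<eta> - z) < 8 * h"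
          using True r by (auto simp: z_def norm_mult norm_minus_commute intro!: self_lt)
        have "1 - cnj \<eta> * of_real (1 - h) * z = (1 - cnj \<eta> * z) + of_real h * (cnj \<eta> * z)"
          by (simp add: algebra_simps)
        also have "cmod \<dots> \<le> cmod (1 - cnj \<eta> * z) + cmod (of_real h * (cnj \<eta> * z))"
          by (rule norm_triangle_ineq)
        also have "cmod (1 - cnj \<eta> * z) = cmod (\<eta> - z)" by (rule cmod_one_minus_cnj_mult[OF \<eta>])
        also have "cmod (of_real h * (cnj \<eta> * z)) \<le> h" using h \<eta> z by (simp add: norm_mult mult_left_le)
        finally have le: "cmod (1 - cnj \<eta> * of_real (1 - h) * z) \<le> 9 * h" using z by simp
        have "(1 - h) * cmod z < 1" using h z mult_cmod_less_1[of "1 - h" z] by simp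
        hence pos: "cmod (1 - cnj \<eta> * of_real (1 - h) * z) > 0"
          using u_kernel_denominator_ge[OF \<eta> h z(1)] by linarith
        have "(cmod (1 - cnj \<eta> * of_real (1 - h) * z))\<^sup>2 \<le> (9 * h)\<^sup>2" using le by (intro power_mono) auto
        hence "h\<^sup>2 / (9 * h)\<^sup>2 \<le> cmod (u_kernel \<eta> (1 - h) z)"
          unfolding u_kernel_norm[OF \<eta> h] using pos h by (intro divide_left_mono mult_pos_pos) auto
        hence "1 / 81 \<le> cmod (u_kernel \<eta> (1 - h) z)" using h by (simp add: power_mult_distrib)
        hence "(1 / 81) / C \<le> cmod (u_kernel \<eta> (1 - h) z) / C" using C by (intro divide_right_mono) auto
        moreover have "(1 / 81) / C = B * b" using B b by (simp add: C_def)
        ultimately have "\<Psi> (B * b) \<le> \<Psi> (cmod (u_kernel \<eta> (1 - h) z) / C)"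
          using B b by (intro \<Psi>_mono) auto
        thus ?thesis using True by (simp add: z_def)
      qed
    qed
    also have "\<dots> \<le> 1" using m by (simp add: modular_comp)
    finally show "measure circ ?W \<le> 1 / \<Psi> (B * inv\<Psi> (1 / h))"
      using \<Psi>pos by (simp add: b_def field_simps)
  qed
qed

text \<open>The choice of constants must not depend on f or r, and its order matters: A determines
  \<open>h1\<close>, then \<open>c0\<close>, then B; the window bound is used a second time with
  this B to find \<delta>.\<close>

lemma uniform_smallness:
  assumes lo: "test_sup \<in> o[at_right 0](\<lambda>h. 1 / inv\<Psi> (1 / h))" and A: "A > 0"
  shows "\<exists>\<delta> \<epsilon>. 0 < \<delta> \<and> \<delta> < 1 \<and> 0 < \<epsilon> \<and> (\<forall>f. f holomorphic_on ball 0 1 \<longrightarrow>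
     (\<forall>r. 0 \<le> r \<longrightarrow> r < 1 \<longrightarrow> modular f r 1 \<le> 1) \<longrightarrow> (\<forall>z. cmod z \<le> 1 - \<delta> \<longrightarrow> cmod (f z) \<le> \<epsilon>) \<longrightarrow>
     (\<forall>r. 0 \<le> r \<longrightarrow> r < 1 \<longrightarrow> modular (f \<circ> \<phi>) r (1 / A) \<le> 1))"
proof -
  define K where "K = 80 * pi + 8"
  have K: "K > 8" using pi_gt_zero by (simp add: K_def)
  have p0: "cmod (\<phi> 0) < 1" by (rule self_lt) simp
  obtain h0 where h0: "h0 > 0" and win0: "\<And>h r \<eta>. 0 < h \<Longrightarrow> h < h0 \<Longrightarrow> 0 \<le> r \<Longrightarrow> r < 1 \<Longrightarrow> cmod \<eta> = 1 \<Longrightarrow>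
     measure circ {t. cmod (\<phi> (of_real r * cis t) - \<eta>) < 8 * h} \<le> 1 / \<Psi> (128 * A * K * inv\<Psi> (1 / h))"
    using littleo_imp_window_bound[OF lo, of "128 * A * K"] A K by auto
  define h1 where "h1 = min h0 ((1 - cmod (\<phi> 0)) / 8)"
  have h1': "h1 > 0" "h1 \<le> h0" "h1 \<le> (1 - cmod (\<phi> 0)) / 8"
    using h0 p0 unfolding h1_def by (simp_all only: min.cobounded1 min.cobounded2 min_less_iff_conj) simp
  have "8 * h1 \<le> 1 - cmod (\<phi> 0)" using h1'(3) by (simp add: field_simps)
  moreover from this have "h1 \<le> 1" using norm_ge_zero[of "\<phi> 0"] h1'(1) by linarith
  ultimately have h1: "h1 > 0" "h1 \<le> h0" "8 * h1 \<le> 1 - cmod (\<phi> 0)" "h1 \<le> 1"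
    using h1' by auto
  \<comment> \<open>The value 8 / h1 makes the first depth \<open>4 / \<Psi> c0\<close> equal to h1
    / 2.\<close>
  define c0 where "c0 = inv\<Psi> (8 / h1)"
  have c0: "c0 > 0" "\<Psi> c0 = 8 / h1" using h1 inv\<Psi>_pos[of "8/h1"] inv\<Psi>[of "8/h1"] by (auto simp: c0_def)
  define B where "B = max 1 (4 * \<Psi> (4 * A * c0) * K)"
  have B: "B \<ge> 1" "\<Psi> (4 * A * c0) * K \<le> B / 4" by (auto simp: B_def)
  obtain h2 where h2: "h2 > 0" and win2: "\<And>h r \<eta>. 0 < h \<Longrightarrow> h < h2 \<Longrightarrow> 0 \<le> r \<Longrightarrow> r < 1 \<Longrightarrow> cmod \<eta> = 1 \<Longrightarrow>
     measure circ {t. cmod (\<phi> (of_real r * cis t) - \<eta>) < 8 * h} \<le> 1 / \<Psi> (B * inv\<Psi> (1 / h))"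
    using littleo_imp_window_bound[OF lo, of B] B by auto
  define \<delta> where "\<delta> = min h1 h2 / 2"
  have \<delta>: "0 < \<delta>" "\<delta> < h1" "\<delta> < h2" using h1 h2 by (auto simp: \<delta>_def)
  define \<epsilon> where "\<epsilon> = inv\<Psi> (1 / 4) / A"
  have \<epsilon>: "\<epsilon> > 0" "\<Psi> (A * \<epsilon>) \<le> 1 / 4" using A inv\<Psi>_pos[of "1/4"] inv\<Psi>[of "1/4"] by (auto simp: \<epsilon>_def)
  show ?thesis
  proof (rule exI[of _ \<delta>], rule exI[of _ \<epsilon>], intro conjI allI impI)
    show "0 < \<delta>" "\<delta> < 1" "0 < \<epsilon>" using \<delta> h1 \<epsilon> by auto
    fix f :: "complex \<Rightarrow> complex" and r :: real
    assume f: "f holomorphic_on ball 0 1" and m: "\<forall>r. 0 \<le> r \<longrightarrow> r < 1 \<longrightarrow> modular f r 1 \<le> 1"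
      and small: "\<forall>z. cmod z \<le> 1 - \<delta> \<longrightarrow> cmod (f z) \<le> \<epsilon>" and r: "0 \<le> r" "r < 1"
    interpret orlicz_self_map \<Psi> "\<lambda>z. \<phi> (of_real r * z)" "2 / (1 + r)" by (rule dilate_self_map[OF r])
    have "(\<integral>t. \<Psi> (cmod (f (\<phi> (of_real r * cis t))) / (1 / A)) \<partial>circ) \<le> 1"
    proof (rule modular_dilate_limit[OF f])
      show "1 / A > 0" using A by simp
      fix R :: real assume R: "0 < R" "R < 1"
      have "(\<integral>t. \<Psi> (A * cmod (f (of_real R * \<phi> (of_real r * cis t)))) \<partial>circ) \<le> 1"
      proof (rule carleson_estimate[where f="\<lambda>z. f (of_real R * z)" and ?h1.0=h1 and \<delta>=\<delta> and \<epsilon>=\<epsilon> and B=B and ?c0.0=c0,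
            OF holomorphic_dilate[OF f R], folded K_def])
        show "1 < 1 / R" using R by simp
        show "(\<integral>t. \<Psi> (cmod (f (of_real R * cis t))) \<partial>circ) \<le> 1" using m R by (simp add: modular_def)
        show "A > 0" "h1 \<le> 1" "8 * h1 \<le> 1 - cmod (\<phi> (of_real r * 0))" "c0 > 0" using A h1 c0 by auto
        show "4 / \<Psi> c0 < h1" using c0(2) h1 by simp
        show "measure circ {t. cmod (\<phi> (of_real r * cis t) - \<eta>) < 8 * h} \<le> 1 / \<Psi> (128 * A * K * inv\<Psi> (1 / h))"
          if "0 < h" "h < h1" "cmod \<eta> = 1" for h \<eta> using that h1 r by (intro win0) auto
        show "0 < \<delta>" "\<delta> < h1" "B \<ge> 1" "\<Psi> (4 * A * c0) * K \<le> B / 4" "\<Psi> (A * \<epsilon>) \<le> 1 / 4" by fact+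
        show "measure circ {t. cmod (\<phi> (of_real r * cis t) - \<eta>) < 8 * \<delta>} \<le> 1 / \<Psi> (B * inv\<Psi> (1 / \<delta>))"
          if "cmod \<eta> = 1" for \<eta> using that \<delta> r by (intro win2) auto
        show "cmod (f (of_real R * z)) \<le> \<epsilon>" if "cmod z \<le> 1 - \<delta>" for z
        proof -
          have "R * cmod z \<le> 1 * cmod z" using R by (intro mult_right_mono) auto
          thus ?thesis using that R small by (auto simp: norm_mult)
        qed
      qed
      thus "(\<integral>t. \<Psi> (cmod (f (of_real R * \<phi> (of_real r * cis t))) / (1 / A)) \<partial>circ) \<le> 1"
        by (simp add: mult.commute)
    qed
    thus "modular (f \<circ> \<phi>) r (1 / A) \<le> 1" by (simp add: modular_comp)
  qed
qed

text \<open>On a circle of radius r < 1 the pointwise estimate provides the constant majorant 2 / (1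
  - r) for dominated convergence.\<close>

lemma modular_limit:
  assumes F: "\<And>n. F n holomorphic_on ball 0 1" and G: "G holomorphic_on ball 0 1" and C: "C > 0"
    and m: "\<And>n r. 0 \<le> r \<Longrightarrow> r < 1 \<Longrightarrow> modular (F n) r C \<le> 1"
    and lim: "\<And>z. cmod z < 1 \<Longrightarrow> (\<lambda>n. F n z) \<longlonglongrightarrow> G z" and r: "0 \<le> r" "r < 1"
  shows "modular G r C \<le> 1"
proof -
  have "(\<lambda>n. modular (F n) r C) \<longlonglongrightarrow> modular G r C"
    unfolding modular_def
  proof (rule integral_dominated_convergence[where w="\<lambda>_. 2 / (1 - r)"])
    have c: "continuous_on UNIV (\<lambda>t. \<Psi> (cmod (f (of_real r * cis t)) / C))" if "f holomorphic_on ball 0 1" for f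
      using C by (intro continuous_intros cont_circle that r) auto
    show "(\<lambda>t. \<Psi> (cmod (G (of_real r * cis t)) / C)) \<in> borel_measurable circ"
      using borel_measurable_continuous_onI[OF c[OF G]] by simp
    show "(\<lambda>t. \<Psi> (cmod (F n (of_real r * cis t)) / C)) \<in> borel_measurable circ" for n
      using borel_measurable_continuous_onI[OF c[OF F]] by simp
    show "AE t in circ. (\<lambda>n. \<Psi> (cmod (F n (of_real r * cis t)) / C)) \<longlonglongrightarrow> \<Psi> (cmod (G (of_real r * cis t)) / C)"
    proof (rule AE_I2)
      fix t
      have "(\<lambda>n. F n (of_real r * cis t)) \<longlonglongrightarrow> G (of_real r * cis t)"
        using r by (intro lim) (simp add: norm_mult)
      hence "(\<lambda>n. cmod (F n (of_real r * cis t)) / C) \<longlonglongrightarrow> cmod (G (of_real r * cis t)) / C"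
        using C by (intro tendsto_intros) auto
      thus "(\<lambda>n. \<Psi> (cmod (F n (of_real r * cis t)) / C)) \<longlonglongrightarrow> \<Psi> (cmod (G (of_real r * cis t)) / C)"
        using C by (intro continuous_on_tendsto_compose[OF cont_\<Psi>]) auto
    qed
    show "AE t in circ. norm (\<Psi> (cmod (F n (of_real r * cis t)) / C)) \<le> 2 / (1 - r)" for n
    proof (rule AE_I2)
      fix t
      have "\<Psi> (cmod (F n (of_real r * cis t)) / C) \<le> 2 / (1 - cmod (of_real r * cis t))"
        using r by (intro \<Psi>_pointwise_le F C m) (auto simp: norm_mult)
      moreover have "0 \<le> \<Psi> (cmod (F n (of_real r * cis t)) / C)" using C by (intro \<Psi>_nonneg) auto
      ultimately show "norm (\<Psi> (cmod (F n (of_real r * cis t)) / C)) \<le> 2 / (1 - r)"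
        using r by (simp add: norm_mult)
    qed
  qed auto
  thus ?thesis by (rule LIMSEQ_le_const2) (use m r in auto)
qed

text \<open>Montel's theorem gives a locally uniform limit G, and the modular bound passes to it.
  The rescaled differences to G are then uniformly small on the disc of radius 1 - \<delta>, the
  remaining hypothesis of \<open>uniform_smallness\<close>.\<close>

lemma littleo_imp_compact:
  assumes lo: "test_sup \<in> o[at_right 0](\<lambda>h. 1 / inv\<Psi> (1 / h))"
  shows "compact_composition \<Psi> \<phi>"
  unfolding compact_composition_def
proof (intro conjI allI impI ballI)
  show "f \<circ> \<phi> \<in> hardy_orlicz \<Psi>" if "f \<in> hardy_orlicz \<Psi>" for f using that by (rule comp_hardy_orlicz)
  fix F :: "nat \<Rightarrow> complex \<Rightarrow> complex"
  assume "(\<forall>n. F n \<in> hardy_orlicz \<Psi>) \<and> bdd_above (range (\<lambda>n. hardy_orlicz_norm \<Psi> (F n)))"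
  then obtain K0 where F: "\<And>n. F n \<in> hardy_orlicz \<Psi>" and K0: "\<And>n. hardy_orlicz_norm \<Psi> (F n) \<le> K0"
    unfolding bdd_above_def by auto
  define K where "K = K0 + 1"
  have K: "K > 0" "\<And>n. hardy_orlicz_norm \<Psi> (F n) < K"
    unfolding K_def using K0[of 0] hardy_orlicz_norm_nonneg[OF F, of 0]
    by linarith (rule le_less_trans[OF K0], simp)
  define H where "H = {f. f holomorphic_on ball 0 1 \<and> (\<forall>r. 0 \<le> r \<longrightarrow> r < 1 \<longrightarrow> modular f r K \<le> 1)}"
  have FH: "F n \<in> H" for n
    using F K(2) by (auto simp: H_def intro: hardy_orlicz_holomorphic modular_le_1)
  have bounded: "\<exists>B. \<forall>f\<in>H. \<forall>z\<in>X. norm (f z) \<le> B" if X: "compact X" "X \<subseteq> ball 0 1" for X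
  proof -
    obtain s where s: "0 \<le> s" "s < 1" "X \<subseteq> cball 0 s" using compact_subset_ball_cball[OF X] .
    have "norm (f z) \<le> K * inv\<Psi> (2 / (1 - s))" if "f \<in> H" "z \<in> X" for f z
    proof -
      have z: "cmod z \<le> s" using that s by auto
      have "\<Psi> (cmod (f z) / K) \<le> 2 / (1 - cmod z)"
        using that z s K by (intro \<Psi>_pointwise_le) (auto simp: H_def)
      also have "\<dots> \<le> 2 / (1 - s)" using z s by (intro divide_left_mono mult_pos_pos) auto
      finally have "cmod (f z) / K \<le> inv\<Psi> (2 / (1 - s))" using s K by (subst le_inv\<Psi>_iff) auto
      thus ?thesis using K by (simp add: field_simps)
    qed
    thus ?thesis by blast
  qed
  obtain G s where G: "G holomorphic_on ball 0 1" and s: "strict_mono (s :: nat \<Rightarrow> nat)"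
    and ptw: "\<And>z. z \<in> ball 0 1 \<Longrightarrow> (\<lambda>n. F (s n) z) \<longlonglongrightarrow> G z"
    and unif: "\<And>X. compact X \<Longrightarrow> X \<subseteq> ball 0 1 \<Longrightarrow> uniform_limit X (F \<circ> s) G sequentially"
    by (rule Montel[of "ball 0 1" H F, OF _ _ bounded]) (use FH in \<open>auto simp: H_def\<close>)
  have mF: "modular (F n) r K \<le> 1" if "0 \<le> r" "r < 1" for n r using FH[of n] that by (simp add: H_def)
  have Fh: "F n holomorphic_on ball 0 1" for n by (rule hardy_orlicz_holomorphic[OF F])
  have mG: "modular G r K \<le> 1" if "0 \<le> r" "r < 1" for r
    by (rule modular_limit[where F="\<lambda>n. F (s n)", OF Fh G K(1) mF]) (use ptw that in auto)
  have GH: "G \<in> hardy_orlicz \<Psi>" by (rule hardy_orliczI(1)[OF G K(1) mG])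
  \<comment> \<open>Division by 2K brings the differences to modular at most 1.\<close>
  define f where "f = (\<lambda>n z. (F (s n) z - G z) / of_real (2 * K))"
  have fh: "f n holomorphic_on ball 0 1" for n
    unfolding f_def using K by (intro holomorphic_intros Fh G) auto
  have mf: "modular (f n) r 1 \<le> 1" if "0 \<le> r" "r < 1" for n r
  proof -
    have "modular (f n) r 1 = modular (\<lambda>z. F (s n) z - G z) r (2 * K)"
      unfolding modular_def f_def norm_divide norm_of_real using K by simp
    also have "\<dots> \<le> 1" by (rule modular_diff[OF Fh mF[OF that] G mG[OF that] K(1) that])
    finally show ?thesis .
  qed
  have dH: "(\<lambda>z. (F (s n) \<circ> \<phi>) z - (G \<circ> \<phi>) z) \<in> hardy_orlicz \<Psi>" for n
    by (intro hardy_orlicz_diff comp_hardy_orlicz F GH)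
  have "(\<lambda>n. hardy_orlicz_norm \<Psi> (\<lambda>z. (F (s n) \<circ> \<phi>) z - (G \<circ> \<phi>) z)) \<longlonglongrightarrow> 0"
  proof (rule tendstoI)
    fix e :: real assume e: "e > 0"
    \<comment> \<open>Chosen so that \<open>A * |f n|\<close> is
      \<open>|F (s n) - G| / (e / 2)\<close>.\<close>
    define A where "A = 4 * K / e"
    have A: "A > 0" using K e by (simp add: A_def)
    obtain \<delta> \<epsilon> where \<delta>: "0 < \<delta>" "\<delta> < 1" "0 < \<epsilon>"
      and est: "\<And>f r. f holomorphic_on ball 0 1 \<Longrightarrow> (\<And>r. 0 \<le> r \<Longrightarrow> r < 1 \<Longrightarrow> modular f r 1 \<le> 1) \<Longrightarrow>
         (\<And>z. cmod z \<le> 1 - \<delta> \<Longrightarrow> cmod (f z) \<le> \<epsilon>) \<Longrightarrow> 0 \<le> r \<Longrightarrow> r < 1 \<Longrightarrow> modular (f \<circ> \<phi>) r (1 / A) \<le> 1"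
      using uniform_smallness[OF lo A] by blast
    have "uniform_limit (cball 0 (1 - \<delta>)) (F \<circ> s) G sequentially"
      using \<delta> by (intro unif) auto
    hence "eventually (\<lambda>n. \<forall>z\<in>cball 0 (1 - \<delta>). dist ((F \<circ> s) n z) (G z) < 2 * K * \<epsilon>) sequentially"
      unfolding uniform_limit_iff using K \<delta> by simp
    thus "eventually (\<lambda>n. dist (hardy_orlicz_norm \<Psi> (\<lambda>z. (F (s n) \<circ> \<phi>) z - (G \<circ> \<phi>) z)) 0 < e) sequentially"
    proof eventually_elim
      case (elim n)
      have small: "cmod (f n z) \<le> \<epsilon>" if "cmod z \<le> 1 - \<delta>" for z
      proof -
        have "cmod (F (s n) z - G z) < 2 * K * \<epsilon>" using elim that by (auto simp: dist_norm)
        thus ?thesis unfolding f_def norm_divide norm_of_real using K by (simp add: field_simps)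
      qed
      have "hardy_orlicz_norm \<Psi> (\<lambda>z. (F (s n) \<circ> \<phi>) z - (G \<circ> \<phi>) z) \<le> e / 2"
      proof (rule hardy_orliczI(2)[OF hardy_orlicz_holomorphic[OF dH]])
        show "e / 2 > 0" using e by simp
        fix r :: real assume r: "0 \<le> r" "r < 1"
        have "modular (\<lambda>z. (F (s n) \<circ> \<phi>) z - (G \<circ> \<phi>) z) r (e / 2) = modular (f n \<circ> \<phi>) r (1 / A)"
          unfolding modular_def f_def o_def norm_divide norm_of_real using K e by (simp add: A_def field_simps)
        also have "\<dots> \<le> 1" by (rule est[OF fh mf small r])
        finally show "modular (\<lambda>z. (F (s n) \<circ> \<phi>) z - (G \<circ> \<phi>) z) r (e / 2) \<le> 1" .
      qed
      thus ?case using hardy_orlicz_norm_nonneg[OF dH[of n]] e by simp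
    qed
  qed
  thus "\<exists>s g. strict_mono s \<and> g \<in> hardy_orlicz \<Psi> \<and>
      (\<lambda>n. hardy_orlicz_norm \<Psi> (\<lambda>z. (F (s n) \<circ> \<phi>) z - g z)) \<longlonglongrightarrow> 0"
    using s comp_hardy_orlicz[OF GH] by blast
qed

end

theorem mainTheorem15:
  fixes \<phi> :: "complex \<Rightarrow> complex" and \<Psi> :: "real \<Rightarrow> real"
  assumes "\<phi> holomorphic_on ball 0 1" and "\<phi> ` ball 0 1 \<subseteq> ball 0 1"
    and "orlicz_function \<Psi>"
  shows "compact_composition \<Psi> \<phi> \<longleftrightarrow>
    (\<lambda>h. SUP \<xi>\<in>sphere 0 1. hardy_orlicz_norm \<Psi> (u_kernel \<xi> (1 - h) \<circ> \<phi>))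
      \<in> o[at_right 0](\<lambda>h. 1 / orlicz_inv \<Psi> (1 / h))"
proof -
  interpret orlicz_composition \<Psi> \<phi> by unfold_locales (rule assms)+
  show ?thesis using compact_imp_littleo littleo_imp_compact by blast
qed

end
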